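(* Let $n\ge1$, $\gamma\in(0,1)$, $T>0$. Let $\varphi\in L^1(\mathbb{R}^n)$ be a smooth real-valued function with $\int_{\mathbb{R}^n}\varphi(x)\,dx=1$, and assume that there exists a function $\varrho:(0,\infty)\to[0,\infty)$ such that $$\forall\alpha>0,\ \forall\xi\in\mathbb{R}^n,\qquad \frac{|\widehat\varphi(\alpha\xi)|}{E_{\gamma,1}(-|\xi|^2T^\gamma)}\le\varrho(\alpha).$$ For $g\in L^2(\mathbb{R}^n)$ and $\alpha>0$ let $u_\alpha$ be the solution of $\partial_t^\gamma u=\Delta u$ on $\mathbb{R}^n\times(0,T)$ with $u(\cdot,T)=\varphi_\alpha\star g$, where $\varphi_\alpha(x)=\alpha^{-n}\varphi(x/\alpha)$. Then the family $(u_\alpha)_{\alpha>0}$ defines a regularization method in $L^2(\mathbb{R}^n)$ for the problem of recovering $u(\cdot,0)$ from $g=u(\cdot,T)$, where $\partial_t^\gamma u=\Delta u$ on $\mathbb{R}^n\times(0,T)$.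
   Context: The Fourier transform is $\widehat f(\xi)=(2\pi)^{-n/2}\int_{\mathbb{R}^n}f(x)e^{-ix\cdot\xi}\,dx$. $\partial_t^\gamma$ is the Caputo derivative $\partial_t^\gamma u(t)=\frac{1}{\Gamma(1-\gamma)}\int_0^t\frac{u'(r)}{(t-r)^\gamma}\,dr$. $E_{\gamma,1}(z)=\sum_{k\ge0}\frac{z^k}{\Gamma(\gamma k+1)}$ is the Mittag-Leffler function. A solution of $\partial_t^\gamma u=\Delta u$ is understood through its frequency representation $\widehat u(\xi,t)=\widehat u(\xi,0)\,E_{\gamma,1}(-|\xi|^2t^\gamma)$, $t\in[0,T]$ (transform in $x$). Hence $$\widehat{u_\alpha}(\xi,t)=(2\pi)^{n/2}\,\frac{E_{\gamma,1}(-|\xi|^2t^\gamma)}{E_{\gamma,1}(-|\xi|^2T^\gamma)}\,\widehat\varphi(\alpha\xi)\,\widehat g(\xi),\qquad t\in[0,T].$$ "Regularization method in $L^2(\mathbb{R}^n)$" means: (a) for every $\alpha>0$ the linear map $g\mapsto u_\alpha(\cdot,0)$ is well defined and bounded from $L^2(\mathbb{R}^n)$ to $L^2(\mathbb{R}^n)$; and (b) for every exact datum $g=u(\cdot,T)$ arising from a solution $u$ with $u(\cdot,0)\in L^2(\mathbb{R}^n)$, one has $u_\alpha(\cdot,0)\to u(\cdot,0)$ in $L^2(\mathbb{R}^n)$ as $\alpha\downarrow0$. *)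

theory Defs
  imports "HOL-Analysis.Analysis"
begin

primrec times_cont_differentiable :: "nat \<Rightarrow> ('a::euclidean_space \<Rightarrow> real) \<Rightarrow> bool" where
  "times_cont_differentiable 0 f \<longleftrightarrow> continuous_on UNIV f"
| "times_cont_differentiable (Suc k) f \<longleftrightarrow>
     (\<forall>x. f differentiable (at x)) \<and>
     (\<forall>i\<in>Basis. times_cont_differentiable k (\<lambda>x. frechet_derivative f (at x) i))"

definition smooth :: "('a::euclidean_space \<Rightarrow> real) \<Rightarrow> bool" where
  "smooth f \<longleftrightarrow> (\<forall>k. times_cont_differentiable k f)"

definition mittag_leffler :: "real \<Rightarrow> real \<Rightarrow> real \<Rightarrow> real" where
  "mittag_leffler \<gamma> \<beta> z = (\<Sum>k. z ^ k / Gamma (\<gamma> * real k + \<beta>))"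

text \<open>Elements of \<open>L\<^sup>2\<close> are represented by Borel measurable functions, and identities between
  elements are stated almost everywhere. Every Lebesgue class has a Borel representative.\<close>

definition L2_space :: "('a::euclidean_space \<Rightarrow> complex) set" where
  "L2_space = {f. f \<in> borel_measurable lborel \<and> integrable lborel (\<lambda>x. (cmod (f x))\<^sup>2)}"

definition L2_norm :: "('a::euclidean_space \<Rightarrow> complex) \<Rightarrow> real" where
  "L2_norm f = sqrt (LINT x|lborel. (cmod (f x))\<^sup>2)"

text \<open>The membership requirements guarantee that \<open>L2_norm\<close> is applied to \<open>L\<^sup>2\<close> functions only;
  the Bochner integral of a non-integrable function is \<open>0\<close>.\<close>

definition L2_tendsto ::
  "('i \<Rightarrow> 'a::euclidean_space \<Rightarrow> complex) \<Rightarrow> ('a \<Rightarrow> complex) \<Rightarrow> 'i filter \<Rightarrow> bool" where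
  "L2_tendsto f l F \<longleftrightarrow>
     l \<in> L2_space \<and> (\<forall>\<^sub>F i in F. f i \<in> L2_space) \<and>
     ((\<lambda>i. L2_norm (\<lambda>x. f i x - l x)) \<longlongrightarrow> 0) F"

definition fourier :: "('a::euclidean_space \<Rightarrow> complex) \<Rightarrow> 'a \<Rightarrow> complex" where
  "fourier f \<xi> = complex_of_real ((2 * pi) powr (- real DIM('a) / 2)) *
     (LINT x|lborel. f x * exp (- (\<i> * complex_of_real (x \<bullet> \<xi>))))"

text \<open>The Fourier--Plancherel transform: \<open>F\<close> is the \<open>L\<^sup>2\<close> limit of the transforms of the
  truncations of \<open>f\<close> to balls, which are integrable.\<close>

definition has_L2_fourier ::
  "('a::euclidean_space \<Rightarrow> complex) \<Rightarrow> ('a \<Rightarrow> complex) \<Rightarrow> bool" where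
  "has_L2_fourier f F \<longleftrightarrow>
     f \<in> L2_space \<and>
     L2_tendsto (\<lambda>R. fourier (\<lambda>x. indicator (ball 0 R) x * f x)) F at_top"

text \<open>Solutions of \<open>\<partial>\<^sub>t\<^sup>\<gamma> u = \<Delta> u\<close> on \<open>[0, T]\<close> are understood through their frequency
  representation. The value of \<open>u\<close> at time \<open>t\<close> is the function \<open>u t\<close> of the space variable, and
  \<open>U t\<close> is its transform.\<close>

definition frac_heat_solution ::
  "real \<Rightarrow> real \<Rightarrow> (real \<Rightarrow> 'a::euclidean_space \<Rightarrow> complex) \<Rightarrow> bool" where
  "frac_heat_solution \<gamma> T u \<longleftrightarrow>
     (\<exists>U. \<forall>t\<in>{0..T}. has_L2_fourier (u t) (U t) \<and>
        (AE \<xi> in lborel. U t \<xi> =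
           U 0 \<xi> * complex_of_real (mittag_leffler \<gamma> 1 (- ((norm \<xi>)\<^sup>2) * t powr \<gamma>))))"

definition fun_convolution ::
  "('a::euclidean_space \<Rightarrow> complex) \<Rightarrow> ('a \<Rightarrow> complex) \<Rightarrow> 'a \<Rightarrow> complex" where
  "fun_convolution f g x = (LINT y|lborel. f (x - y) * g y)"

definition mollifier :: "('a::euclidean_space \<Rightarrow> real) \<Rightarrow> real \<Rightarrow> 'a \<Rightarrow> real" where
  "mollifier \<phi> \<alpha> x = \<phi> (x /\<^sub>R \<alpha>) / \<alpha> ^ DIM('a)"

text \<open>\<open>u\<close> is (a version of) \<open>u\<^sub>\<alpha>\<close> for the datum \<open>g\<close>.\<close>

definition mollified_solution ::
  "('a::euclidean_space \<Rightarrow> real) \<Rightarrow> real \<Rightarrow> real \<Rightarrow> real \<Rightarrow> ('a \<Rightarrow> complex) \<Rightarrow>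
   (real \<Rightarrow> 'a \<Rightarrow> complex) \<Rightarrow> bool" where
  "mollified_solution \<phi> \<gamma> T \<alpha> g u \<longleftrightarrow>
     frac_heat_solution \<gamma> T u \<and>
     (AE x in lborel. u T x =
        fun_convolution (\<lambda>y. complex_of_real (mollifier \<phi> \<alpha> y)) g x)"

text \<open>A map on \<open>L\<^sup>2\<close> is given by its graph \<open>S\<close> on representatives: \<open>S g w\<close> says that \<open>w\<close>
  represents the value at the class of \<open>g\<close>. The first two clauses say that the map is well
  defined on classes, the third that it is linear, the last that it is bounded into \<open>L\<^sup>2\<close>.\<close>

definition L2_bounded_linear_map ::
  "(('a::euclidean_space \<Rightarrow> complex) \<Rightarrow> ('a \<Rightarrow> complex) \<Rightarrow> bool) \<Rightarrow> bool" where
  "L2_bounded_linear_map S \<longleftrightarrow>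
     (\<forall>g\<in>L2_space. \<exists>w. S g w) \<and>
     (\<forall>g\<in>L2_space. \<forall>h\<in>L2_space. \<forall>v w.
        (AE x in lborel. g x = h x) \<longrightarrow> S g v \<longrightarrow> S h w \<longrightarrow> (AE x in lborel. v x = w x)) \<and>
     (\<forall>g\<in>L2_space. \<forall>h\<in>L2_space. \<forall>a b v w z.
        S g v \<longrightarrow> S h w \<longrightarrow> S (\<lambda>x. a * g x + b * h x) z \<longrightarrow>
        (AE x in lborel. z x = a * v x + b * w x)) \<and>
     (\<exists>C. \<forall>g\<in>L2_space. \<forall>w. S g w \<longrightarrow> w \<in> L2_space \<and> L2_norm w \<le> C * L2_norm g)"

text \<open>\<open>K f g\<close> says that \<open>g\<close> is the exact datum produced by the unknown \<open>f\<close>, and \<open>S \<alpha>\<close> is the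
  graph of the reconstruction map with parameter \<open>\<alpha>\<close>.\<close>

definition L2_regularization_method ::
  "(('a::euclidean_space \<Rightarrow> complex) \<Rightarrow> ('a \<Rightarrow> complex) \<Rightarrow> bool) \<Rightarrow>
   (real \<Rightarrow> ('a \<Rightarrow> complex) \<Rightarrow> ('a \<Rightarrow> complex) \<Rightarrow> bool) \<Rightarrow> bool" where
  "L2_regularization_method K S \<longleftrightarrow>
     (\<forall>\<alpha>>0. L2_bounded_linear_map (S \<alpha>)) \<and>
     (\<forall>f g w. f \<in> L2_space \<longrightarrow> K f g \<longrightarrow> (\<forall>\<alpha>>0. S \<alpha> g (w \<alpha>)) \<longrightarrow>
        L2_tendsto w f (at_right 0))"

end

theory Submission
  imports Defs "HOL-Probability.Characteristic_Functions"
begin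

text \<open>On the Fourier side the reconstruction is multiplication by
  \<open>(2\<pi>)\<^sup>n\<^sup>/\<^sup>2 \<phi>^(\<alpha>\<xi>) / E(-\<bar>\<xi>\<bar>\<^sup>2 T\<^sup>\<gamma>)\<close>, where \<open>E\<close> is the Mittag-Leffler function and \<open>\<phi>^\<close> the Fourier
  transform of \<open>\<phi>\<close>. Since \<open>E > 0\<close> on the negative half-line, the hypothesis bounds this symbol,
  so the operator is bounded by Plancherel's theorem. On exact data the factor \<open>E\<close> cancels and the
  symbol \<open>(2\<pi>)\<^sup>n\<^sup>/\<^sup>2 \<phi>^(\<alpha>\<xi>)\<close> is bounded and tends to \<open>1\<close> as \<open>\<alpha>\<close> tends to \<open>0\<close>, so that dominated
  convergence gives the limit. Because \<open>0 < E \<le> 1\<close>, every intermediate time slice is again an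
  \<open>L\<^sup>2\<close> function.

  The bounds on \<open>E\<close> come from the Grunwald--Letnikov scheme, which preserves positivity and converges
  to \<open>E\<close> by Tannery's theorem. In Plancherel's theorem the inequality \<open>\<parallel>f^\<parallel> \<le> \<parallel>f\<parallel>\<close> follows from
  Gaussian regularization and the elementary bound \<open>2ab \<le> a\<^sup>2 + b\<^sup>2\<close>. Fourier inversion is tested
  against indicators of boxes, and turns the inequality into an equality.\<close>

subsection \<open>Bounds for the Mittag-Leffler function on the negative half-line\<close>

text \<open>The series of E alternates on the negative half-line, so its sign cannot be read off
  termwise. The discretized equation shows it: (1 - z)^\<gamma> has leading coefficient 1 and
  nonpositive coefficients afterwards, so each new value is a nonnegative combination of earlier
  values plus a positive source. A limit of positive numbers may still be 0, so the scheme carries a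
  lower bound that converges to 1 / (1 + x \<Gamma>(1 - \<gamma>)) at the argument -x; this is what
  permits division by E. The bound 2ab <= a^2 + b^2 yields the sharp constant because the Gaussian
  kernel has mass 1 in each of its two variables. Inversion also makes the transform onto, which
  turns a formula for the transform at time t into a function \<open>u t\<close>. The bound \<rho>
  may blow up as \<alpha> tends to 0. Convergence therefore rests on a different bound, that of the
  filter by the L1 norm of \<phi>.\<close>

definition rising_coeff :: "real \<Rightarrow> nat \<Rightarrow> real" where
  "rising_coeff a n = pochhammer a n / fact n"

lemma rising_coeff_0 [simp]: "rising_coeff a 0 = 1"
  by (simp add: rising_coeff_def)

lemma rising_coeff_1 [simp]: "rising_coeff 1 n = 1"
  by (simp add: rising_coeff_def flip: pochhammer_fact)

lemma rising_coeff_Suc: "rising_coeff a (Suc n) = rising_coeff a n * (a + real n) / (real n + 1)"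
  by (simp add: rising_coeff_def pochhammer_Suc field_simps)

lemma rising_coeff_pos: "0 < a \<Longrightarrow> 0 < rising_coeff a n"
  by (simp add: rising_coeff_def pochhammer_pos)

text \<open>Multiplication of the power series (1 - z)^-a and (1 - z)^-b, whose coefficients these
  are; in Pochhammer form it is the Vandermonde identity.\<close>

lemma rising_coeff_convolution:
  "rising_coeff (a + b) n = (\<Sum>j\<le>n. rising_coeff a j * rising_coeff b (n - j))"
  unfolding rising_coeff_def pochhammer_binomial_sum sum_divide_distrib
  by (rule sum.cong) (auto simp: binomial_fact field_simps)

text \<open>These are the coefficients of (1 - z)^\<gamma> after the leading 1. Splitting off the
  factor -\<gamma> leaves a Pochhammer symbol of 1 - \<gamma>, which is nonnegative. This sign is
  what makes the scheme below preserve lower bounds.\<close>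

lemma rising_coeff_minus_nonpos:
  assumes "0 < \<gamma>" "\<gamma> < 1" "0 < n"
  shows "rising_coeff (- \<gamma>) n \<le> 0"
proof -
  obtain m where n: "n = Suc m" using assms(3) gr0_implies_Suc by blast
  have "0 \<le> pochhammer (1 - \<gamma>) m" using assms by (intro pochhammer_nonneg) simp
  then have "\<gamma> * pochhammer (- \<gamma> + 1) m \<ge> 0" using assms by (simp add: add.commute)
  then show ?thesis unfolding n rising_coeff_def pochhammer_rec by (simp add: divide_nonpos_pos)
qed

lemma rising_coeff_decreasing:
  assumes "0 < a" "a \<le> 1" "m \<le> n"
  shows "rising_coeff a n \<le> rising_coeff a m"
  using assms(3)
proof (induction rule: dec_induct)
  case (step k)
  have "rising_coeff a (Suc k) = rising_coeff a k * ((a + real k) / (real k + 1))"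
    by (simp add: rising_coeff_Suc)
  also have "\<dots> \<le> rising_coeff a k * 1"
    using assms rising_coeff_pos[OF assms(1), of k] by (intro mult_left_mono) auto
  finally show ?case using step by simp
qed simp

text \<open>With step h = 1/n this is h^a times the n-th coefficient of (1 - z)^(-a-1): the discrete
  counterpart at time 1 of t^a / \<Gamma>(a+1).\<close>

definition scaled_coeff :: "real \<Rightarrow> nat \<Rightarrow> real" where
  "scaled_coeff a n = rising_coeff (a + 1) n * real n powr (- a)"

lemma scaled_coeff_pos: "- 1 < a \<Longrightarrow> 0 < n \<Longrightarrow> 0 < scaled_coeff a n"
  by (simp add: scaled_coeff_def rising_coeff_pos)

text \<open>The quotient of consecutive terms is (1 + a/(k+1)) (k/(k+1))^a, and 1 + y <= exp y
  together with 1/(k+1) <= ln((k+1)/k) bounds it by 1. Monotonicity in n later supplies a majorant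
  independent of the step size.\<close>

lemma scaled_coeff_decreasing:
  assumes "0 \<le> a" "0 < m" "m \<le> n"
  shows "scaled_coeff a n \<le> scaled_coeff a m"
  using assms(3)
proof (induction rule: dec_induct)
  case (step k)
  define r where "r = real k"
  have r: "0 < r" using step assms by (simp add: r_def)
  have "1 - r / (r + 1) \<le> ln ((r + 1) / r)"
    using ln_le_minus_one[of "r / (r + 1)"] r by (simp add: ln_div)
  also have "1 - r / (r + 1) = 1 / (r + 1)" using r by (simp add: field_simps)
  finally have "a * (1 / (r + 1)) \<le> a * (ln (r + 1) - ln r)"
    using r assms(1) by (intro mult_left_mono) (auto simp: ln_div)
  then have "exp (a / (r + 1)) \<le> exp (a * (ln (r + 1) - ln r))" by simp
  with exp_ge_add_one_self[of "a / (r + 1)"]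
  have "1 + a / (r + 1) \<le> exp (a * (ln (r + 1) - ln r))" by (rule order_trans)
  also have "\<dots> = (r + 1) powr a * r powr (- a)"
    using r by (simp add: powr_def algebra_simps flip: exp_add)
  finally have "(1 + a / (r + 1)) * (r + 1) powr (- a)
      \<le> ((r + 1) powr a * r powr (- a)) * (r + 1) powr (- a)"
    by (rule mult_right_mono) simp
  also have "\<dots> = r powr (- a)" using r by (simp add: powr_minus)
  finally have *: "(1 + a / (r + 1)) * (r + 1) powr (- a) \<le> r powr (- a)" .
  have "scaled_coeff a (Suc k) = rising_coeff (a + 1) k * ((1 + a / (r + 1)) * (r + 1) powr (- a))"
    using r by (simp add: scaled_coeff_def rising_coeff_Suc r_def field_simps)
  also have "\<dots> \<le> rising_coeff (a + 1) k * r powr (- a)"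
    using * rising_coeff_pos[of "a + 1" k] assms by (intro mult_left_mono) auto
  also have "\<dots> = scaled_coeff a k" by (simp add: scaled_coeff_def r_def)
  finally show ?case using step by simp
qed simp

text \<open>Euler's limit for 1/\<Gamma>: \<open>rGamma_series\<close> carries one more Pochhammer
  factor a + 1 + n and one more power of n in the denominator, and the factor n / (a + 1 + n)
  corrects for both.\<close>

lemma scaled_coeff_LIMSEQ: "scaled_coeff a \<longlonglongrightarrow> inverse (Gamma (a + 1))"
proof -
  have "(\<lambda>n. real n / (a + 1 + real n)) \<longlonglongrightarrow> 1" by real_asymp
  from tendsto_mult[OF rGamma_series_LIMSEQ[of "a + 1"] this]
  have "(\<lambda>n. rGamma_series (a + 1) n * (real n / (a + 1 + real n))) \<longlonglongrightarrow> inverse (Gamma (a + 1))"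
    by (simp add: rGamma_inverse_Gamma)
  moreover have "\<forall>\<^sub>F n in sequentially.
      rGamma_series (a + 1) n * (real n / (a + 1 + real n)) = scaled_coeff a n"
    using eventually_gt_at_top[of "nat \<lceil>\<bar>a\<bar> + 1\<rceil>"]
  proof eventually_elim
    case (elim n)
    then have n: "real n > \<bar>a\<bar> + 1" by linarith
    have *: "exp ((a + 1) * ln (real n)) = real n powr a * real n"
      using n by (simp add: powr_def algebra_simps exp_add)
    show ?case
      using n unfolding rGamma_series_def scaled_coeff_def rising_coeff_def pochhammer_Suc
      by (simp add: * powr_minus divide_simps) (auto simp: algebra_simps pochhammer_Suc)
  qed
  ultimately show ?thesis by (rule Lim_transform_eventually)
qed

text \<open>Induction on n: one factor 1 + k is absorbed by raising the base from q to r = (1 +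
  q)/2, because (1 + k) (q/r)^k tends to 0.\<close>

lemma summable_poly_times_power:
  assumes "0 \<le> (q :: real)" "q < 1"
  shows "summable (\<lambda>k. (1 + real k) ^ n * q ^ k)"
  using assms
proof (induction n arbitrary: q)
  case 0
  then show ?case by simp
next
  case (Suc n)
  define r where "r = (1 + q) / 2"
  have r: "q < r" "r < 1" "0 < r" using Suc.prems by (auto simp: r_def)
  have qr: "norm (q / r) < 1" using r Suc.prems by simp
  have "(\<lambda>k. real k * (q / r) ^ k) \<longlonglongrightarrow> 0" by (rule powser_times_n_limit_0[OF qr])
  moreover have "(\<lambda>k. (q / r) ^ k) \<longlonglongrightarrow> 0" by (rule LIMSEQ_power_zero[OF qr])
  ultimately have "(\<lambda>k. (q / r) ^ k + real k * (q / r) ^ k) \<longlonglongrightarrow> 0"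
    by (auto intro: tendsto_eq_intros)
  then have "\<forall>\<^sub>F k in sequentially. (q / r) ^ k + real k * (q / r) ^ k < 1"
    by (rule order_tendstoD) simp
  then have "\<forall>\<^sub>F k in sequentially. norm ((1 + real k) ^ Suc n * q ^ k) \<le> (1 + real k) ^ n * r ^ k"
  proof eventually_elim
    case (elim k)
    have "(1 + real k) ^ Suc n * q ^ k
        = (1 + real k) ^ n * r ^ k * ((q / r) ^ k + real k * (q / r) ^ k)"
      using r by (simp add: power_divide field_simps)
    also have "\<dots> \<le> (1 + real k) ^ n * r ^ k * 1"
      using elim r by (intro mult_left_mono) auto
    finally show ?case using Suc.prems by simp
  qed
  then show ?case
    by (rule summable_comparison_test_ev) (use Suc.IH[of r] r in simp)
qed

text \<open>A product of factors (a + 1 + j)/(j + 1), each at most 1 + a. At fixed n this is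
  polynomial in a, so a geometric factor in k makes the series with a = \<gamma> k converge.\<close>

lemma rising_coeff_le_power:
  assumes "0 \<le> a"
  shows "\<bar>rising_coeff (a + 1) n\<bar> \<le> (1 + a) ^ n"
proof (induction n)
  case (Suc n)
  have *: "0 < rising_coeff (a + 1) n" using assms by (simp add: rising_coeff_pos)
  have "(a + 1 + real n) / (real n + 1) \<le> 1 + a"
    using assms by (simp add: field_simps)
  moreover have "\<bar>rising_coeff (a + 1) (Suc n)\<bar>
      = \<bar>rising_coeff (a + 1) n\<bar> * ((a + 1 + real n) / (real n + 1))"
    unfolding rising_coeff_Suc using assms * by (simp add: abs_mult)
  moreover have "\<bar>rising_coeff (a + 1) n\<bar> * ((a + 1 + real n) / (real n + 1)) \<le> (1 + a) ^ n * (1 + a)"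
    using Suc * assms calculation(1) by (intro mult_mono) auto
  ultimately show ?case by (metis power_Suc2)
qed simp

lemma summable_rising_coeff:
  assumes "0 < \<gamma>" "\<gamma> < 1" "0 \<le> q" "q < 1"
  shows "summable (\<lambda>k. q ^ k * rising_coeff (\<gamma> * real k + 1) n)"
proof (rule summable_comparison_test')
  show "summable (\<lambda>k. (1 + real k) ^ n * q ^ k)"
    using assms by (intro summable_poly_times_power)
  show "norm (q ^ k * rising_coeff (\<gamma> * real k + 1) n) \<le> (1 + real k) ^ n * q ^ k" for k
  proof -
    have "\<bar>rising_coeff (\<gamma> * real k + 1) n\<bar> \<le> (1 + \<gamma> * real k) ^ n"
      using assms by (intro rising_coeff_le_power) simp
    also have "\<dots> \<le> (1 + real k) ^ n"
      using assms by (intro power_mono) (auto simp: mult_left_le_one_le)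
    finally show ?thesis using assms by (simp add: abs_mult mult.commute mult_left_mono)
  qed
qed

text \<open>The Grunwald--Letnikov scheme for \<open>\<partial>\<^sub>t\<^sup>\<gamma> u = -\<lambda> u\<close> with step \<open>h\<close>, solved by the generating function
  \<open>(1 - z)\<^sup>\<gamma>\<^sup>-\<^sup>1 / ((1 - z)\<^sup>\<gamma> + \<mu>) = (\<Sum>k. (-\<mu>)\<^sup>k (1 - z)\<^sup>-\<^sup>\<gamma>\<^sup>k\<^sup>-\<^sup>1)\<close>, where \<open>\<mu> = \<lambda> h\<^sup>\<gamma>\<close>; note that
  \<open>rising_coeff a n\<close> is the coefficient of \<open>z\<^sup>n\<close> in \<open>(1 - z)\<^sup>-\<^sup>a\<close>.\<close>

definition discrete_ml :: "real \<Rightarrow> real \<Rightarrow> nat \<Rightarrow> real" where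
  "discrete_ml \<gamma> \<mu> n = (\<Sum>k. (- \<mu>) ^ k * rising_coeff (\<gamma> * real k + 1) n)"

context
  fixes \<gamma> \<mu> :: real
  assumes \<gamma>: "0 < \<gamma>" "\<gamma> < 1" and \<mu>: "0 \<le> \<mu>" "\<mu> < 1"
begin

lemma summable_discrete_ml:
  "summable (\<lambda>k. (- \<mu>) ^ k * rising_coeff (\<gamma> * real k + 1) n)"
proof (rule summable_rabs_cancel, rule summable_cong[THEN iffD1])
  have "rising_coeff (\<gamma> * real k + 1) n > 0" for k
    using \<gamma> by (intro rising_coeff_pos) (auto intro: add_nonneg_pos)
  then show "\<forall>\<^sub>F k in sequentially. \<mu> ^ k * rising_coeff (\<gamma> * real k + 1) n =
      \<bar>(- \<mu>) ^ k * rising_coeff (\<gamma> * real k + 1) n\<bar>"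
    using \<mu> by (simp add: abs_mult power_abs less_imp_le)
  show "summable (\<lambda>k. \<mu> ^ k * rising_coeff (\<gamma> * real k + 1) n)"
    using summable_rising_coeff \<gamma> \<mu> by blast
qed

text \<open>Multiplying the generating function by (1 - z)^-b shifts every exponent by b. The choice
  b = \<gamma> gives the fractional sum and b = -\<gamma> the fractional difference; both amount to
  moving the summation index k by one.\<close>

lemma discrete_ml_convolution:
  "(\<Sum>j\<le>n. discrete_ml \<gamma> \<mu> j * rising_coeff b (n - j))
    = (\<Sum>k. (- \<mu>) ^ k * rising_coeff (\<gamma> * real k + 1 + b) n)"
proof -
  have "(\<Sum>j\<le>n. discrete_ml \<gamma> \<mu> j * rising_coeff b (n - j))
      = (\<Sum>j\<le>n. \<Sum>k. (- \<mu>) ^ k * rising_coeff (\<gamma> * real k + 1) j * rising_coeff b (n - j))"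
    unfolding discrete_ml_def by (simp add: suminf_mult2[OF summable_discrete_ml])
  also have "\<dots> = (\<Sum>k. \<Sum>j\<le>n. (- \<mu>) ^ k * rising_coeff (\<gamma> * real k + 1) j * rising_coeff b (n - j))"
    by (rule suminf_sum[symmetric]) (intro summable_mult2 summable_discrete_ml)
  finally show ?thesis by (simp add: rising_coeff_convolution[of _ b n] sum_distrib_left mult.assoc)
qed

text \<open>Discrete form of the Volterra equation u = 1 - \<lambda> I^\<gamma> u, with I^\<gamma>
  the fractional integral: the term k = 0 contributes the coefficient 1 of (1 - z)^-1, and the
  others reproduce the series after an index shift.\<close>

lemma discrete_ml_fractional_sum:
  "discrete_ml \<gamma> \<mu> n = 1 - \<mu> * (\<Sum>j\<le>n. discrete_ml \<gamma> \<mu> j * rising_coeff \<gamma> (n - j))"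
proof -
  have *: "(- \<mu>) ^ Suc k * rising_coeff (\<gamma> * real (Suc k) + 1) n
      = - \<mu> * ((- \<mu>) ^ k * rising_coeff (\<gamma> * real k + 1 + \<gamma>) n)" for k
    by (simp add: algebra_simps)
  have "discrete_ml \<gamma> \<mu> n = 1 + (\<Sum>k. (- \<mu>) ^ Suc k * rising_coeff (\<gamma> * real (Suc k) + 1) n)"
    unfolding discrete_ml_def by (subst suminf_split_head[OF summable_discrete_ml]) simp
  also have "(\<Sum>k. (- \<mu>) ^ Suc k * rising_coeff (\<gamma> * real (Suc k) + 1) n)
      = - \<mu> * (\<Sum>k. (- \<mu>) ^ k * rising_coeff (\<gamma> * real k + 1 + \<gamma>) n)"
  \<comment> \<open>Summability of the shifted series comes from cancelling the factor -\<mu>; for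
    \<mu> = 0 both sides are 0.\<close>
  proof (cases "\<mu> = 0")
    case False
    have "summable (\<lambda>k. (- \<mu>) ^ Suc k * rising_coeff (\<gamma> * real (Suc k) + 1) n)"
      using summable_discrete_ml[of n] by (subst summable_Suc_iff)
    then have "summable (\<lambda>k. (- \<mu>) ^ k * rising_coeff (\<gamma> * real k + 1 + \<gamma>) n)"
      unfolding * using False by (subst (asm) summable_cmult_iff) simp
    then show ?thesis unfolding * by (rule suminf_mult)
  qed simp
  finally show ?thesis by (simp add: discrete_ml_convolution)
qed

text \<open>The scheme proper, a discrete Caputo equation. The term k = 0 is the coefficient of (1 -
  z)^(\<gamma>-1), the fractional difference of the constant initial value 1.\<close>

lemma discrete_ml_fractional_difference:
  "(\<Sum>j\<le>n. discrete_ml \<gamma> \<mu> j * rising_coeff (- \<gamma>) (n - j))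
    = rising_coeff (1 - \<gamma>) n - \<mu> * discrete_ml \<gamma> \<mu> n"
proof -
  have *: "(- \<mu>) ^ Suc k * rising_coeff (\<gamma> * real (Suc k) + 1 + - \<gamma>) n
      = - \<mu> * ((- \<mu>) ^ k * rising_coeff (\<gamma> * real k + 1) n)" for k
    by (simp add: algebra_simps)
  have "summable (\<lambda>k. (- \<mu>) ^ Suc k * rising_coeff (\<gamma> * real (Suc k) + 1 + - \<gamma>) n)"
    unfolding * by (intro summable_mult summable_discrete_ml)
  then have "summable (\<lambda>k. (- \<mu>) ^ k * rising_coeff (\<gamma> * real k + 1 + - \<gamma>) n)"
    by (subst (asm) summable_Suc_iff)
  then show ?thesis
    unfolding discrete_ml_convolution
    using suminf_split_head[of "\<lambda>k. (- \<mu>) ^ k * rising_coeff (\<gamma> * real k + 1 + - \<gamma>) n"]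
    unfolding * suminf_mult[OF summable_discrete_ml] discrete_ml_def by simp
qed

text \<open>Solved for the value at n, the difference equation has nonnegative weights
  \<open>- rising_coeff (- \<gamma>) (n - j)\<close> on the earlier values, so a common lower bound
  of these passes to n. Since \<open>rising_coeff (1 - \<gamma>)\<close> decreases, so do the bounds
  of the induction hypothesis, and the bound for n serves for all j < n.\<close>

lemma discrete_ml_lower_bound:
  "rising_coeff (1 - \<gamma>) n / (\<mu> + rising_coeff (1 - \<gamma>) n) \<le> discrete_ml \<gamma> \<mu> n"
proof (induction n rule: less_induct)
  case (less n)
  define c where "c = rising_coeff (1 - \<gamma>)"
  define u where "u = discrete_ml \<gamma> \<mu>"
  \<comment> \<open>The fixed point of the recursion: l solves c n - l (c n - 1) = (1 + \<mu>)
    l.\<close>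
  define l where "l = c n / (\<mu> + c n)"
  have c: "0 < c m" for m unfolding c_def using \<gamma> by (intro rising_coeff_pos) simp
  have ul: "l \<le> u j" if "j < n" for j
  proof -
    have "c n \<le> c j" unfolding c_def using \<gamma> that by (intro rising_coeff_decreasing) auto
    then have "c n / (\<mu> + c n) \<le> c j / (\<mu> + c j)"
      using c[of n] c[of j] \<mu> by (simp add: divide_simps mult_left_mono algebra_simps)
    then show ?thesis using less[OF that] by (simp add: l_def c_def u_def)
  qed
  have split: "(\<Sum>j\<le>n. f j * rising_coeff (- \<gamma>) (n - j))
      = f n + (\<Sum>j<n. f j * rising_coeff (- \<gamma>) (n - j))" for f :: "nat \<Rightarrow> real"
    by (simp add: lessThan_Suc_atMost[symmetric])
  \<comment> \<open>The weights up to n sum to c n, because (1 - z)^-1 (1 - z)^\<gamma> = (1 -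
    z)^(\<gamma>-1).\<close>
  have one: "(\<Sum>j\<le>n. 1 * rising_coeff (- \<gamma>) (n - j)) = c n"
    using rising_coeff_convolution[of 1 "- \<gamma>" n] by (simp add: c_def)
  have "(1 + \<mu>) * u n = c n - (\<Sum>j<n. u j * rising_coeff (- \<gamma>) (n - j))"
    using discrete_ml_fractional_difference[of n] split[of u] by (simp add: u_def c_def algebra_simps)
  also have "\<dots> \<ge> c n - (\<Sum>j<n. l * rising_coeff (- \<gamma>) (n - j))"
    using \<gamma> ul by (intro diff_left_mono sum_mono mult_right_mono_neg rising_coeff_minus_nonpos) auto
  also have "(\<Sum>j<n. l * rising_coeff (- \<gamma>) (n - j)) = l * (c n - 1)"
    using one split[of "\<lambda>_. 1"] by (simp add: sum_distrib_left[symmetric])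
  also have "c n - l * (c n - 1) = (1 + \<mu>) * l"
    unfolding l_def using c[of n] \<mu> by (simp add: field_simps)
  finally have "l \<le> u n" using \<mu> by simp
  then show ?case by (simp add: l_def u_def c_def)
qed

text \<open>By the lower bound all values are nonnegative, so the fractional sum subtracted from 1
  is nonnegative.\<close>

lemma discrete_ml_le_one: "discrete_ml \<gamma> \<mu> n \<le> 1"
proof -
  have c: "0 < rising_coeff (1 - \<gamma>) m" for m using \<gamma> by (intro rising_coeff_pos) simp
  have "0 \<le> discrete_ml \<gamma> \<mu> j" for j
  proof -
    have "0 \<le> rising_coeff (1 - \<gamma>) j / (\<mu> + rising_coeff (1 - \<gamma>) j)"
      using c[of j] \<mu> by (intro divide_nonneg_nonneg) auto
    then show ?thesis using discrete_ml_lower_bound[of j] by linarith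
  qed
  then have "0 \<le> (\<Sum>j\<le>n. discrete_ml \<gamma> \<mu> j * rising_coeff \<gamma> (n - j))"
    using \<gamma> by (intro sum_nonneg mult_nonneg_nonneg less_imp_le[OF rising_coeff_pos]) auto
  then show ?thesis using \<mu> by (simp add: discrete_ml_fractional_sum[of n])
qed

end

section \<open>Convergence of the scheme to the Mittag-Leffler function\<close>

context
  fixes \<gamma> x :: real
  assumes \<gamma>: "0 < \<gamma>" "\<gamma> < 1" and x: "0 \<le> x"
begin

text \<open>Time 1 is reached with n steps of length 1/n, so \<mu> = x n^-\<gamma>. The bounds for
  the scheme are stated for \<mu> < 1.\<close>

lemma eventually_mesh_small: "\<forall>\<^sub>F n in sequentially. x * real n powr (- \<gamma>) < 1 \<and> 0 < n"
proof -
  have "(\<lambda>n. x * real n powr (- \<gamma>)) \<longlonglongrightarrow> 0" using \<gamma> by real_asymp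
  then have "\<forall>\<^sub>F n in sequentially. x * real n powr (- \<gamma>) < 1" by (rule order_tendstoD) simp
  then show ?thesis using eventually_gt_at_top[of 0] by eventually_elim auto
qed

text \<open>Termwise the limit is Euler's formula for 1/\<Gamma>. For n >= m the k-th term is in
  absolute value at most its value at m, by monotonicity of \<open>scaled_coeff\<close>, so one
  summable majorant serves all finer step sizes in Tannery's theorem.\<close>

lemma discrete_ml_LIMSEQ:
  "(\<lambda>n. discrete_ml \<gamma> (x * real n powr (- \<gamma>)) n) \<longlonglongrightarrow> mittag_leffler \<gamma> 1 (- x)"
proof -
  let ?a = "\<lambda>k n. (- x) ^ k * scaled_coeff (\<gamma> * real k) n"
  \<comment> \<open>Any step size with \<mu> < 1 will do: there the series converges absolutely and
    becomes the majorant.\<close>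
  obtain m where m: "0 < m" "x * real m powr (- \<gamma>) < 1"
    using eventually_happens'[OF sequentially_bot eventually_mesh_small] by blast
  have a_eq: "?a k n = (- (x * real n powr (- \<gamma>))) ^ k * rising_coeff (\<gamma> * real k + 1) n"
    if "0 < n" for k n
  proof -
    have "real n powr (- (\<gamma> * real k)) = (real n powr (- \<gamma>)) ^ k"
      using that by (simp add: powr_powr flip: powr_realpow)
    moreover have "(- (x * real n powr (- \<gamma>))) ^ k = (- x) ^ k * (real n powr (- \<gamma>)) ^ k"
      by (metis mult_minus_left power_mult_distrib)
    ultimately show ?thesis by (simp add: scaled_coeff_def)
  qed
  have norm_a: "norm (?a k n) = x ^ k * scaled_coeff (\<gamma> * real k) n" if "0 < n" for k n
  proof -
    have "- 1 < \<gamma> * real k" using \<gamma> by (smt (verit) mult_nonneg_nonneg of_nat_0_le_iff)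
    then show ?thesis
      using scaled_coeff_pos[of "\<gamma> * real k" n] that x by (simp add: abs_mult power_abs)
  qed
  have 1: "?a k \<longlonglongrightarrow> (- x) ^ k * inverse (Gamma (\<gamma> * real k + 1))" for k
    by (intro tendsto_intros scaled_coeff_LIMSEQ)
  have 2: "\<forall>\<^sub>F (k, n) in sequentially \<times>\<^sub>F sequentially. norm (?a k n) \<le> norm (?a k m)"
  proof -
    have "\<forall>\<^sub>F p in sequentially \<times>\<^sub>F sequentially. m \<le> snd p"
      by (rule eventually_compose_filterlim[OF eventually_ge_at_top filterlim_snd])
    then show ?thesis
    proof eventually_elim
      case (elim p)
      have "scaled_coeff (\<gamma> * real (fst p)) (snd p) \<le> scaled_coeff (\<gamma> * real (fst p)) m"
        using elim m \<gamma> by (intro scaled_coeff_decreasing) auto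
      then show ?case
        using norm_a m elim x by (auto simp: case_prod_beta intro!: mult_left_mono)
    qed
  qed
  have "summable (\<lambda>k. (x * real m powr (- \<gamma>)) ^ k * rising_coeff (\<gamma> * real k + 1) m)"
    using m x \<gamma> by (intro summable_rising_coeff) auto
  moreover have "(x * real m powr (- \<gamma>)) ^ k * rising_coeff (\<gamma> * real k + 1) m = norm (?a k m)" for k
  proof -
    have "0 < rising_coeff (\<gamma> * real k + 1) m"
      using \<gamma> by (intro rising_coeff_pos) (auto intro: add_nonneg_pos)
    then show ?thesis unfolding a_eq[OF m(1)] using x by (simp add: abs_mult power_abs)
  qed
  ultimately have 3: "summable (\<lambda>k. norm (?a k m))" by simp
  from tannerys_theorem[OF 1 2 3 sequentially_bot]
  have 4: "(\<lambda>n. suminf (\<lambda>k. ?a k n)) \<longlonglongrightarrow> (\<Sum>k. (- x) ^ k * inverse (Gamma (\<gamma> * real k + 1)))"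
    by blast
  have "\<forall>\<^sub>F n in sequentially. suminf (\<lambda>k. ?a k n) = discrete_ml \<gamma> (x * real n powr (- \<gamma>)) n"
    using eventually_gt_at_top[of 0]
    by eventually_elim (simp add: a_eq discrete_ml_def)
  from Lim_transform_eventually[OF 4 this]
  show "(\<lambda>n. discrete_ml \<gamma> (x * real n powr (- \<gamma>)) n) \<longlonglongrightarrow> mittag_leffler \<gamma> 1 (- x)"
    by (simp add: mittag_leffler_def divide_inverse)
qed

lemma mittag_leffler_le_one: "mittag_leffler \<gamma> 1 (- x) \<le> 1"
proof (rule tendsto_upperbound[OF discrete_ml_LIMSEQ])
  show "\<forall>\<^sub>F n in sequentially. discrete_ml \<gamma> (x * real n powr (- \<gamma>)) n \<le> 1"
    using eventually_mesh_small by eventually_elim (use \<gamma> x in \<open>auto intro: discrete_ml_le_one\<close>)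
qed simp

text \<open>Divided through by \<open>rising_coeff (1 - \<gamma>) n\<close>, the discrete bound
  depends only on \<open>x / scaled_coeff (- \<gamma>) n\<close>, whose limit is x \<Gamma>(1 -
  \<gamma>). The explicit bound keeps the limit away from 0.\<close>

lemma mittag_leffler_lower_bound:
  "1 / (1 + x * Gamma (1 - \<gamma>)) \<le> mittag_leffler \<gamma> 1 (- x)"
proof (rule tendsto_le[OF sequentially_bot discrete_ml_LIMSEQ])
  have G: "0 < Gamma (1 - \<gamma>)" using \<gamma> by (intro Gamma_real_pos) simp
  have "scaled_coeff (- \<gamma>) \<longlonglongrightarrow> inverse (Gamma (- \<gamma> + 1))" by (rule scaled_coeff_LIMSEQ)
  then have *: "scaled_coeff (- \<gamma>) \<longlonglongrightarrow> inverse (Gamma (1 - \<gamma>))" by (simp add: add.commute)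
  have "x * Gamma (1 - \<gamma>) \<ge> 0" using x G by simp
  then show "(\<lambda>n. 1 / (1 + x / scaled_coeff (- \<gamma>) n)) \<longlonglongrightarrow> 1 / (1 + x * Gamma (1 - \<gamma>))"
    using G by (auto intro!: tendsto_eq_intros * simp: divide_inverse)
  show "\<forall>\<^sub>F n in sequentially. 1 / (1 + x / scaled_coeff (- \<gamma>) n)
      \<le> discrete_ml \<gamma> (x * real n powr (- \<gamma>)) n"
    using eventually_mesh_small
  proof eventually_elim
    case (elim n)
    have c: "0 < rising_coeff (1 - \<gamma>) n" using \<gamma> by (intro rising_coeff_pos) simp
    have eq: "scaled_coeff (- \<gamma>) n = rising_coeff (1 - \<gamma>) n * real n powr \<gamma>"
      by (simp add: scaled_coeff_def add.commute)
    have n: "0 < real n powr \<gamma>" using elim by simp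
    have "rising_coeff (1 - \<gamma>) n / (x * real n powr (- \<gamma>) + rising_coeff (1 - \<gamma>) n)
        = 1 / (1 + x / scaled_coeff (- \<gamma>) n)"
      unfolding eq powr_minus using c n x by (simp add: divide_simps)
    then show ?case
      using discrete_ml_lower_bound[of \<gamma> "x * real n powr (- \<gamma>)" n] \<gamma> x elim by simp
  qed
qed

lemma mittag_leffler_pos: "0 < mittag_leffler \<gamma> 1 (- x)"
proof -
  have "0 < Gamma (1 - \<gamma>)" using \<gamma> by (intro Gamma_real_pos) simp
  then have "0 < 1 / (1 + x * Gamma (1 - \<gamma>))" using x by (auto intro: divide_pos_pos add_pos_nonneg)
  then show ?thesis using mittag_leffler_lower_bound by linarith
qed

end

lemma mittag_leffler_measurable [measurable]: "mittag_leffler \<gamma> \<beta> \<in> borel_measurable borel"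
  unfolding mittag_leffler_def[abs_def] by measurable

subsection \<open>The space of square integrable functions\<close>

lemma L2_space_iff:
  "f \<in> L2_space \<longleftrightarrow> f \<in> borel_measurable borel \<and> (\<integral>\<^sup>+x. ennreal ((cmod (f x))\<^sup>2) \<partial>lborel) < \<infinity>"
  unfolding L2_space_def by (auto simp: integrable_iff_bounded)

lemma L2_space_measurable [measurable_dest]: "f \<in> L2_space \<Longrightarrow> f \<in> borel_measurable borel"
  by (simp add: L2_space_iff)

lemma L2_space_integrable: "f \<in> L2_space \<Longrightarrow> integrable lborel (\<lambda>x. (cmod (f x))\<^sup>2)"
  by (simp add: L2_space_def)

lemma L2_norm_nonneg [simp]: "0 \<le> L2_norm f"
  by (simp add: L2_norm_def)

lemma L2_norm_square: "(L2_norm f)\<^sup>2 = (LINT x|lborel. (cmod (f x))\<^sup>2)"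
  by (simp add: L2_norm_def)

lemma nn_integral_eq_L2_norm:
  "f \<in> L2_space \<Longrightarrow> (\<integral>\<^sup>+x. ennreal ((cmod (f x))\<^sup>2) \<partial>lborel) = ennreal ((L2_norm f)\<^sup>2)"
  unfolding L2_norm_square by (rule nn_integral_eq_integral) (auto simp: L2_space_integrable)

text \<open>A Bochner integral of a non-integrable function is 0, so a bound on
  \<open>L2_norm\<close> says nothing about membership. A bound on the nonnegative integral gives
  both at once, and it is the form in which Fatou's lemma delivers estimates.\<close>

lemma L2_norm_leI:
  assumes "f \<in> borel_measurable borel" "0 \<le> C"
    and "(\<integral>\<^sup>+x. ennreal ((cmod (f x))\<^sup>2) \<partial>lborel) \<le> ennreal (C\<^sup>2)"
  shows "f \<in> L2_space" and "L2_norm f \<le> C"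
proof -
  show f: "f \<in> L2_space"
    using assms by (auto simp: L2_space_iff intro: le_less_trans)
  have "(L2_norm f)\<^sup>2 \<le> C\<^sup>2"
    using assms(3) nn_integral_eq_L2_norm[OF f] by simp
  then show "L2_norm f \<le> C" using assms(2) by (rule power2_le_imp_le)
qed

lemma L2_bound:
  assumes "f \<in> L2_space" "g \<in> borel_measurable borel" "0 \<le> C"
    and "AE x in lborel. cmod (g x) \<le> C * cmod (f x)"
  shows "g \<in> L2_space" and "L2_norm g \<le> C * L2_norm f"
proof -
  have "(\<integral>\<^sup>+x. ennreal ((cmod (g x))\<^sup>2) \<partial>lborel) \<le> (\<integral>\<^sup>+x. ennreal (C\<^sup>2) * ennreal ((cmod (f x))\<^sup>2) \<partial>lborel)"
    using assms(4)
    by (intro nn_integral_mono_AE) (auto simp flip: ennreal_mult' power_mult_distrib intro!: power_mono)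
  also have "\<dots> = ennreal ((C * L2_norm f)\<^sup>2)"
    using assms(1) by (subst nn_integral_cmult)
      (auto simp: nn_integral_eq_L2_norm power_mult_distrib simp flip: ennreal_mult')
  finally show "g \<in> L2_space" "L2_norm g \<le> C * L2_norm f"
    using L2_norm_leI[of g "C * L2_norm f"] assms by auto
qed

lemma L2_norm_cong_AE:
  assumes "f \<in> borel_measurable borel" "g \<in> borel_measurable borel" "AE x in lborel. f x = g x"
  shows "L2_norm f = L2_norm g"
proof -
  have "(LINT x|lborel. (cmod (f x))\<^sup>2) = (LINT x|lborel. (cmod (g x))\<^sup>2)"
    using assms by (intro integral_cong_AE) auto
  then show ?thesis by (simp add: L2_norm_def)
qed

lemma L2_space_cong_AE:
  assumes "f \<in> L2_space" "g \<in> borel_measurable borel" "AE x in lborel. f x = g x"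
  shows "g \<in> L2_space"
  by (rule L2_bound(1)[OF assms(1,2), of 1]) (use assms(3) in auto)

lemma L2_norm_eq_0:
  assumes "f \<in> L2_space" "L2_norm f = 0"
  shows "AE x in lborel. f x = 0"
  using nn_integral_eq_L2_norm[OF assms(1)] assms by (auto simp: nn_integral_0_iff_AE)

lemma L2_scale:
  assumes "f \<in> L2_space"
  shows "(\<lambda>x. c * f x) \<in> L2_space" and "L2_norm (\<lambda>x. c * f x) = cmod c * L2_norm f"
proof -
  show "(\<lambda>x. c * f x) \<in> L2_space"
    by (rule L2_bound(1)[OF assms, of _ "cmod c"]) (use assms in \<open>auto simp: norm_mult\<close>)
  show "L2_norm (\<lambda>x. c * f x) = cmod c * L2_norm f"
    by (simp add: L2_norm_def norm_mult power_mult_distrib real_sqrt_mult)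
qed

text \<open>Minkowski's inequality from a weighted form of 2st <= s^2 + t^2: with weights q/p and
  p/q, where p and q are essentially the two norms, the integrated bound is (p + q)^2.\<close>

lemma L2_add:
  assumes f: "f \<in> L2_space" and g: "g \<in> L2_space"
  shows "(\<lambda>x. f x + g x) \<in> L2_space" and "L2_norm (\<lambda>x. f x + g x) \<le> L2_norm f + L2_norm g"
proof -
  have [measurable]: "f \<in> borel_measurable borel" "g \<in> borel_measurable borel"
    using f g by auto
  have *: "(\<lambda>x. f x + g x) \<in> L2_space \<and> L2_norm (\<lambda>x. f x + g x) \<le> L2_norm f + L2_norm g + e"
    if "0 < e" for e
  proof -
    \<comment> \<open>The padding e/2 keeps p and q positive when a norm vanishes; e is sent to 0 at
      the end.\<close>
    define p where "p = L2_norm f + e / 2"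
    define q where "q = L2_norm g + e / 2"
    have pq: "0 < p" "0 < q" "L2_norm f \<le> p" "L2_norm g \<le> q"
      using that L2_norm_nonneg[of f] L2_norm_nonneg[of g] by (auto simp: p_def q_def simp del: L2_norm_nonneg)
    have pt: "(cmod (a + b))\<^sup>2 \<le> (1 + q / p) * (cmod a)\<^sup>2 + (1 + p / q) * (cmod b)\<^sup>2" for a b :: complex
    proof -
      define s t where "s = cmod a" and "t = cmod b"
      have "0 \<le> (q * s - p * t)\<^sup>2 / (p * q)" using pq by simp
      also have "\<dots> = q / p * s\<^sup>2 + p / q * t\<^sup>2 - 2 * s * t"
        using pq by (simp add: field_simps power2_eq_square)
      finally have "(s + t)\<^sup>2 \<le> (1 + q / p) * s\<^sup>2 + (1 + p / q) * t\<^sup>2"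
        by (simp add: power2_sum algebra_simps)
      moreover have "(cmod (a + b))\<^sup>2 \<le> (s + t)\<^sup>2"
        unfolding s_def t_def by (intro power_mono norm_triangle_ineq) simp
      ultimately show ?thesis unfolding s_def t_def by (rule order_trans[rotated])
    qed
    have "(\<integral>\<^sup>+x. ennreal ((cmod (f x + g x))\<^sup>2) \<partial>lborel)
      \<le> (\<integral>\<^sup>+x. ennreal (1 + q / p) * ennreal ((cmod (f x))\<^sup>2)
          + ennreal (1 + p / q) * ennreal ((cmod (g x))\<^sup>2) \<partial>lborel)"
      using pq pt by (intro nn_integral_mono) (auto simp flip: ennreal_mult' ennreal_plus intro!: ennreal_leI)
    also have "\<dots> = ennreal (1 + q / p) * ennreal ((L2_norm f)\<^sup>2) + ennreal (1 + p / q) * ennreal ((L2_norm g)\<^sup>2)"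
      using f g by (simp add: nn_integral_add nn_integral_cmult nn_integral_eq_L2_norm)
    also have "\<dots> = ennreal ((1 + q / p) * (L2_norm f)\<^sup>2 + (1 + p / q) * (L2_norm g)\<^sup>2)"
      using pq by (subst (1 2) ennreal_mult'[symmetric], simp, simp, subst ennreal_plus[symmetric]) auto
    also have "\<dots> \<le> ennreal ((p + q)\<^sup>2)"
    proof (rule ennreal_leI)
      have "(1 + q / p) * (L2_norm f)\<^sup>2 + (1 + p / q) * (L2_norm g)\<^sup>2
          \<le> (1 + q / p) * p\<^sup>2 + (1 + p / q) * q\<^sup>2"
        using pq by (intro add_mono mult_left_mono power_mono) auto
      also have "\<dots> = (p + q)\<^sup>2" using pq by (simp add: field_simps power2_eq_square)
      finally show "(1 + q / p) * (L2_norm f)\<^sup>2 + (1 + p / q) * (L2_norm g)\<^sup>2 \<le> (p + q)\<^sup>2" .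
    qed
    finally show ?thesis
      using L2_norm_leI[of "\<lambda>x. f x + g x" "p + q"] pq by (simp add: p_def q_def)
  qed
  show "(\<lambda>x. f x + g x) \<in> L2_space" using *[of 1] by simp
  show "L2_norm (\<lambda>x. f x + g x) \<le> L2_norm f + L2_norm g"
    by (rule field_le_epsilon) (use * in blast)
qed

lemma L2_uminus:
  assumes "f \<in> L2_space"
  shows "(\<lambda>x. - f x) \<in> L2_space" and "L2_norm (\<lambda>x. - f x) = L2_norm f"
  using L2_scale[OF assms, of "- 1"] by simp_all

lemma L2_diff:
  assumes "f \<in> L2_space" and "g \<in> L2_space"
  shows "(\<lambda>x. f x - g x) \<in> L2_space" and "L2_norm (\<lambda>x. f x - g x) \<le> L2_norm f + L2_norm g"
  using L2_add[OF assms(1) L2_uminus(1)[OF assms(2)]] L2_uminus(2)[OF assms(2)] by simp_all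

lemma L2_norm_diff_commute: "L2_norm (\<lambda>x. f x - g x) = L2_norm (\<lambda>x. g x - f x)"
  by (simp add: L2_norm_def norm_minus_commute)

lemma L2_norm_diff_triangle:
  assumes "f \<in> L2_space" "g \<in> L2_space" "h \<in> L2_space"
  shows "L2_norm (\<lambda>x. f x - h x) \<le> L2_norm (\<lambda>x. f x - g x) + L2_norm (\<lambda>x. g x - h x)"
  using L2_add(2)[OF L2_diff(1)[OF assms(1,2)] L2_diff(1)[OF assms(2,3)]] by simp

lemma L2_norm_le_diff:
  assumes "f \<in> L2_space" "g \<in> L2_space"
  shows "L2_norm f \<le> L2_norm (\<lambda>x. f x - g x) + L2_norm g"
  using L2_add(2)[OF L2_diff(1)[OF assms] assms(2)] by simp

lemma L2_AE_eqI:
  assumes "f \<in> L2_space" "g \<in> L2_space" "\<And>e. 0 < e \<Longrightarrow> L2_norm (\<lambda>x. f x - g x) \<le> e"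
  shows "AE x in lborel. f x = g x"
proof -
  have "L2_norm (\<lambda>x. f x - g x) \<le> 0" by (rule field_le_epsilon) (use assms(3) in auto)
  then have "L2_norm (\<lambda>x. f x - g x) = 0" using L2_norm_nonneg by (rule antisym)
  from L2_norm_eq_0[OF L2_diff(1)[OF assms(1,2)] this] show ?thesis by simp
qed

lemma L2_tendsto_unique:
  assumes "L2_tendsto f l F" "L2_tendsto f l' F" "F \<noteq> bot"
  shows "AE x in lborel. l x = l' x"
proof (rule L2_AE_eqI)
  show l: "l \<in> L2_space" "l' \<in> L2_space" using assms by (auto simp: L2_tendsto_def)
  have lim: "((\<lambda>i. L2_norm (\<lambda>x. f i x - l x) + L2_norm (\<lambda>x. f i x - l' x)) \<longlongrightarrow> 0) F"
    using assms by (auto simp: L2_tendsto_def intro: tendsto_eq_intros)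
  have ev: "\<forall>\<^sub>F i in F. L2_norm (\<lambda>x. l x - l' x) \<le> L2_norm (\<lambda>x. f i x - l x) + L2_norm (\<lambda>x. f i x - l' x)"
  proof -
    have "\<forall>\<^sub>F i in F. f i \<in> L2_space" using assms by (simp add: L2_tendsto_def)
    then show ?thesis
    proof eventually_elim
      case (elim i)
      then show ?case using L2_norm_diff_triangle[OF l(1) elim l(2)] L2_norm_diff_commute[of l "f i"] by simp
    qed
  qed
  have "L2_norm (\<lambda>x. l x - l' x) \<le> 0" by (rule tendsto_lowerbound[OF lim ev assms(3)])
  then show "L2_norm (\<lambda>x. l x - l' x) \<le> e" if "0 < e" for e using that by simp
qed

lemma L2_tendsto_norm:
  assumes "L2_tendsto f l F"
  shows "((\<lambda>i. L2_norm (f i)) \<longlongrightarrow> L2_norm l) F"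
proof (rule Lim_transform2[OF tendsto_const], rule tendsto_rabs_zero_cancel, rule tendsto_sandwich[OF _ _ tendsto_const])
  have l: "l \<in> L2_space" and ev: "\<forall>\<^sub>F i in F. f i \<in> L2_space"
    using assms by (auto simp: L2_tendsto_def)
  show "((\<lambda>i. L2_norm (\<lambda>x. f i x - l x)) \<longlongrightarrow> 0) F" using assms by (simp add: L2_tendsto_def)
  show "\<forall>\<^sub>F i in F. \<bar>L2_norm l - L2_norm (f i)\<bar> \<le> L2_norm (\<lambda>x. f i x - l x)"
    using ev
  proof eventually_elim
    case (elim i)
    then show ?case
      using L2_norm_le_diff[OF l elim] L2_norm_le_diff[OF elim l] L2_norm_diff_commute[of l "f i"] by simp
  qed
qed simp

text \<open>Riesz-Fischer: a subsequence whose consecutive differences have norm at most 2^-k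
  converges almost everywhere, and Fatou's lemma identifies its limit as the limit in norm of the
  full sequence.\<close>

lemma L2_complete:
  fixes f :: "nat \<Rightarrow> 'a::euclidean_space \<Rightarrow> complex"
  assumes f: "\<And>n. f n \<in> L2_space"
    and Cauchy: "\<And>e. 0 < e \<Longrightarrow> \<exists>N. \<forall>m\<ge>N. \<forall>n\<ge>N. L2_norm (\<lambda>x. f m x - f n x) \<le> e"
  shows "\<exists>F. L2_tendsto f F sequentially"
proof -
  have [measurable]: "f n \<in> borel_measurable borel" for n using f by auto
  have "\<forall>k. \<exists>N. \<forall>m\<ge>N. \<forall>n\<ge>N. L2_norm (\<lambda>x. f m x - f n x) \<le> (1 / 2) ^ k"
    using Cauchy by simp
  then obtain N where N: "\<And>k m n. N k \<le> m \<Longrightarrow> N k \<le> n \<Longrightarrow> L2_norm (\<lambda>x. f m x - f n x) \<le> (1 / 2) ^ k"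
    by metis
  \<comment> \<open>The partial sum dominates every N i with i <= k, so no monotone choice of
    thresholds is needed.\<close>
  define s where "s k = (\<Sum>i\<le>k. N i)" for k
  have s: "N k \<le> s j" if "k \<le> j" for k j
    unfolding s_def using that by (intro member_le_sum) auto
  define d where "d k x = f (s (Suc k)) x - f (s k) x" for k x
  have [measurable]: "d k \<in> borel_measurable borel" for k unfolding d_def by measurable
  have d: "d k \<in> L2_space" "L2_norm (d k) \<le> (1 / 2) ^ k" for k
    using L2_diff(1)[OF f f] N[OF s s] unfolding d_def by auto
  \<comment> \<open>The weight 2^k balances two needs: the integrals are at most 2^k 4^-k = 2^-k,
    and |d| <= 2^-k + 2^k |d|^2 makes the telescoping series absolutely summable wherever the
    weighted sum is finite.\<close>
  have "(\<integral>\<^sup>+x. (\<Sum>k. ennreal (2 ^ k * (cmod (d k x))\<^sup>2)) \<partial>lborel)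
      = (\<Sum>k. \<integral>\<^sup>+x. ennreal (2 ^ k * (cmod (d k x))\<^sup>2) \<partial>lborel)"
    by (rule nn_integral_suminf) measurable
  also have "\<dots> \<le> (\<Sum>k. ennreal ((1 / 2) ^ k))"
  proof (intro suminf_le summableI)
    fix k
    have "(\<integral>\<^sup>+x. ennreal (2 ^ k * (cmod (d k x))\<^sup>2) \<partial>lborel) = ennreal (2 ^ k) * ennreal ((L2_norm (d k))\<^sup>2)"
      by (simp add: ennreal_mult' nn_integral_cmult nn_integral_eq_L2_norm[OF d(1)])
    also have "\<dots> = ennreal (2 ^ k * (L2_norm (d k))\<^sup>2)" by (simp add: ennreal_mult')
    also have "\<dots> \<le> ennreal (2 ^ k * ((1 / 2) ^ k)\<^sup>2)"
      using d(2) by (intro ennreal_leI mult_left_mono power_mono) auto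
    also have "2 ^ k * ((1 / 2) ^ k)\<^sup>2 = ((1 / 2) ^ k :: real)"
      by (simp add: power_divide power2_eq_square)
    finally show "(\<integral>\<^sup>+x. ennreal (2 ^ k * (cmod (d k x))\<^sup>2) \<partial>lborel) \<le> ennreal ((1 / 2) ^ k)" .
  qed
  also have "\<dots> = ennreal (\<Sum>k. (1 / 2) ^ k)"
    by (rule suminf_ennreal_eq) (auto intro!: summable_sums summable_geometric)
  finally have "(\<integral>\<^sup>+x. (\<Sum>k. ennreal (2 ^ k * (cmod (d k x))\<^sup>2)) \<partial>lborel) \<noteq> \<infinity>"
    by (auto simp: top_unique)
  then have "AE x in lborel. (\<Sum>k. ennreal (2 ^ k * (cmod (d k x))\<^sup>2)) \<noteq> \<infinity>"
    by (intro nn_integral_noteq_infinite) auto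
  then have conv: "AE x in lborel. (\<lambda>k. f (s k) x) \<longlonglongrightarrow> lim (\<lambda>k. f (s k) x)"
  proof eventually_elim
    case (elim x)
    then have *: "summable (\<lambda>k. 2 ^ k * (cmod (d k x))\<^sup>2)"
      by (intro summable_suminf_not_top) auto
    have "summable (\<lambda>k. cmod (d k x))"
    proof (rule summable_comparison_test')
      show "summable (\<lambda>k. (1 / 2) ^ k + 2 ^ k * (cmod (d k x))\<^sup>2)"
        by (intro summable_add *) (simp add: summable_geometric)
      show "norm (cmod (d k x)) \<le> (1 / 2) ^ k + 2 ^ k * (cmod (d k x))\<^sup>2" for k
      proof -
        define p :: real where "p = 2 ^ k"
        define a where "a = cmod (d k x)"
        have p: "0 < p" "0 \<le> a" by (auto simp: p_def a_def)
        have "0 \<le> (p * a - 1)\<^sup>2 / p" using p by simp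
        also have "\<dots> = 1 / p + p * a\<^sup>2 - 2 * a"
          using p by (simp add: field_simps power2_eq_square)
        finally have "a \<le> 1 / p + p * a\<^sup>2" using p by simp
        then show ?thesis by (simp add: a_def p_def power_divide)
      qed
    qed
    then have "summable (\<lambda>k. d k x)" by (rule summable_norm_cancel)
    then have "convergent (\<lambda>n. \<Sum>k<n. d k x)" by (simp add: summable_iff_convergent)
    then have "convergent (\<lambda>n. f (s n) x - f (s 0) x)"
      unfolding d_def sum_lessThan_telescope[of "\<lambda>k. f (s k) x"] .
    then have "convergent (\<lambda>n. f (s n) x)"
      by (subst (asm) convergent_diff_const_right_iff)
    then show ?case by (simp add: convergent_LIMSEQ_iff)
  qed
  define F where "F x = lim (\<lambda>k. f (s k) x)" for x
  have [measurable]: "F \<in> borel_measurable borel"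
    unfolding F_def by (rule borel_measurable_lim_metric) measurable
  have bound: "(\<lambda>x. f n x - F x) \<in> L2_space \<and> L2_norm (\<lambda>x. f n x - F x) \<le> (1 / 2) ^ k"
    if "N k \<le> n" for n k
  proof -
    have "(\<integral>\<^sup>+x. ennreal ((cmod (f n x - F x))\<^sup>2) \<partial>lborel)
        = (\<integral>\<^sup>+x. liminf (\<lambda>j. ennreal ((cmod (f n x - f (s j) x))\<^sup>2)) \<partial>lborel)"
      using conv
    proof (intro nn_integral_cong_AE, eventually_elim)
      case (elim x)
      then have "(\<lambda>j. ennreal ((cmod (f n x - f (s j) x))\<^sup>2)) \<longlonglongrightarrow> ennreal ((cmod (f n x - F x))\<^sup>2)"
        unfolding F_def by (intro tendsto_intros) auto
      then show ?case by (intro lim_imp_Liminf[symmetric]) auto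
    qed
    also have "\<dots> \<le> liminf (\<lambda>j. \<integral>\<^sup>+x. ennreal ((cmod (f n x - f (s j) x))\<^sup>2) \<partial>lborel)"
      by (rule nn_integral_liminf) measurable
    also have "\<dots> \<le> ennreal (((1 / 2) ^ k)\<^sup>2)"
    proof (rule Liminf_le)
      show "\<forall>\<^sub>F j in sequentially. (\<integral>\<^sup>+x. ennreal ((cmod (f n x - f (s j) x))\<^sup>2) \<partial>lborel)
          \<le> ennreal (((1 / 2) ^ k)\<^sup>2)"
        using eventually_ge_at_top[of k]
      proof eventually_elim
        case (elim j)
        have "L2_norm (\<lambda>x. f n x - f (s j) x) \<le> (1 / 2) ^ k" using N that s[OF elim] by blast
        then show ?case
          using nn_integral_eq_L2_norm[OF L2_diff(1)[OF f[of n] f[of "s j"]]] by (simp add: power_mono)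
      qed
    qed simp
    finally show ?thesis
      using L2_norm_leI[of "\<lambda>x. f n x - F x" "(1 / 2) ^ k"] by simp
  qed
  have "F \<in> L2_space"
    using L2_diff(1)[OF f[of "N 0"] conjunct1[OF bound[of 0 "N 0"]]] by simp
  moreover have "(\<lambda>n. L2_norm (\<lambda>x. f n x - F x)) \<longlonglongrightarrow> 0"
  proof (rule LIMSEQ_I)
    fix e :: real assume "0 < e"
    then obtain k where k: "(1 / 2) ^ k < e" using real_arch_pow_inv[of e "1 / 2"] by auto
    then show "\<exists>no. \<forall>n\<ge>no. norm (L2_norm (\<lambda>x. f n x - F x) - 0) < e"
      using bound[of k] by (auto intro!: exI[of _ "N k"] intro: le_less_trans)
  qed
  ultimately show ?thesis using f by (auto simp: L2_tendsto_def)
qed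

section \<open>Truncation to balls\<close>

definition truncate :: "real \<Rightarrow> ('a::euclidean_space \<Rightarrow> complex) \<Rightarrow> 'a \<Rightarrow> complex" where
  "truncate R f = (\<lambda>x. indicator (ball 0 R) x * f x)"

lemma truncate_measurable [measurable]:
  "f \<in> borel_measurable borel \<Longrightarrow> truncate R f \<in> borel_measurable borel"
  unfolding truncate_def by (intro borel_measurable_times borel_measurable_indicator) auto

lemma truncate_L2: "f \<in> L2_space \<Longrightarrow> truncate R f \<in> L2_space"
  by (rule L2_bound(1)[of f _ 1]) (auto simp: truncate_def indicator_def)

text \<open>Cauchy-Schwarz against an indicator. The second part makes the integral over a set of
  finite measure continuous in the L2 norm, so such integrals pass to L2 limits.\<close>

lemma L2_times_indicator_integrable:
  assumes f: "f \<in> L2_space" and A: "A \<in> sets borel" "emeasure lborel A < \<infinity>"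
  shows "integrable lborel (\<lambda>x. indicator A x * f x)"
    and "cmod (LINT x|lborel. indicator A x * f x) \<le> sqrt (measure lborel A) * L2_norm f"
proof -
  have [measurable]: "f \<in> borel_measurable borel" "A \<in> sets borel" using f A by auto
  have A': "emeasure lborel A = ennreal (measure lborel A)"
    using A by (simp add: emeasure_eq_ennreal_measure)
  have "(\<integral>\<^sup>+x. ennreal (cmod (indicator A x * f x)) \<partial>lborel)\<^sup>2
      = (\<integral>\<^sup>+x. indicator A x * ennreal (cmod (f x)) \<partial>lborel)\<^sup>2"
    by (intro arg_cong[where f="\<lambda>x. x\<^sup>2"] nn_integral_cong) (auto simp: indicator_def)
  also have "\<dots> \<le> (\<integral>\<^sup>+x. (indicator A x)\<^sup>2 \<partial>lborel) * (\<integral>\<^sup>+x. (ennreal (cmod (f x)))\<^sup>2 \<partial>lborel)"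
    by (rule Cauchy_Schwarz_nn_integral) measurable
  also have "(\<integral>\<^sup>+x. (indicator A x)\<^sup>2 \<partial>lborel) = (\<integral>\<^sup>+x. indicator A x \<partial>lborel)"
    by (intro nn_integral_cong) (auto simp: indicator_def)
  also have "\<dots> = ennreal (measure lborel A)" using A' by simp
  also have "(\<integral>\<^sup>+x. (ennreal (cmod (f x)))\<^sup>2 \<partial>lborel) = ennreal ((L2_norm f)\<^sup>2)"
    using nn_integral_eq_L2_norm[OF f] by (simp add: ennreal_power)
  also have "ennreal (measure lborel A) * ennreal ((L2_norm f)\<^sup>2)
      = (ennreal (sqrt (measure lborel A) * L2_norm f))\<^sup>2"
    by (simp add: ennreal_power power_mult_distrib flip: ennreal_mult')
  finally have *: "(\<integral>\<^sup>+x. ennreal (cmod (indicator A x * f x)) \<partial>lborel)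
      \<le> ennreal (sqrt (measure lborel A) * L2_norm f)"
    by (cases "\<integral>\<^sup>+x. ennreal (cmod (indicator A x * f x)) \<partial>lborel")
      (auto simp: ennreal_power top_unique intro!: ennreal_leI power2_le_imp_le)
  then show int: "integrable lborel (\<lambda>x. indicator A x * f x)"
    by (intro integrableI_bounded) (auto intro: le_less_trans)
  have "ennreal (cmod (LINT x|lborel. indicator A x * f x))
      \<le> (\<integral>\<^sup>+x. ennreal (cmod (indicator A x * f x)) \<partial>lborel)"
    by (rule integral_norm_bound_ennreal[OF int])
  with * show "cmod (LINT x|lborel. indicator A x * f x) \<le> sqrt (measure lborel A) * L2_norm f"
    by (auto dest: order_trans)
qed

lemma truncate_integrable: "f \<in> L2_space \<Longrightarrow> integrable lborel (truncate R f)"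
  unfolding truncate_def
  by (rule L2_times_indicator_integrable) (use emeasure_bounded_finite[OF bounded_ball] in auto)

lemma truncate_tendsto:
  assumes f: "f \<in> L2_space"
  shows "L2_tendsto (\<lambda>R. truncate R f) f at_top"
proof -
  have [measurable]: "f \<in> borel_measurable borel" using f by auto
  have "((\<lambda>R. LINT x|lborel. (cmod (truncate R f x - f x))\<^sup>2) \<longlongrightarrow> (LINT x|(lborel :: 'a measure). 0)) at_top"
  proof (rule integral_dominated_convergence_at_top)
    show "integrable lborel (\<lambda>x. (cmod (f x))\<^sup>2)" using f by (rule L2_space_integrable)
    show "\<forall>\<^sub>F R in at_top. AE x in lborel. norm ((cmod (truncate R f x - f x))\<^sup>2) \<le> (cmod (f x))\<^sup>2"
      by (auto simp: truncate_def indicator_def)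
    show "AE x in lborel. ((\<lambda>R. (cmod (truncate R f x - f x))\<^sup>2) \<longlongrightarrow> 0) at_top"
    proof (rule AE_I2, rule tendsto_eventually)
      fix x :: 'a
      show "\<forall>\<^sub>F R in at_top. (cmod (truncate R f x - f x))\<^sup>2 = 0"
        using eventually_gt_at_top[of "norm x"] by eventually_elim (simp add: truncate_def)
    qed
  qed measurable
  then have "((\<lambda>R. sqrt (LINT x|lborel. (cmod (truncate R f x - f x))\<^sup>2)) \<longlongrightarrow> sqrt 0) at_top"
    by (intro tendsto_real_sqrt) simp
  then show ?thesis using f by (auto simp: L2_tendsto_def L2_norm_def intro!: always_eventually truncate_L2)
qed

subsection \<open>The Fourier transform of integrable functions\<close>

lemma lborel_integral_affine:
  fixes f :: "'a::euclidean_space \<Rightarrow> 'b::{banach, second_countable_topology}"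
  assumes [measurable]: "f \<in> borel_measurable borel" and c: "c \<noteq> 0"
  shows "(LINT x|lborel. f x) = \<bar>c\<bar> ^ DIM('a) *\<^sub>R (LINT x|lborel. f (t + c *\<^sub>R x))"
  by (subst lborel_affine[OF c, of t]) (simp add: integral_density integral_distr)

lemma lborel_integrable_affine:
  fixes f :: "'a::euclidean_space \<Rightarrow> 'b::{banach, second_countable_topology}"
  assumes f: "integrable lborel f" and c: "c \<noteq> 0"
  shows "integrable lborel (\<lambda>x. f (t + c *\<^sub>R x))"
proof -
  have [measurable]: "f \<in> borel_measurable borel" using f by auto
  have "integrable (density (distr lborel borel (\<lambda>x. t + c *\<^sub>R x)) (\<lambda>_. ennreal (\<bar>c\<bar> ^ DIM('a)))) f"
    using f lborel_affine[OF c, of t] by simp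
  then have "integrable lborel (\<lambda>x. \<bar>c\<bar> ^ DIM('a) *\<^sub>R f (t + c *\<^sub>R x))"
    by (simp add: integrable_density integrable_distr_eq del: integrable_scaleR_right)
  then have "integrable lborel (\<lambda>x. (1 / \<bar>c\<bar> ^ DIM('a)) *\<^sub>R \<bar>c\<bar> ^ DIM('a) *\<^sub>R f (t + c *\<^sub>R x))"
    by (rule integrable_scaleR_right)
  then show ?thesis using c by simp
qed

lemma lborel_AE_affine:
  fixes t :: "'a::euclidean_space"
  assumes "AE x in lborel. P x" and c: "c \<noteq> 0"
  shows "AE x in lborel. P (t + c *\<^sub>R x)"
proof -
  have "AE x in density (distr lborel borel (\<lambda>x. t + c *\<^sub>R x)) (\<lambda>_. ennreal (\<bar>c\<bar> ^ DIM('a))). P x"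
    unfolding lborel_affine[OF c, of t, symmetric] by (rule assms(1))
  then have "AE x in distr lborel borel (\<lambda>x. t + c *\<^sub>R x). P x"
    using c by (subst (asm) AE_density) auto
  then show ?thesis by (rule AE_distrD[rotated]) measurable
qed

lemma lborel_integral_reflect:
  fixes f :: "'a::euclidean_space \<Rightarrow> 'b::{banach, second_countable_topology}"
  assumes "f \<in> borel_measurable borel"
  shows "(LINT x|lborel. f (- x)) = (LINT x|lborel. f x)"
  using lborel_integral_affine[OF assms, of "- 1" 0] by simp

lemma lborel_integrable_reflect:
  fixes f :: "'a::euclidean_space \<Rightarrow> 'b::{banach, second_countable_topology}"
  shows "integrable lborel f \<Longrightarrow> integrable lborel (\<lambda>x. f (- x))"
  using lborel_integrable_affine[of f "- 1" 0] by simp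

lemma lborel_AE_reflect: "AE x in lborel. P (x :: 'a::euclidean_space) \<Longrightarrow> AE x in lborel. P (- x)"
  using lborel_AE_affine[of P "- 1" 0] by simp

lemma L2_reflect:
  assumes "f \<in> L2_space"
  shows "(\<lambda>x. f (- x)) \<in> L2_space" and "L2_norm (\<lambda>x. f (- x)) = L2_norm f"
proof -
  have [measurable]: "f \<in> borel_measurable borel" using assms by auto
  show "(\<lambda>x. f (- x)) \<in> L2_space"
    using lborel_integrable_reflect[OF L2_space_integrable[OF assms]] by (simp add: L2_space_def)
  show "L2_norm (\<lambda>x. f (- x)) = L2_norm f"
    unfolding L2_norm_def using lborel_integral_reflect[of "\<lambda>x. (cmod (f x))\<^sup>2"] by simp
qed

lemma fourier_measurable [measurable]:
  assumes [measurable]: "f \<in> borel_measurable borel"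
  shows "fourier f \<in> borel_measurable borel"
proof -
  have "(\<lambda>\<xi>. LINT x|lborel. f x * exp (- (\<i> * complex_of_real (x \<bullet> \<xi>)))) \<in> borel_measurable borel"
    by (rule lborel.borel_measurable_lebesgue_integral) measurable
  then show ?thesis unfolding fourier_def[abs_def] by measurable
qed

lemma norm_exp_minus_i [simp]: "cmod (exp (- (\<i> * complex_of_real t))) = 1"
  by (simp add: norm_exp_eq_Re)

lemma integrable_phase:
  fixes f :: "'a::euclidean_space \<Rightarrow> complex"
  assumes "integrable lborel f"
  shows "integrable lborel (\<lambda>x. f x * exp (- (\<i> * complex_of_real (x \<bullet> \<xi>))))"
proof (rule Bochner_Integration.integrable_bound[OF assms])
  have [measurable]: "f \<in> borel_measurable borel" using assms by auto
  show "(\<lambda>x. f x * exp (- (\<i> * complex_of_real (x \<bullet> \<xi>)))) \<in> borel_measurable lborel" by measurable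
qed (simp add: norm_mult)

lemma fourier_bound:
  fixes f :: "'a::euclidean_space \<Rightarrow> complex"
  shows "cmod (fourier f \<xi>) \<le> (2 * pi) powr (- real DIM('a) / 2) * (LINT x|lborel. cmod (f x))"
proof -
  have "cmod (LINT x|lborel. f x * exp (- (\<i> * complex_of_real (x \<bullet> \<xi>)))) \<le> (LINT x|lborel. cmod (f x))"
    using integral_norm_bound[of lborel "\<lambda>x. f x * exp (- (\<i> * complex_of_real (x \<bullet> \<xi>)))"]
    by (simp add: norm_mult)
  then show ?thesis by (simp add: fourier_def norm_mult mult_left_mono)
qed

lemma fourier_linear:
  assumes "integrable lborel f" "integrable lborel g"
  shows "fourier (\<lambda>x. a * f x + b * g x) \<xi> = a * fourier f \<xi> + b * fourier g \<xi>"
  using integrable_phase[OF assms(1), of \<xi>] integrable_phase[OF assms(2), of \<xi>]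
  by (simp add: fourier_def algebra_simps)

lemma fourier_cong_AE:
  assumes "f \<in> borel_measurable borel" "g \<in> borel_measurable borel" "AE x in lborel. f x = g x"
  shows "fourier f = fourier g"
proof
  fix \<xi>
  have "(LINT x|lborel. f x * exp (- (\<i> * complex_of_real (x \<bullet> \<xi>))))
      = (LINT x|lborel. g x * exp (- (\<i> * complex_of_real (x \<bullet> \<xi>))))"
    using assms by (intro integral_cong_AE) auto
  then show "fourier f \<xi> = fourier g \<xi>" by (simp add: fourier_def)
qed

lemma fourier_reflect:
  assumes [measurable]: "f \<in> borel_measurable borel"
  shows "fourier (\<lambda>x. f (- x)) \<xi> = fourier f (- \<xi>)"
  unfolding fourier_def
  using lborel_integral_reflect[of "\<lambda>x. f x * exp (- (\<i> * complex_of_real (x \<bullet> - \<xi>)))"] by simp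

lemma fourier_cnj: "cnj (fourier f \<xi>) = fourier (\<lambda>x. cnj (f x)) (- \<xi>)"
  unfolding fourier_def by (simp add: exp_cnj flip: Bochner_Integration.integral_cnj)

lemma fourier_modulate:
  "fourier (\<lambda>x. f x * exp (- (\<i> * complex_of_real (x \<bullet> y)))) \<xi> = fourier f (\<xi> + y)"
  unfolding fourier_def by (simp add: inner_add_right algebra_simps flip: exp_add)

lemma fourier_scale:
  fixes f :: "'a::euclidean_space \<Rightarrow> complex"
  assumes [measurable]: "f \<in> borel_measurable borel" and a: "0 < a"
  shows "fourier f \<xi> = complex_of_real (a ^ DIM('a)) * fourier (\<lambda>x. f (a *\<^sub>R x)) (a *\<^sub>R \<xi>)"
  unfolding fourier_def using a
    lborel_integral_affine[of "\<lambda>x. f x * exp (- (\<i> * complex_of_real (x \<bullet> \<xi>)))" a 0]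
  by (simp add: scaleR_conv_of_real)

lemma integrable_product_phase:
  fixes f :: "'a::euclidean_space \<Rightarrow> complex" and g :: "'b::euclidean_space \<Rightarrow> complex"
  assumes f: "integrable lborel f" and g: "integrable lborel g"
    and [measurable]: "(\<lambda>(x, y). p x y) \<in> borel_measurable (borel \<Otimes>\<^sub>M borel)"
    and p: "\<And>x y. cmod (p x y) \<le> 1"
  shows "integrable (lborel \<Otimes>\<^sub>M lborel) (\<lambda>(x, y). f x * g y * p x y)"
proof -
  have [measurable]: "f \<in> borel_measurable borel" "g \<in> borel_measurable borel" using f g by auto
  have "integrable (lborel \<Otimes>\<^sub>M lborel) (\<lambda>(x, y). f x * g y)"
  proof (rule lborel_pair.Fubini_integrable)
    show "integrable lborel (\<lambda>x. LINT y|lborel. cmod (case (x, y) of (x, y) \<Rightarrow> f x * g y))"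
      using f by (simp add: norm_mult)
  qed (use g in auto)
  then show ?thesis
    by (rule Bochner_Integration.integrable_bound) (use p in \<open>auto simp: norm_mult mult_left_le\<close>)
qed

text \<open>Fubini, since the phase is symmetric in x and \<xi>. The regularized inversion arguments
  below move a transform from one factor to the other by this formula.\<close>

lemma fourier_multiplication_formula:
  fixes f g :: "'a::euclidean_space \<Rightarrow> complex"
  assumes f: "integrable lborel f" and g: "integrable lborel g"
  shows "(LINT \<xi>|lborel. fourier f \<xi> * g \<xi>) = (LINT x|lborel. f x * fourier g x)"
proof -
  define c where "c = complex_of_real ((2 * pi) powr (- real DIM('a) / 2))"
  define p :: "'a \<Rightarrow> 'a \<Rightarrow> complex" where "p x \<xi> = exp (- (\<i> * complex_of_real (x \<bullet> \<xi>)))" for x \<xi>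
  have pc: "p x y = p y x" for x y by (simp add: p_def inner_commute)
  have "integrable (lborel \<Otimes>\<^sub>M lborel) (\<lambda>(x, \<xi>). f x * g \<xi> * p x \<xi>)"
    by (rule integrable_product_phase[OF f g]) (auto simp: p_def)
  from lborel_pair.Fubini_integral[OF this]
  have *: "(LINT \<xi>|lborel. (LINT x|lborel. f x * g \<xi> * p x \<xi>)) = (LINT x|lborel. (LINT \<xi>|lborel. f x * g \<xi> * p x \<xi>))" .
  have "(LINT \<xi>|lborel. fourier f \<xi> * g \<xi>) = (LINT \<xi>|lborel. c * (LINT x|lborel. f x * g \<xi> * p x \<xi>))"
    unfolding fourier_def c_def[symmetric] p_def[symmetric]
    by (intro Bochner_Integration.integral_cong refl)
      (simp add: mult.assoc mult.commute[of "g _"] flip: integral_mult_left_zero)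
  also have "\<dots> = (LINT x|lborel. c * (LINT \<xi>|lborel. f x * g \<xi> * p x \<xi>))"
    using * by simp
  also have "\<dots> = (LINT x|lborel. f x * fourier g x)"
    unfolding fourier_def c_def[symmetric] p_def[symmetric]
    by (intro Bochner_Integration.integral_cong refl)
      (simp add: mult.assoc mult.left_commute[of "f _"] pc flip: integral_mult_right_zero)
  finally show ?thesis .
qed

text \<open>Lebesgue measure is the image of the product of one-dimensional Lebesgue measures under
  the coordinate map, so the integral splits by coordinates. This reduces the Gaussian to dimension
  one.\<close>

lemma lborel_integral_prod:
  fixes h :: "'a::euclidean_space \<Rightarrow> real \<Rightarrow> complex"
  assumes h: "\<And>b. b \<in> Basis \<Longrightarrow> integrable lborel (h b)"
  shows "integrable lborel (\<lambda>x::'a. \<Prod>b\<in>Basis. h b (x \<bullet> b))"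
    and "(LINT x|lborel. (\<Prod>b\<in>Basis. h b (x \<bullet> b))) = (\<Prod>b\<in>Basis. LINT t|lborel. h b t)"
proof -
  interpret product_sigma_finite "\<lambda>_::'a. lborel :: real measure"
    by standard
  have [measurable]: "h b \<in> borel_measurable borel" if "b \<in> Basis" for b using h[OF that] by auto
  have T[measurable]: "(\<lambda>f. \<Sum>b\<in>Basis. f b *\<^sub>R b) \<in> (\<Pi>\<^sub>M b\<in>Basis. lborel) \<rightarrow>\<^sub>M (borel :: 'a measure)"
    by measurable
  have m[measurable]: "(\<lambda>x::'a. \<Prod>b\<in>Basis. h b (x \<bullet> b)) \<in> borel_measurable borel" by measurable
  have eq: "(\<Prod>b\<in>Basis. h b ((\<Sum>b\<in>Basis. f b *\<^sub>R b) \<bullet> b)) = (\<Prod>b\<in>Basis. h b (f b))" for f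
    by (intro prod.cong refl) (simp add: inner_sum_left inner_Basis if_distrib cong: if_cong)
  show "integrable lborel (\<lambda>x::'a. \<Prod>b\<in>Basis. h b (x \<bullet> b))"
    using product_integrable_prod[OF finite_Basis h]
    by (subst lborel_eq, subst integrable_distr_eq[OF T]) (simp_all add: eq)
  show "(LINT x|lborel. (\<Prod>b\<in>Basis. h b (x \<bullet> b))) = (\<Prod>b\<in>Basis. LINT t|lborel. h b t)"
    using product_integral_prod[OF finite_Basis h]
    by (subst lborel_eq) (simp add: integral_distr[OF T] eq)
qed

section \<open>The standard Gaussian\<close>

definition gauss :: "'a::euclidean_space \<Rightarrow> complex" where
  "gauss x = complex_of_real (exp (- (norm x)\<^sup>2 / 2))"

lemma gauss_measurable [measurable]: "gauss \<in> borel_measurable borel"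
  unfolding gauss_def[abs_def] by measurable

lemma gauss_1d:
  shows "integrable lborel (\<lambda>t::real. complex_of_real (exp (- t\<^sup>2 / 2)) * exp (- (\<i> * complex_of_real (t * s))))"
    and "(LINT t|lborel. complex_of_real (exp (- t\<^sup>2 / 2)) * exp (- (\<i> * complex_of_real (t * s))))
      = complex_of_real (sqrt (2 * pi) * exp (- s\<^sup>2 / 2))"
proof -
  have g: "exp (- t\<^sup>2 / 2) = sqrt (2 * pi) * std_normal_density t" for t
    by (simp add: std_normal_density_def)
  have int: "integrable lborel (\<lambda>t. complex_of_real (std_normal_density t))"
    using integrable_normal_density[of 1 0] by (intro integrable_of_real) auto
  have "integrable lborel (\<lambda>t. complex_of_real (exp (- t\<^sup>2 / 2)))"
    unfolding g of_real_mult by (intro integrable_mult_right int)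
  from integrable_phase[OF this, of s]
  show "integrable lborel (\<lambda>t::real. complex_of_real (exp (- t\<^sup>2 / 2)) * exp (- (\<i> * complex_of_real (t * s))))"
    by simp
  \<comment> \<open>The characteristic function has the phase exp(+ i t x), hence the argument
    -s.\<close>
  have "char std_normal_distribution (- s)
      = (LINT t|lborel. std_normal_density t *\<^sub>R exp (\<i> * complex_of_real (- s * t)))"
    unfolding char_def by (subst integral_density) auto
  then have "(LINT t|lborel. std_normal_density t *\<^sub>R exp (\<i> * complex_of_real (- s * t)))
      = complex_of_real (exp (- s\<^sup>2 / 2))"
    by (simp add: char_std_normal_distribution)
  then have "complex_of_real (sqrt (2 * pi)) * (LINT t|lborel. std_normal_density t *\<^sub>R exp (\<i> * complex_of_real (- s * t)))
      = complex_of_real (sqrt (2 * pi) * exp (- s\<^sup>2 / 2))"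
    by simp
  then show "(LINT t|lborel. complex_of_real (exp (- t\<^sup>2 / 2)) * exp (- (\<i> * complex_of_real (t * s))))
      = complex_of_real (sqrt (2 * pi) * exp (- s\<^sup>2 / 2))"
    unfolding g by (simp add: scaleR_conv_of_real mult.assoc mult.commute[of s] flip: integral_mult_right_zero)
qed

lemma gauss_prod:
  fixes x :: "'a::euclidean_space"
  shows "gauss x * exp (- (\<i> * complex_of_real (x \<bullet> \<xi>)))
    = (\<Prod>b\<in>Basis. complex_of_real (exp (- (x \<bullet> b)\<^sup>2 / 2)) * exp (- (\<i> * complex_of_real ((x \<bullet> b) * (\<xi> \<bullet> b)))))"
proof -
  have "- (norm x)\<^sup>2 / 2 = (\<Sum>b\<in>Basis. - (x \<bullet> b)\<^sup>2 / 2)"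
    by (simp add: power2_norm_eq_inner euclidean_inner[of x x] sum_negf sum_divide_distrib[symmetric] flip: power2_eq_square)
  moreover have "- (\<i> * complex_of_real (x \<bullet> \<xi>)) = (\<Sum>b\<in>Basis. - (\<i> * complex_of_real ((x \<bullet> b) * (\<xi> \<bullet> b))))"
    by (subst euclidean_inner) (simp add: sum_negf sum_distrib_left)
  ultimately show ?thesis by (simp add: gauss_def exp_sum prod.distrib)
qed

lemma gauss_integrable: "integrable lborel gauss"
  using lborel_integral_prod(1)[OF gauss_1d(1), of "\<lambda>_. 0"]
  unfolding gauss_prod[of _ 0, simplified, abs_def, folded fun_eq_iff] by simp

lemma fourier_gauss: "fourier gauss \<xi> = gauss (\<xi> :: 'a::euclidean_space)"
proof -
  have "(LINT x|lborel. gauss x * exp (- (\<i> * complex_of_real (x \<bullet> \<xi>))))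
      = (\<Prod>b\<in>Basis. complex_of_real (sqrt (2 * pi) * exp (- (\<xi> \<bullet> b)\<^sup>2 / 2)))"
    unfolding gauss_prod using lborel_integral_prod(2)[OF gauss_1d(1), of "\<lambda>b. \<xi> \<bullet> b"] gauss_1d(2) by simp
  also have "\<dots> = complex_of_real (sqrt (2 * pi)) ^ DIM('a) * gauss \<xi>"
    using gauss_prod[of \<xi> 0] by (simp add: prod.distrib)
  moreover have "(2 * pi) powr (- real DIM('a) / 2) * sqrt (2 * pi) ^ DIM('a) = 1"
  proof -
    have "sqrt (2 * pi) ^ DIM('a) = (2 * pi) powr (real DIM('a) / 2)"
      by (simp add: powr_half_sqrt[symmetric] powr_powr flip: powr_realpow)
    then show ?thesis by (simp flip: powr_add)
  qed
  then have "complex_of_real ((2 * pi) powr (- real DIM('a) / 2)) * complex_of_real (sqrt (2 * pi)) ^ DIM('a) = 1"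
    by (metis of_real_1 of_real_mult of_real_power)
  ultimately show ?thesis unfolding fourier_def by (simp flip: mult.assoc)
qed

subsection \<open>Gaussian regularization\<close>

text \<open>Without integrability the Bochner integral is 0 and the bound is trivial. Convolutions
  can thus be estimated before their integrals are known to exist.\<close>

lemma integral_norm_bound_ennreal':
  fixes f :: "'b \<Rightarrow> 'c::{banach, second_countable_topology}"
  shows "ennreal (norm (integral\<^sup>L M f)) \<le> (\<integral>\<^sup>+x. ennreal (norm (f x)) \<partial>M)"
  by (cases "integrable M f") (auto simp: integral_norm_bound_ennreal not_integrable_integral_eq)

text \<open>Dominated convergence with majorant (C + 1)^2 |u|^2. It serves both the Gaussian cutoffs
  used for inversion and the filter of the reconstruction.\<close>

lemma L2_tendsto_multiplier:
  fixes u :: "'a::euclidean_space \<Rightarrow> complex"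
  assumes u: "u \<in> L2_space"
    and m[measurable]: "\<And>k. m k \<in> borel_measurable borel"
    and lim: "\<And>\<xi>. (\<lambda>k. m k \<xi>) \<longlonglongrightarrow> 1"
    and bound: "\<And>k \<xi>. cmod (m k \<xi>) \<le> C"
  shows "L2_tendsto (\<lambda>k \<xi>. m k \<xi> * u \<xi>) u sequentially"
proof -
  have [measurable]: "u \<in> borel_measurable borel" using u by auto
  have C: "0 \<le> C" using bound[of 0 0] norm_ge_zero order_trans by blast
  have "(\<lambda>k. LINT \<xi>|lborel. (cmod (m k \<xi> * u \<xi> - u \<xi>))\<^sup>2) \<longlonglongrightarrow> (LINT \<xi>|(lborel :: 'a measure). 0)"
  proof (rule integral_dominated_convergence)
    show "integrable lborel (\<lambda>\<xi>. (C + 1)\<^sup>2 * (cmod (u \<xi>))\<^sup>2)"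
      by (intro integrable_mult_right L2_space_integrable u)
    show "AE \<xi> in lborel. norm ((cmod (m k \<xi> * u \<xi> - u \<xi>))\<^sup>2) \<le> (C + 1)\<^sup>2 * (cmod (u \<xi>))\<^sup>2" for k
    proof (rule AE_I2)
      fix \<xi>
      have "cmod (m k \<xi> - 1) \<le> C + 1"
        using norm_triangle_ineq4[of "m k \<xi>" 1] bound[of k \<xi>] by simp
      then have "cmod (m k \<xi> * u \<xi> - u \<xi>) \<le> (C + 1) * cmod (u \<xi>)"
        by (metis left_diff_distrib mult_1 norm_mult mult_right_mono norm_ge_zero)
      then show "norm ((cmod (m k \<xi> * u \<xi> - u \<xi>))\<^sup>2) \<le> (C + 1)\<^sup>2 * (cmod (u \<xi>))\<^sup>2"
        by (simp add: power_mono flip: power_mult_distrib)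
    qed
    show "AE \<xi> in lborel. (\<lambda>k. (cmod (m k \<xi> * u \<xi> - u \<xi>))\<^sup>2) \<longlonglongrightarrow> 0"
      by (rule AE_I2) (auto intro!: tendsto_eq_intros lim)
  qed measurable
  then have "(\<lambda>k. sqrt (LINT \<xi>|lborel. (cmod (m k \<xi> * u \<xi> - u \<xi>))\<^sup>2)) \<longlonglongrightarrow> sqrt 0"
    by (intro tendsto_real_sqrt) simp
  moreover have "(\<lambda>\<xi>. m k \<xi> * u \<xi>) \<in> L2_space" for k
    by (rule L2_bound(1)[OF u _ C]) (use bound in \<open>auto simp: norm_mult mult_right_mono\<close>)
  ultimately show ?thesis using u by (simp add: L2_tendsto_def L2_norm_def)
qed

lemma norm_gauss_le_1: "cmod (gauss x) \<le> 1"
  by (simp add: gauss_def)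

lemma gauss_minus [simp]: "gauss (- x) = gauss x"
  by (simp add: gauss_def)

lemma real_gauss_integrable: "integrable lborel (\<lambda>x::'a::euclidean_space. exp (- (norm x)\<^sup>2 / 2))"
  using gauss_integrable unfolding gauss_def[abs_def] by (simp only: complex_of_real_integrable_eq)

lemma real_gauss_integral:
  "(2 * pi) powr (- real DIM('a) / 2) * (LINT x::'a::euclidean_space|lborel. exp (- (norm x)\<^sup>2 / 2)) = 1"
proof -
  have "complex_of_real ((2 * pi) powr (- real DIM('a) / 2) * (LINT x::'a|lborel. exp (- (norm x)\<^sup>2 / 2))) = 1"
    using fourier_gauss[of "0 :: 'a"] unfolding fourier_def gauss_def by simp
  then show ?thesis using of_real_eq_1_iff by blast
qed

text \<open>The centred normal density with standard deviation \<delta> in each coordinate, that is,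
  the heat kernel at time \<delta>^2 / 2.\<close>

definition heat :: "real \<Rightarrow> 'a::euclidean_space \<Rightarrow> real" where
  "heat \<delta> z = (2 * pi) powr (- real DIM('a) / 2) * exp (- (norm (z /\<^sub>R \<delta>))\<^sup>2 / 2) / \<delta> ^ DIM('a)"

lemma heat_measurable [measurable]: "heat \<delta> \<in> borel_measurable borel"
  unfolding heat_def[abs_def] by measurable

lemma heat_minus: "heat \<delta> (x - y) = heat \<delta> (y - x)"
  by (simp add: heat_def norm_minus_commute)

context
  fixes \<delta> :: real
  assumes \<delta>: "0 < \<delta>"
begin

lemma heat_nonneg: "0 \<le> heat \<delta> z"
  using \<delta> by (simp add: heat_def)

lemma heat_scaled:
  "heat \<delta> (\<delta> *\<^sub>R z) = (2 * pi) powr (- real DIM('a) / 2) * exp (- (norm (z :: 'a::euclidean_space))\<^sup>2 / 2) / \<delta> ^ DIM('a)"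
  using \<delta> by (simp add: heat_def)

lemma heat_integral: "(LINT z::'a::euclidean_space|lborel. heat \<delta> (z - y)) = 1"
proof -
  have "(LINT z|lborel. heat \<delta> (z - y)) = \<bar>\<delta>\<bar> ^ DIM('a) *\<^sub>R (LINT z::'a|lborel. heat \<delta> (y + \<delta> *\<^sub>R z - y))"
    using \<delta> by (intro lborel_integral_affine) auto
  then show ?thesis using real_gauss_integral[where 'a='a] \<delta> by (simp add: heat_scaled)
qed

lemma heat_nn_integral: "(\<integral>\<^sup>+z. ennreal (heat \<delta> (z - (y :: 'a::euclidean_space))) \<partial>lborel) = 1"
proof -
  \<comment> \<open>A non-integrable function would have integral 0, so the value 1 already proves
    integrability.\<close>
  have "integrable lborel (\<lambda>z. heat \<delta> (z - y))"
    using heat_integral[of y] not_integrable_integral_eq by fastforce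
  then show ?thesis
    by (subst nn_integral_eq_integral) (auto simp: heat_nonneg heat_integral)
qed

lemma gauss_scaled_integrable: "integrable lborel (\<lambda>x. gauss (\<delta> *\<^sub>R x))"
  using lborel_integrable_affine[OF gauss_integrable, of \<delta> 0] \<delta> by simp

lemma fourier_gauss_scaled:
  fixes z :: "'a::euclidean_space"
  shows "complex_of_real ((2 * pi) powr (- real DIM('a) / 2)) * fourier (\<lambda>x. gauss (\<delta> *\<^sub>R x)) z
    = complex_of_real (heat \<delta> z)"
proof -
  have "gauss (z /\<^sub>R \<delta>) = complex_of_real (\<delta> ^ DIM('a)) * fourier (\<lambda>x. gauss (\<delta> *\<^sub>R x)) z"
    using fourier_scale[OF gauss_measurable \<delta>, of "z /\<^sub>R \<delta>"] fourier_gauss[of "z /\<^sub>R \<delta>"] \<delta> by simp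
  then have "fourier (\<lambda>x. gauss (\<delta> *\<^sub>R x)) z = gauss (z /\<^sub>R \<delta>) / complex_of_real (\<delta> ^ DIM('a))"
    using \<delta> by (simp add: field_simps)
  then show ?thesis by (simp add: heat_def gauss_def)
qed

lemma bounded_times_gauss_integrable:
  assumes [measurable]: "u \<in> borel_measurable borel" and "\<And>\<xi>. cmod (u \<xi>) \<le> C"
  shows "integrable lborel (\<lambda>\<xi>. u \<xi> * gauss (\<delta> *\<^sub>R \<xi>))"
proof (rule Bochner_Integration.integrable_bound)
  show "integrable lborel (\<lambda>\<xi>. complex_of_real C * gauss (\<delta> *\<^sub>R \<xi>))"
    by (intro integrable_mult_right gauss_scaled_integrable)
  have "0 \<le> C" using assms(2)[of 0] norm_ge_zero order_trans by blast
  then show "AE \<xi> in lborel. norm (u \<xi> * gauss (\<delta> *\<^sub>R \<xi>)) \<le> norm (complex_of_real C * gauss (\<delta> *\<^sub>R \<xi>))"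
    using assms(2) by (auto simp: norm_mult mult_right_mono)
qed measurable

text \<open>The transform of f need not be integrable; the Gaussian factor makes it so. The
  multiplication formula then moves the transform to a modulated Gaussian, whose transform is a
  translated heat kernel. Evaluation at -x turns the forward transform into the inverse one.\<close>

lemma mollified_inversion:
  assumes f: "integrable lborel f"
  shows "fourier (\<lambda>\<xi>. fourier f \<xi> * gauss (\<delta> *\<^sub>R \<xi>)) (- x)
    = (LINT y|lborel. f y * complex_of_real (heat \<delta> (y - x)))"
proof -
  define c where "c = complex_of_real ((2 * pi) powr (- real DIM('a) / 2))"
  define g where "g \<xi> = gauss (\<delta> *\<^sub>R \<xi>) * exp (- (\<i> * complex_of_real (\<xi> \<bullet> - x)))" for \<xi>
  have g: "integrable lborel g" unfolding g_def by (intro integrable_phase gauss_scaled_integrable)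
  have "fourier (\<lambda>\<xi>. fourier f \<xi> * gauss (\<delta> *\<^sub>R \<xi>)) (- x) = c * (LINT \<xi>|lborel. fourier f \<xi> * g \<xi>)"
    unfolding fourier_def[of "\<lambda>\<xi>. fourier f \<xi> * gauss (\<delta> *\<^sub>R \<xi>)"] c_def g_def by (simp add: mult.assoc)
  also have "\<dots> = (LINT y|lborel. f y * (c * fourier g y))"
    unfolding fourier_multiplication_formula[OF f g]
    by (subst integral_mult_right_zero[symmetric]) (simp add: mult.left_commute)
  also have "\<dots> = (LINT y|lborel. f y * complex_of_real (heat \<delta> (y - x)))"
    unfolding g_def fourier_modulate c_def fourier_gauss_scaled by simp
  finally show ?thesis .
qed

text \<open>By the multiplication formula and regularized inversion the left side is the double
  integral of f(y) cnj(f(z)) heat(z - y). Bounding |f(y) f(z)| by |f(y)|^2/2 + |f(z)|^2/2 and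
  integrating out the free variable, in which the kernel has mass 1, leaves the squared norm,
  uniformly in \<delta>.\<close>

lemma fourier_L2_regularized:
  assumes f: "integrable lborel f" "f \<in> L2_space"
  shows "(\<integral>\<^sup>+\<xi>. ennreal ((cmod (fourier f \<xi>))\<^sup>2 * cmod (gauss (\<delta> *\<^sub>R \<xi>))) \<partial>lborel) \<le> ennreal ((L2_norm f)\<^sup>2)"
proof -
  have [measurable]: "f \<in> borel_measurable borel" using f by auto
  define B where "B = (2 * pi) powr (- real DIM('a) / 2) * (LINT x|lborel. cmod (f x))"
  have ennreal_sum_mult: "ennreal a * ennreal c + ennreal b * ennreal c = ennreal ((a + b) * c)"
    if "0 \<le> a" "0 \<le> b" "0 \<le> c" for a b c
    using that by (simp add: distrib_right flip: ennreal_mult ennreal_plus)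
  have hz: "(\<integral>\<^sup>+y. ennreal (heat \<delta> (z - y)) \<partial>lborel) = 1" for z :: 'a
    using heat_nn_integral[of z] by (simp only: heat_minus[of \<delta> z])
  define g where "g \<xi> = cnj (fourier f \<xi>) * gauss (\<delta> *\<^sub>R \<xi>)" for \<xi>
  have cnj_meas[measurable]: "(\<lambda>x. cnj (h x)) \<in> borel_measurable borel" if [measurable]: "h \<in> borel_measurable borel" for h :: "'a \<Rightarrow> complex"
    by (rule borel_measurable_continuous_on[OF continuous_on_cnj[OF continuous_on_id] that])
  have f': "integrable lborel (\<lambda>x. cnj (f x))" using f by simp
  have g: "integrable lborel g" unfolding g_def
    by (rule bounded_times_gauss_integrable[of _ B]) (use fourier_bound[of f] in \<open>auto simp: B_def\<close>)
  have Q: "fourier g y = (LINT z|lborel. cnj (f z) * complex_of_real (heat \<delta> (z - y)))" for y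
  proof -
    \<comment> \<open>The conjugate of a transform is the transform of the conjugate at the
      reflected frequency; the reflection supplies the sign change needed for
      \<open>mollified_inversion\<close>.\<close>
    have ref: "g = (\<lambda>\<xi>. (\<lambda>\<xi>. fourier (\<lambda>x. cnj (f x)) \<xi> * gauss (\<delta> *\<^sub>R \<xi>)) (- \<xi>))"
      by (simp add: g_def fourier_cnj fun_eq_iff)
    have "fourier g y = fourier (\<lambda>\<xi>. fourier (\<lambda>x. cnj (f x)) \<xi> * gauss (\<delta> *\<^sub>R \<xi>)) (- y)"
      unfolding ref by (rule fourier_reflect) measurable
    then show ?thesis using mollified_inversion[OF f'] by simp
  qed
  have eq: "fourier f \<xi> * g \<xi> = complex_of_real ((cmod (fourier f \<xi>))\<^sup>2 * cmod (gauss (\<delta> *\<^sub>R \<xi>)))" for \<xi>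
    unfolding g_def gauss_def of_real_mult complex_norm_square by simp
  have int: "integrable lborel (\<lambda>\<xi>. fourier f \<xi> * g \<xi>)"
  proof (rule Bochner_Integration.integrable_bound)
    show "integrable lborel (\<lambda>\<xi>. complex_of_real B * g \<xi>)" by (intro integrable_mult_right g)
    have "0 \<le> B" by (simp add: B_def)
    then show "AE \<xi> in lborel. norm (fourier f \<xi> * g \<xi>) \<le> norm (complex_of_real B * g \<xi>)"
      using fourier_bound[of f] by (auto simp: norm_mult B_def intro!: mult_right_mono)
  qed (use g in auto)
  then have "(\<integral>\<^sup>+\<xi>. ennreal ((cmod (fourier f \<xi>))\<^sup>2 * cmod (gauss (\<delta> *\<^sub>R \<xi>))) \<partial>lborel)
      = ennreal (LINT \<xi>|lborel. (cmod (fourier f \<xi>))\<^sup>2 * cmod (gauss (\<delta> *\<^sub>R \<xi>)))"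
    unfolding eq complex_of_real_integrable_eq by (intro nn_integral_eq_integral) auto
  also have "(LINT \<xi>|lborel. (cmod (fourier f \<xi>))\<^sup>2 * cmod (gauss (\<delta> *\<^sub>R \<xi>)))
      = cmod (LINT \<xi>|lborel. fourier f \<xi> * g \<xi>)"
    unfolding eq integral_complex_of_real by simp
  also have "\<dots> = cmod (LINT y|lborel. f y * fourier g y)"
    by (simp add: fourier_multiplication_formula[OF f(1) g])
  also have "ennreal \<dots> \<le> (\<integral>\<^sup>+y. ennreal (cmod (f y * fourier g y)) \<partial>lborel)"
    by (rule integral_norm_bound_ennreal')
  also have "\<dots> \<le> (\<integral>\<^sup>+y. \<integral>\<^sup>+z. ennreal ((cmod (f y))\<^sup>2 / 2) * ennreal (heat \<delta> (z - y))
      + ennreal ((cmod (f z))\<^sup>2 / 2) * ennreal (heat \<delta> (z - y)) \<partial>lborel \<partial>lborel)"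
  proof (rule nn_integral_mono)
    fix y
    have "ennreal (cmod (f y * fourier g y)) \<le> ennreal (cmod (f y)) * (\<integral>\<^sup>+z. ennreal (cmod (f z) * heat \<delta> (z - y)) \<partial>lborel)"
      using integral_norm_bound_ennreal'[of lborel "\<lambda>z. cnj (f z) * complex_of_real (heat \<delta> (z - y))"]
      unfolding Q norm_mult ennreal_mult'[OF norm_ge_zero]
      by (intro mult_left_mono) (simp_all add: heat_nonneg)
    also have "\<dots> = (\<integral>\<^sup>+z. ennreal (cmod (f y)) * ennreal (cmod (f z) * heat \<delta> (z - y)) \<partial>lborel)"
      by (rule nn_integral_cmult[symmetric]) measurable
    also have "\<dots> \<le> (\<integral>\<^sup>+z. ennreal ((cmod (f y))\<^sup>2 / 2) * ennreal (heat \<delta> (z - y))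
      + ennreal ((cmod (f z))\<^sup>2 / 2) * ennreal (heat \<delta> (z - y)) \<partial>lborel)"
    proof (rule nn_integral_mono)
      fix z
      have "cmod (f y) * (cmod (f z) * heat \<delta> (z - y))
          \<le> ((cmod (f y))\<^sup>2 / 2 + (cmod (f z))\<^sup>2 / 2) * heat \<delta> (z - y)"
        unfolding mult.assoc[symmetric]
        using sum_squares_bound[of "cmod (f y)" "cmod (f z)"] by (intro mult_right_mono heat_nonneg) simp
      then show "ennreal (cmod (f y)) * ennreal (cmod (f z) * heat \<delta> (z - y))
          \<le> ennreal ((cmod (f y))\<^sup>2 / 2) * ennreal (heat \<delta> (z - y))
            + ennreal ((cmod (f z))\<^sup>2 / 2) * ennreal (heat \<delta> (z - y))"
        using ennreal_sum_mult[of "(cmod (f y))\<^sup>2 / 2" "(cmod (f z))\<^sup>2 / 2", OF _ _ heat_nonneg[of "z - y"]]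
        by (simp add: heat_nonneg flip: ennreal_mult)
    qed
    finally show "ennreal (cmod (f y * fourier g y)) \<le> (\<integral>\<^sup>+z. ennreal ((cmod (f y))\<^sup>2 / 2) * ennreal (heat \<delta> (z - y))
      + ennreal ((cmod (f z))\<^sup>2 / 2) * ennreal (heat \<delta> (z - y)) \<partial>lborel)" .
  qed
  also have "\<dots> = (\<integral>\<^sup>+y. ennreal ((cmod (f y))\<^sup>2 / 2) \<partial>lborel)
      + (\<integral>\<^sup>+y. \<integral>\<^sup>+z. ennreal ((cmod (f z))\<^sup>2 / 2) * ennreal (heat \<delta> (z - y)) \<partial>lborel \<partial>lborel)"
    by (subst nn_integral_add[symmetric]) (auto simp: nn_integral_add nn_integral_cmult heat_nn_integral)
  also have "(\<integral>\<^sup>+y. \<integral>\<^sup>+z. ennreal ((cmod (f z))\<^sup>2 / 2) * ennreal (heat \<delta> (z - y)) \<partial>lborel \<partial>lborel)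
      = (\<integral>\<^sup>+z. \<integral>\<^sup>+y. ennreal ((cmod (f z))\<^sup>2 / 2) * ennreal (heat \<delta> (z - y)) \<partial>lborel \<partial>lborel)"
    by (rule lborel_pair.Fubini') measurable
  also have "\<dots> = (\<integral>\<^sup>+z. ennreal ((cmod (f z))\<^sup>2 / 2) \<partial>lborel)"
    by (simp add: nn_integral_cmult hz)
  also have "(\<integral>\<^sup>+y. ennreal ((cmod (f y))\<^sup>2 / 2) \<partial>lborel) + (\<integral>\<^sup>+z. ennreal ((cmod (f z))\<^sup>2 / 2) \<partial>lborel)
      = (\<integral>\<^sup>+y. ennreal ((cmod (f y))\<^sup>2) \<partial>lborel)"
    by (subst nn_integral_add[symmetric]) (auto simp flip: ennreal_plus)
  also have "\<dots> = ennreal ((L2_norm f)\<^sup>2)" by (rule nn_integral_eq_L2_norm[OF f(2)])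
  finally show ?thesis .
qed

end

abbreviation mesh :: "nat \<Rightarrow> real" where
  "mesh k \<equiv> 1 / real (Suc k)"

lemma gauss_mesh_tendsto: "(\<lambda>k. gauss (mesh k *\<^sub>R \<xi>)) \<longlonglongrightarrow> 1"
proof -
  have "(\<lambda>k. gauss (mesh k *\<^sub>R \<xi>)) \<longlonglongrightarrow> complex_of_real (exp (- (norm (0 *\<^sub>R \<xi>))\<^sup>2 / 2))"
    unfolding gauss_def
    by (intro tendsto_intros lim_1_over_n[THEN LIMSEQ_Suc]) auto
  then show ?thesis by simp
qed

text \<open>The cutoffs tend to 1, so Fatou's lemma carries the uniform bound over to the transform
  itself.\<close>

lemma fourier_L2:
  assumes f: "integrable lborel f" "f \<in> L2_space"
  shows "fourier f \<in> L2_space" and "L2_norm (fourier f) \<le> L2_norm f"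
proof -
  have [measurable]: "f \<in> borel_measurable borel" using f by auto
  let ?h = "\<lambda>k \<xi>. ennreal ((cmod (fourier f \<xi>))\<^sup>2 * cmod (gauss (mesh k *\<^sub>R \<xi>)))"
  have "(\<integral>\<^sup>+\<xi>. ennreal ((cmod (fourier f \<xi>))\<^sup>2) \<partial>lborel) = (\<integral>\<^sup>+\<xi>. liminf (\<lambda>k. ?h k \<xi>) \<partial>lborel)"
  proof (rule nn_integral_cong)
    fix \<xi>
    have "(\<lambda>k. ?h k \<xi>) \<longlonglongrightarrow> ennreal ((cmod (fourier f \<xi>))\<^sup>2 * cmod 1)"
      by (intro tendsto_intros gauss_mesh_tendsto)
    then show "ennreal ((cmod (fourier f \<xi>))\<^sup>2) = liminf (\<lambda>k. ?h k \<xi>)"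
      by (intro lim_imp_Liminf[symmetric]) auto
  qed
  also have "\<dots> \<le> liminf (\<lambda>k. \<integral>\<^sup>+\<xi>. ?h k \<xi> \<partial>lborel)"
    by (rule nn_integral_liminf) measurable
  also have "\<dots> \<le> ennreal ((L2_norm f)\<^sup>2)"
    by (rule Liminf_le) (simp_all add: fourier_L2_regularized[OF _ f] always_eventually)
  finally show "fourier f \<in> L2_space" "L2_norm (fourier f) \<le> L2_norm f"
    using L2_norm_leI[of "fourier f" "L2_norm f"] by auto
qed

section \<open>Fourier inversion tested on boxes\<close>

lemma AE_not_in_frontier_box: "AE y in lborel. y \<notin> cbox a b - box a (b :: 'a::euclidean_space)"
proof -
  have "cbox a b - box a b \<in> null_sets lebesgue"
    using negligible_frontier_interval negligible_iff_null_sets by blast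
  then have "cbox a b - box a b \<in> null_sets lborel"
    by (subst (asm) null_sets_completion_iff) auto
  then show ?thesis by (rule AE_not_in)
qed

lemma indicator_box_integrable: "integrable lborel (\<lambda>x::'a::euclidean_space. indicator (box a b) x :: complex)"
  by (rule integrable_real_indicator[THEN integrable_of_real, where 'a=complex, simplified of_real_indicator]) 
    (use emeasure_bounded_finite[OF bounded_box] in auto)

text \<open>After the substitution z = -y + \<delta> w with \<delta> = \<open>mesh k\<close> the
  kernel is a fixed Gaussian of mass 1, and the indicator is evaluated near y. Off the frontier it
  is locally constant there, so dominated convergence applies.\<close>

lemma heat_box_tendsto:
  fixes y :: "'a::euclidean_space"
  assumes "y \<notin> cbox a b - box a b"
  shows "(\<lambda>k. LINT z|lborel. indicator (box a b) (- z) * heat (mesh k) (z + y)) \<longlonglongrightarrow> indicator (box a b) y"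
proof -
  let ?c = "(2 * pi) powr (- real DIM('a) / 2)"
  have eq: "(LINT z|lborel. indicator (box a b) (- z) * heat (mesh k) (z + y))
      = (LINT w|lborel. indicator (box a b) (y - mesh k *\<^sub>R w) * (?c * exp (- (norm w)\<^sup>2 / 2)))" for k
  proof -
    have "(LINT z|lborel. indicator (box a b) (- z) * heat (mesh k) (z + y))
      = \<bar>mesh k\<bar> ^ DIM('a) *\<^sub>R (LINT w|lborel. indicator (box a b) (- (- y + mesh k *\<^sub>R w)) * heat (mesh k) (- y + mesh k *\<^sub>R w + y))"
      by (rule lborel_integral_affine) auto
    also have "\<dots> = (LINT w|lborel. mesh k ^ DIM('a) *\<^sub>R (indicator (box a b) (y - mesh k *\<^sub>R w) * heat (mesh k) (mesh k *\<^sub>R w)))"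
      by (subst integral_scaleR_right) (simp del: of_nat_Suc)
    also have "\<dots> = (LINT w|lborel. indicator (box a b) (y - mesh k *\<^sub>R w) * (?c * exp (- (norm w)\<^sup>2 / 2)))"
      by (intro Bochner_Integration.integral_cong refl, subst heat_scaled) (simp_all del: of_nat_Suc)
    finally show ?thesis .
  qed
  have "(\<lambda>k. LINT w|lborel. indicator (box a b) (y - mesh k *\<^sub>R w) * (?c * exp (- (norm w)\<^sup>2 / 2)))
      \<longlonglongrightarrow> (LINT w|lborel. indicator (box a b) y * (?c * exp (- (norm (w::'a))\<^sup>2 / 2)))"
  proof (rule integral_dominated_convergence)
    show "integrable lborel (\<lambda>w::'a. ?c * exp (- (norm w)\<^sup>2 / 2))"
      using real_gauss_integrable by (intro integrable_mult_right) auto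
    show "AE w in lborel. norm (indicator (box a b) (y - mesh k *\<^sub>R w) * (?c * exp (- (norm w)\<^sup>2 / 2)))
        \<le> ?c * exp (- (norm (w::'a))\<^sup>2 / 2)" for k
      by (auto simp: indicator_def)
    show "AE w in lborel. (\<lambda>k. indicator (box a b) (y - mesh k *\<^sub>R w) * (?c * exp (- (norm w)\<^sup>2 / 2)))
        \<longlonglongrightarrow> indicator (box a b) y * (?c * exp (- (norm w)\<^sup>2 / 2))"
    proof (rule AE_I2, rule tendsto_mult_right)
      fix w :: 'a
      have lim: "(\<lambda>k. y - mesh k *\<^sub>R w) \<longlonglongrightarrow> y"
      proof -
        have "(\<lambda>k. y - mesh k *\<^sub>R w) \<longlonglongrightarrow> y - 0 *\<^sub>R w"
          by (intro tendsto_intros lim_1_over_n[THEN LIMSEQ_Suc])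
        then show ?thesis by simp
      qed
      show "(\<lambda>k. indicator (box a b) (y - mesh k *\<^sub>R w)) \<longlonglongrightarrow> (indicator (box a b) y :: real)"
      proof (cases "y \<in> box a b")
        case True
        have "\<forall>\<^sub>F k in sequentially. y - mesh k *\<^sub>R w \<in> box a b"
          by (rule topological_tendstoD[OF lim open_box True])
        then show ?thesis using True by (intro tendsto_eventually) (auto elim: eventually_mono)
      next
        case False
        then have "y \<in> - cbox a b" using assms by auto
        then have "\<forall>\<^sub>F k in sequentially. y - mesh k *\<^sub>R w \<in> - cbox a b"
          by (intro topological_tendstoD[OF lim]) (auto intro: closed_cbox)
        then have "\<forall>\<^sub>F k in sequentially. y - mesh k *\<^sub>R w \<notin> box a b"
          by eventually_elim (use box_subset_cbox in auto)
        then show ?thesis using False by (intro tendsto_eventually) (auto elim: eventually_mono)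
      qed
    qed
  qed measurable
  then show ?thesis
    unfolding eq using real_gauss_integral[where 'a='a] by simp
qed

text \<open>Two uses of the multiplication formula transfer the Gaussian smoothing from f to the
  indicator of the box. The smoothed indicator is bounded by 1 and converges off the frontier, so
  |f| is a majorant. The reflected argument encodes the inverse transform.\<close>

lemma mollified_inversion_weak:
  fixes f :: "'a::euclidean_space \<Rightarrow> complex"
  assumes f: "integrable lborel f"
  shows "(\<lambda>k. LINT x|lborel. indicator (box a b) (- x) * fourier (\<lambda>\<xi>. fourier f \<xi> * gauss (mesh k *\<^sub>R \<xi>)) x)
    \<longlonglongrightarrow> (LINT y|lborel. indicator (box a b) y * f y)"
proof -
  have [measurable]: "f \<in> borel_measurable borel" using f by auto
  define p :: "'a \<Rightarrow> complex" where "p x = indicator (box a b) (- x)" for x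
  define m where "m k y = (LINT z|lborel. indicator (box a b) (- z) * heat (mesh k) (z + y))" for k and y :: 'a
  have [measurable]: "m k \<in> borel_measurable borel" for k
    unfolding m_def by (rule lborel.borel_measurable_lebesgue_integral) measurable
  have [measurable]: "p \<in> borel_measurable borel" unfolding p_def by measurable
  have p: "integrable lborel p"
    unfolding p_def by (rule lborel_integrable_reflect[OF indicator_box_integrable])
  have mesh: "0 < mesh k" for k by simp
  have ind: "integrable lborel (\<lambda>\<xi>. fourier h \<xi> * gauss (mesh k *\<^sub>R \<xi>))" if "integrable lborel h" for h :: "'a \<Rightarrow> complex" and k
    by (rule bounded_times_gauss_integrable[OF mesh _ fourier_bound]) (use that in auto)
  have eq: "(LINT x|lborel. p x * fourier (\<lambda>\<xi>. fourier f \<xi> * gauss (mesh k *\<^sub>R \<xi>)) x)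
      = (LINT y|lborel. f y * complex_of_real (m k y))" for k
  proof -
    have R: "fourier (\<lambda>\<xi>. fourier p \<xi> * gauss (mesh k *\<^sub>R \<xi>)) y = complex_of_real (m k y)" for y
    proof -
      have "fourier (\<lambda>\<xi>. fourier p \<xi> * gauss (mesh k *\<^sub>R \<xi>)) y
          = (LINT z|lborel. p z * complex_of_real (heat (mesh k) (z + y)))"
        using mollified_inversion[OF mesh p, of k "- y"] by simp
      also have "\<dots> = (LINT z|lborel. complex_of_real (indicator (box a b) (- z) * heat (mesh k) (z + y)))"
        by (intro Bochner_Integration.integral_cong refl) (simp add: p_def of_real_indicator)
      finally show ?thesis unfolding integral_complex_of_real m_def .
    qed
    have "(LINT x|lborel. p x * fourier (\<lambda>\<xi>. fourier f \<xi> * gauss (mesh k *\<^sub>R \<xi>)) x)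
        = (LINT \<xi>|lborel. fourier p \<xi> * (fourier f \<xi> * gauss (mesh k *\<^sub>R \<xi>)))"
      by (rule fourier_multiplication_formula[OF p ind[OF f], symmetric])
    also have "\<dots> = (LINT \<xi>|lborel. fourier f \<xi> * (fourier p \<xi> * gauss (mesh k *\<^sub>R \<xi>)))"
      by (simp add: mult.left_commute)
    also have "\<dots> = (LINT y|lborel. f y * fourier (\<lambda>\<xi>. fourier p \<xi> * gauss (mesh k *\<^sub>R \<xi>)) y)"
      by (rule fourier_multiplication_formula[OF f ind[OF p]])
    also have "\<dots> = (LINT y|lborel. f y * complex_of_real (m k y))" unfolding R ..
    finally show ?thesis .
  qed
  have m_bound: "\<bar>m k y\<bar> \<le> 1" for k y
  proof -
    have "ennreal \<bar>m k y\<bar> \<le> (\<integral>\<^sup>+z. ennreal (heat (mesh k) (z - (- y))) \<partial>lborel)"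
      unfolding m_def real_norm_def[symmetric]
      by (rule order_trans[OF integral_norm_bound_ennreal'])
        (intro nn_integral_mono ennreal_leI, auto simp: indicator_def heat_nonneg simp del: of_nat_Suc)
    then show ?thesis by (simp add: heat_nn_integral del: of_nat_Suc diff_minus_eq_add)
  qed
  have "(\<lambda>k. LINT y|lborel. f y * complex_of_real (m k y)) \<longlonglongrightarrow> (LINT y|lborel. indicator (box a b) y * f y)"
  proof (rule integral_dominated_convergence)
    show "integrable lborel (\<lambda>y. cmod (f y))" using f by simp
    show "AE y in lborel. norm (f y * complex_of_real (m k y)) \<le> cmod (f y)" for k
      using m_bound by (auto simp: norm_mult mult_left_le)
    show "AE y in lborel. (\<lambda>k. f y * complex_of_real (m k y)) \<longlonglongrightarrow> indicator (box a b) y * f y"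
      using AE_not_in_frontier_box[of a b]
    proof eventually_elim
      case (elim y)
      have "(\<lambda>k. f y * complex_of_real (m k y)) \<longlonglongrightarrow> f y * complex_of_real (indicator (box a b) y)"
        unfolding m_def by (intro tendsto_intros heat_box_tendsto elim)
      then show ?case by (simp add: of_real_indicator mult.commute)
    qed
  qed measurable
  then show ?thesis unfolding eq[symmetric] p_def .
qed

text \<open>Boxes are closed under intersection and generate the Borel sets, so Dynkin induction
  extends vanishing integrals from boxes to all Borel sets. An L2 function need not be integrable on
  the whole space, hence the restriction to boxes of half-width n; intersecting with such a box
  gives a box again.\<close>

lemma L2_AE_eq_if_eq_on_boxes:
  fixes u v :: "'a::euclidean_space \<Rightarrow> complex"
  assumes u: "u \<in> L2_space" and v: "v \<in> L2_space"
    and eq: "\<And>a b. (LINT x|lborel. indicator (box a b) x * u x) = (LINT x|lborel. indicator (box a b) x * v x)"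
  shows "AE x in lborel. u x = v x"
proof -
  define d where "d x = u x - v x" for x
  have d: "d \<in> L2_space" unfolding d_def by (rule L2_diff(1)[OF u v])
  have box_int: "integrable lborel (\<lambda>x. indicator (box a b) x * f x)" if "f \<in> L2_space" for a b and f :: "'a \<Rightarrow> complex"
    by (rule L2_times_indicator_integrable[OF that]) (use emeasure_bounded_finite[OF bounded_box] in auto)
  have d0: "(LINT x|lborel. indicator (box a b) x * d x) = 0" for a b
    unfolding d_def right_diff_distrib using eq[of a b] box_int[OF u] box_int[OF v] by simp
  have "AE x in lborel. x \<in> box (- real n *\<^sub>R One) (real n *\<^sub>R One) \<longrightarrow> d x = 0" for n
  proof -
    let ?N = "box (- real n *\<^sub>R One) (real n *\<^sub>R One) :: 'a set"
    define h where "h x = indicator ?N x * d x" for x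
    have h: "integrable lborel h" unfolding h_def by (rule box_int[OF d])
    have h0: "(LINT x|lborel. h x) = 0" unfolding h_def by (rule d0)
    have "AE x in lborel. h x = 0"
    proof (rule sigma_finite_measure.density_zero[OF sigma_finite_lborel h])
      fix A assume "A \<in> sets (lborel :: 'a measure)"
      then have A: "A \<in> sigma_sets UNIV (range (\<lambda>(a, b). box a b))"
        by (simp add: borel_eq_box)
      have "Int_stable (range (\<lambda>(a, b). box a b :: 'a set))"
        by (auto simp: Int_stable_def box_Int_box)
      moreover have "range (\<lambda>(a, b). box a b :: 'a set) \<subseteq> Pow UNIV" by simp
      ultimately show "set_lebesgue_integral lborel A h = 0"
        using A
      proof (induction rule: sigma_sets_induct_disjoint)
        case (basic B)
        then obtain a b where B: "B = box a b" by auto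
        obtain a' b' where ab: "box a b \<inter> ?N = box a' b'"
          by (rule that[OF box_Int_box])
        have "indicator B x *\<^sub>R h x = indicator (box a' b') x * d x" for x
          unfolding ab[symmetric] B h_def by (auto simp: indicator_def)
        then show ?case using d0[of a' b'] by (simp add: set_lebesgue_integral_def)
      next
        case empty
        show ?case by (simp add: set_lebesgue_integral_def)
      next
        case (compl B)
        have [measurable]: "B \<in> sets borel" using compl by (simp add: borel_eq_box)
        have "indicator (UNIV - B) x *\<^sub>R h x = h x - indicator B x *\<^sub>R h x" for x
          by (auto simp: indicator_def)
        moreover have "integrable lborel (\<lambda>x. indicator B x *\<^sub>R h x)"
          by (rule integrable_mult_indicator[OF _ h]) simp
        ultimately show ?case
          using compl h h0 by (simp add: set_lebesgue_integral_def)
      next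
        case (union B)
        have B: "B i \<in> sets borel" for i using union by (auto simp: borel_eq_box)
        have "set_lebesgue_integral lborel (\<Union>i. B i) h = (\<Sum>i. set_lebesgue_integral lborel (B i) h)"
        proof (rule lebesgue_integral_countable_add)
          show "set_integrable lborel (\<Union> (range B)) h"
            unfolding set_integrable_def using B by (intro integrable_mult_indicator h) auto
        qed (use B union in \<open>auto simp: disjoint_family_on_def\<close>)
        then show ?case using union by simp
      qed
    qed
    then show ?thesis by eventually_elim (auto simp: h_def)
  qed
  then have "AE x in lborel. \<forall>n. x \<in> box (- real n *\<^sub>R One) (real n *\<^sub>R One) \<longrightarrow> d x = 0"
    by (subst AE_all_countable) blast
  then show ?thesis
  proof eventually_elim
    case (elim x)
    have "x \<in> (\<Union>n. box (- real n *\<^sub>R One) (real n *\<^sub>R One))" by (simp add: UN_box_eq_UNIV)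
    then show ?case using elim by (auto simp: d_def)
  qed
qed

subsection \<open>The Fourier--Plancherel transform\<close>

lemma has_L2_fourier_truncate:
  "has_L2_fourier f F \<longleftrightarrow> f \<in> L2_space \<and> L2_tendsto (\<lambda>R. fourier (truncate R f)) F at_top"
  by (simp add: has_L2_fourier_def truncate_def)

lemma has_L2_fourierD:
  assumes "has_L2_fourier f F"
  shows "f \<in> L2_space" and "F \<in> L2_space"
  using assms by (auto simp: has_L2_fourier_def L2_tendsto_def)

lemma fourier_diff_L2:
  assumes "integrable lborel f" "f \<in> L2_space" "integrable lborel g" "g \<in> L2_space"
  shows "L2_norm (\<lambda>\<xi>. fourier f \<xi> - fourier g \<xi>) \<le> L2_norm (\<lambda>x. f x - g x)"
proof -
  have "fourier (\<lambda>x. f x - g x) = (\<lambda>\<xi>. fourier f \<xi> - fourier g \<xi>)"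
    using fourier_linear[OF assms(1,3), of 1 "- 1"] by auto
  then show ?thesis
    using fourier_L2(2)[of "\<lambda>x. f x - g x"] assms L2_diff(1) by auto
qed

lemma L2_tendsto_linear:
  assumes "L2_tendsto u l F" "L2_tendsto v m F"
  shows "L2_tendsto (\<lambda>i x. a * u i x + b * v i x) (\<lambda>x. a * l x + b * m x) F"
proof -
  have l: "l \<in> L2_space" "m \<in> L2_space" and ev: "\<forall>\<^sub>F i in F. u i \<in> L2_space" "\<forall>\<^sub>F i in F. v i \<in> L2_space"
    using assms by (auto simp: L2_tendsto_def)
  have lim: "((\<lambda>i. cmod a * L2_norm (\<lambda>x. u i x - l x) + cmod b * L2_norm (\<lambda>x. v i x - m x)) \<longlongrightarrow> 0) F"
    using assms by (auto simp: L2_tendsto_def intro!: tendsto_eq_intros)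
  have bound: "\<forall>\<^sub>F i in F. L2_norm (\<lambda>x. (a * u i x + b * v i x) - (a * l x + b * m x))
      \<le> cmod a * L2_norm (\<lambda>x. u i x - l x) + cmod b * L2_norm (\<lambda>x. v i x - m x)"
    using ev
  proof eventually_elim
    case (elim i)
    have "L2_norm (\<lambda>x. a * (u i x - l x) + b * (v i x - m x))
        \<le> L2_norm (\<lambda>x. a * (u i x - l x)) + L2_norm (\<lambda>x. b * (v i x - m x))"
      using elim l by (intro L2_add(2) L2_scale(1) L2_diff(1))
    moreover have "(\<lambda>x. a * (u i x - l x) + b * (v i x - m x)) = (\<lambda>x. (a * u i x + b * v i x) - (a * l x + b * m x))"
      by (auto simp: algebra_simps)
    ultimately show ?case
      using L2_scale(2)[OF L2_diff(1), of "u i" l a] L2_scale(2)[OF L2_diff(1), of "v i" m b] elim l by simp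
  qed
  have "((\<lambda>i. L2_norm (\<lambda>x. (a * u i x + b * v i x) - (a * l x + b * m x))) \<longlongrightarrow> 0) F"
    by (rule tendsto_sandwich[OF _ bound tendsto_const lim]) simp
  moreover have "\<forall>\<^sub>F i in F. (\<lambda>x. a * u i x + b * v i x) \<in> L2_space"
    using ev by eventually_elim (intro L2_add(1) L2_scale(1))
  ultimately show ?thesis using l by (auto simp: L2_tendsto_def intro!: L2_add(1) L2_scale(1))
qed

text \<open>Completeness concerns sequences, so the limit is found along integer radii. Letting one
  radius tend to infinity in the Cauchy estimate bounds the distance at any real radius R by the L2
  error of truncating at R, which gives the limit over all radii.\<close>

lemma has_L2_fourier_exists:
  assumes f: "f \<in> L2_space"
  shows "\<exists>F. has_L2_fourier f F"
proof -
  define \<epsilon> where "\<epsilon> R = L2_norm (\<lambda>x. truncate R f x - f x)" for R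
  have \<epsilon>: "(\<epsilon> \<longlongrightarrow> 0) at_top"
    using truncate_tendsto[OF f] by (simp add: L2_tendsto_def \<epsilon>_def[abs_def])
  have t: "truncate R f \<in> L2_space" "integrable lborel (truncate R f)" for R
    using truncate_L2[OF f] truncate_integrable[OF f] .
  have d: "L2_norm (\<lambda>\<xi>. fourier (truncate R f) \<xi> - fourier (truncate S f) \<xi>) \<le> \<epsilon> R + \<epsilon> S" for R S
    using fourier_diff_L2[OF t(2,1) t(2,1), of R S] L2_norm_diff_triangle[OF t(1) f t(1), of R S]
      L2_norm_diff_commute[of f "truncate S f"]
    by (simp add: \<epsilon>_def)
  have \<epsilon>': "(\<lambda>n. \<epsilon> (real n)) \<longlonglongrightarrow> 0"
    using \<epsilon> filterlim_real_sequentially by (rule filterlim_compose)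
  obtain F where F: "L2_tendsto (\<lambda>n. fourier (truncate (real n) f)) F sequentially"
  proof (rule exE[OF L2_complete[of "\<lambda>n. fourier (truncate (real n) f)"]])
    fix e :: real assume "0 < e"
    then have "\<forall>\<^sub>F n in sequentially. \<epsilon> (real n) < e / 2"
      using \<epsilon>' by (intro order_tendstoD) auto
    then obtain N where N: "\<And>n. N \<le> n \<Longrightarrow> \<epsilon> (real n) < e / 2" by (auto simp: eventually_sequentially)
    show "\<exists>N. \<forall>m\<ge>N. \<forall>n\<ge>N.
        L2_norm (\<lambda>x. fourier (truncate (real m) f) x - fourier (truncate (real n) f) x) \<le> e"
    proof (intro exI[of _ N] allI impI)
      fix m n assume "N \<le> m" "N \<le> n"
      then show "L2_norm (\<lambda>x. fourier (truncate (real m) f) x - fourier (truncate (real n) f) x) \<le> e"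
        using N[of m] N[of n] d[of "real m" "real n"] by linarith
    qed
  qed (use fourier_L2(1) t in auto)
  have FL: "F \<in> L2_space" using F by (simp add: L2_tendsto_def)
  have bound: "L2_norm (\<lambda>\<xi>. fourier (truncate R f) \<xi> - F \<xi>) \<le> \<epsilon> R" for R
  proof (rule tendsto_lowerbound)
    show "(\<lambda>n. \<epsilon> R + \<epsilon> (real n) + L2_norm (\<lambda>\<xi>. fourier (truncate (real n) f) \<xi> - F \<xi>)) \<longlonglongrightarrow> \<epsilon> R"
      using \<epsilon>' F by (auto simp: L2_tendsto_def intro!: tendsto_eq_intros)
    show "\<forall>\<^sub>F n in sequentially. L2_norm (\<lambda>\<xi>. fourier (truncate R f) \<xi> - F \<xi>)
        \<le> \<epsilon> R + \<epsilon> (real n) + L2_norm (\<lambda>\<xi>. fourier (truncate (real n) f) \<xi> - F \<xi>)"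
    proof (rule always_eventually, rule allI)
      fix n
      show "L2_norm (\<lambda>\<xi>. fourier (truncate R f) \<xi> - F \<xi>)
        \<le> \<epsilon> R + \<epsilon> (real n) + L2_norm (\<lambda>\<xi>. fourier (truncate (real n) f) \<xi> - F \<xi>)"
        using L2_norm_diff_triangle[OF fourier_L2(1)[OF t(2,1)] fourier_L2(1)[OF t(2,1)] FL, of R "real n"]
          d[of R "real n"] by linarith
    qed
  qed simp
  have "((\<lambda>R. L2_norm (\<lambda>\<xi>. fourier (truncate R f) \<xi> - F \<xi>)) \<longlongrightarrow> 0) at_top"
    by (rule tendsto_sandwich[OF _ _ tendsto_const \<epsilon>]) (use bound in \<open>auto intro!: always_eventually\<close>)
  then have "has_L2_fourier f F"
    using f FL fourier_L2(1)[OF t(2,1)] by (simp add: has_L2_fourier_truncate L2_tendsto_def)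
  then show ?thesis by blast
qed

lemma has_L2_fourier_norm_le:
  assumes "has_L2_fourier f F"
  shows "L2_norm F \<le> L2_norm f"
proof (rule tendsto_upperbound)
  have f: "f \<in> L2_space" using has_L2_fourierD[OF assms] by simp
  show "((\<lambda>R. L2_norm (fourier (truncate R f))) \<longlongrightarrow> L2_norm F) at_top"
    using assms by (intro L2_tendsto_norm) (simp add: has_L2_fourier_truncate)
  have "L2_norm (fourier (truncate R f)) \<le> L2_norm f" for R
  proof -
    have "L2_norm (truncate R f) \<le> 1 * L2_norm f"
      using f by (intro L2_bound(2)) (auto simp: truncate_def indicator_def intro!: truncate_measurable[unfolded truncate_def])
    then show ?thesis using fourier_L2(2)[OF truncate_integrable[OF f] truncate_L2[OF f], of R] by simp
  qed
  then show "\<forall>\<^sub>F R in at_top. L2_norm (fourier (truncate R f)) \<le> L2_norm f" by simp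
qed simp

lemma has_L2_fourier_linear:
  assumes "has_L2_fourier f F" "has_L2_fourier g G"
  shows "has_L2_fourier (\<lambda>x. a * f x + b * g x) (\<lambda>\<xi>. a * F \<xi> + b * G \<xi>)"
proof -
  have fg: "f \<in> L2_space" "g \<in> L2_space" using assms has_L2_fourierD by auto
  have "truncate R (\<lambda>x. a * f x + b * g x) = (\<lambda>x. a * truncate R f x + b * truncate R g x)" for R
    by (auto simp: truncate_def algebra_simps)
  then have "fourier (truncate R (\<lambda>x. a * f x + b * g x))
      = (\<lambda>\<xi>. a * fourier (truncate R f) \<xi> + b * fourier (truncate R g) \<xi>)" for R
    using fourier_linear[OF truncate_integrable[OF fg(1)] truncate_integrable[OF fg(2)]] by auto
  then show ?thesis
    using assms L2_tendsto_linear[of "\<lambda>R. fourier (truncate R f)" F at_top "\<lambda>R. fourier (truncate R g)" G a b]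
    by (simp add: has_L2_fourier_truncate L2_add(1) L2_scale(1))
qed

lemma has_L2_fourier_diff:
  assumes "has_L2_fourier f F" "has_L2_fourier g G"
  shows "has_L2_fourier (\<lambda>x. f x - g x) (\<lambda>\<xi>. F \<xi> - G \<xi>)"
  using has_L2_fourier_linear[OF assms, of 1 "- 1"] by simp

lemma has_L2_fourier_cong_AE:
  assumes "has_L2_fourier f F"
    and "g \<in> borel_measurable borel" "AE x in lborel. f x = g x"
    and "G \<in> borel_measurable borel" "AE \<xi> in lborel. F \<xi> = G \<xi>"
  shows "has_L2_fourier g G"
proof -
  have f: "f \<in> L2_space" and F: "F \<in> L2_space" using has_L2_fourierD[OF assms(1)] by auto
  have [measurable]: "f \<in> borel_measurable borel" "F \<in> borel_measurable borel"
    "g \<in> borel_measurable borel" "G \<in> borel_measurable borel"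
    using f F assms by auto
  have g: "g \<in> L2_space" by (rule L2_space_cong_AE[OF f assms(2,3)])
  have G: "G \<in> L2_space" by (rule L2_space_cong_AE[OF F assms(4,5)])
  have "fourier (truncate R g) = fourier (truncate R f)" for R
    using assms(3) by (intro fourier_cong_AE) (auto simp: truncate_def elim: eventually_mono intro!: truncate_measurable[unfolded truncate_def])
  moreover have "L2_norm (\<lambda>\<xi>. fourier (truncate R f) \<xi> - G \<xi>) = L2_norm (\<lambda>\<xi>. fourier (truncate R f) \<xi> - F \<xi>)" for R
    using assms(5) by (intro L2_norm_cong_AE) (measurable, auto elim: eventually_mono)
  ultimately show ?thesis
    using assms(1) g G by (simp add: has_L2_fourier_truncate L2_tendsto_def)
qed

lemma has_L2_fourier_unique:
  assumes "has_L2_fourier f F" "has_L2_fourier f G"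
  shows "AE \<xi> in lborel. F \<xi> = G \<xi>"
  using assms by (intro L2_tendsto_unique[of "\<lambda>R. fourier (truncate R f)" _ at_top])
    (auto simp: has_L2_fourier_truncate)

lemma has_L2_fourier_fourier:
  assumes f: "integrable lborel f" "f \<in> L2_space"
  shows "has_L2_fourier f (fourier f)"
proof -
  note t = truncate_integrable[OF f(2)] truncate_L2[OF f(2)]
  have "((\<lambda>R. L2_norm (\<lambda>x. truncate R f x - f x)) \<longlongrightarrow> 0) at_top"
    using truncate_tendsto[OF f(2)] by (simp add: L2_tendsto_def)
  then have "((\<lambda>R. L2_norm (\<lambda>\<xi>. fourier (truncate R f) \<xi> - fourier f \<xi>)) \<longlongrightarrow> 0) at_top"
    by (rule tendsto_sandwich[OF _ _ tendsto_const, rotated 2])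
      (auto intro!: always_eventually fourier_diff_L2 t f)
  then show ?thesis
    using f fourier_L2(1)[OF t] fourier_L2(1)[OF f] by (simp add: has_L2_fourier_truncate L2_tendsto_def)
qed

lemma has_L2_fourier_reflect:
  assumes "has_L2_fourier f F"
  shows "has_L2_fourier (\<lambda>x. f (- x)) (\<lambda>\<xi>. F (- \<xi>))"
proof -
  have f: "f \<in> L2_space" and F: "F \<in> L2_space" using has_L2_fourierD[OF assms] by auto
  have [measurable]: "f \<in> borel_measurable borel" using f by auto
  note t = truncate_integrable[OF f] truncate_L2[OF f]
  have "fourier (truncate R (\<lambda>x. f (- x))) = (\<lambda>\<xi>. fourier (truncate R f) (- \<xi>))" for R
  proof -
    have "truncate R (\<lambda>x. f (- x)) = (\<lambda>x. truncate R f (- x))"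
      by (auto simp: truncate_def indicator_def)
    then show ?thesis by (auto simp: fourier_reflect)
  qed
  moreover have "L2_norm (\<lambda>\<xi>. fourier (truncate R f) (- \<xi>) - F (- \<xi>))
      = L2_norm (\<lambda>\<xi>. fourier (truncate R f) \<xi> - F \<xi>)" for R
    using L2_reflect(2)[OF L2_diff(1)[OF fourier_L2(1)[OF t, of R] F]] .
  ultimately show ?thesis
    using assms f F fourier_L2(1)[OF t]
    by (simp add: has_L2_fourier_truncate L2_tendsto_def L2_reflect(1))
qed

text \<open>Since the transform of f need not be integrable, it is replaced by its Gaussian cutoffs
  \<open>H k\<close>, which are integrable and square integrable. Tested on boxes, the transforms of
  \<open>H k\<close> converge to G, because the transform is a contraction, and to the reflection of
  f, by \<open>mollified_inversion_weak\<close>.\<close>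

lemma fourier_inversion_L1_L2:
  fixes f :: "'a::euclidean_space \<Rightarrow> complex"
  assumes f: "integrable lborel f" "f \<in> L2_space" and G: "has_L2_fourier (fourier f) G"
  shows "AE x in lborel. f x = G (- x)"
proof (rule L2_AE_eq_if_eq_on_boxes)
  have [measurable]: "f \<in> borel_measurable borel" using f by auto
  have GL: "G \<in> L2_space" using has_L2_fourierD[OF G] by simp
  then have [measurable]: "G \<in> borel_measurable borel" by auto
  show "f \<in> L2_space" "(\<lambda>x. G (- x)) \<in> L2_space" using f(2) L2_reflect(1)[OF GL] by auto
  fix a b :: 'a
  define H where "H k \<xi> = fourier f \<xi> * gauss (mesh k *\<^sub>R \<xi>)" for k \<xi>
  have "H = (\<lambda>k \<xi>. gauss (mesh k *\<^sub>R \<xi>) * fourier f \<xi>)"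
    by (auto simp: H_def fun_eq_iff mult.commute)
  moreover have "L2_tendsto (\<lambda>k \<xi>. gauss (mesh k *\<^sub>R \<xi>) * fourier f \<xi>) (fourier f) sequentially"
    by (rule L2_tendsto_multiplier[OF fourier_L2(1)[OF f] _ gauss_mesh_tendsto norm_gauss_le_1]) measurable
  ultimately have H: "L2_tendsto H (fourier f) sequentially" by simp
  have HL: "H k \<in> L2_space" for k
    unfolding H_def by (rule L2_bound(1)[OF fourier_L2(1)[OF f], of _ 1])
      (auto simp: norm_mult norm_gauss_le_1 mult_left_le)
  have Hint: "integrable lborel (H k)" for k
    unfolding H_def by (rule bounded_times_gauss_integrable[OF _ _ fourier_bound]) auto
  have GH: "L2_norm (\<lambda>\<xi>. fourier (H k) \<xi> - G \<xi>) \<le> L2_norm (\<lambda>\<xi>. H k \<xi> - fourier f \<xi>)" for k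
    by (rule has_L2_fourier_norm_le[OF has_L2_fourier_diff[OF has_L2_fourier_fourier[OF Hint HL] G]])
  have refl: "indicator (box a b) (- x) = (indicator (box (- b) (- a)) x :: complex)" for x
  proof -
    have "(a \<bullet> i < - (x \<bullet> i) \<and> - (x \<bullet> i) < b \<bullet> i) \<longleftrightarrow> (- (b \<bullet> i) < x \<bullet> i \<and> x \<bullet> i < - (a \<bullet> i))" for i
      by linarith
    then show ?thesis by (simp add: indicator_def mem_box)
  qed
  have fin: "emeasure lborel (box (- b) (- a)) < \<infinity>" "box (- b) (- a) \<in> sets borel"
    using emeasure_bounded_finite[OF bounded_box] by auto
  let ?I = "\<lambda>u. LINT x|lborel. indicator (box (- b) (- a)) x * u x :: complex"
  have "(\<lambda>k. ?I (fourier (H k)) - ?I G) \<longlonglongrightarrow> 0"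
  proof (rule Lim_null_comparison)
    show "(\<lambda>k. sqrt (measure lborel (box (- b) (- a))) * L2_norm (\<lambda>\<xi>. H k \<xi> - fourier f \<xi>)) \<longlonglongrightarrow> 0"
      using H by (auto simp: L2_tendsto_def intro!: tendsto_eq_intros)
    have "norm (?I (fourier (H k)) - ?I G)
        \<le> sqrt (measure lborel (box (- b) (- a))) * L2_norm (\<lambda>\<xi>. H k \<xi> - fourier f \<xi>)" for k
    proof -
      have FH: "fourier (H k) \<in> L2_space" by (rule fourier_L2(1)[OF Hint HL])
      have "?I (fourier (H k)) - ?I G = ?I (\<lambda>x. fourier (H k) x - G x)"
        using L2_times_indicator_integrable(1)[OF FH fin(2,1)] L2_times_indicator_integrable(1)[OF GL fin(2,1)]
        by (simp add: right_diff_distrib)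
      also have "norm \<dots> \<le> sqrt (measure lborel (box (- b) (- a))) * L2_norm (\<lambda>x. fourier (H k) x - G x)"
        by (rule L2_times_indicator_integrable(2)[OF L2_diff(1)[OF FH GL] fin(2,1)])
      also have "\<dots> \<le> sqrt (measure lborel (box (- b) (- a))) * L2_norm (\<lambda>\<xi>. H k \<xi> - fourier f \<xi>)"
        using GH by (intro mult_left_mono) auto
      finally show ?thesis .
    qed
    then show "\<forall>\<^sub>F k in sequentially. norm (?I (fourier (H k)) - ?I G)
        \<le> sqrt (measure lborel (box (- b) (- a))) * L2_norm (\<lambda>\<xi>. H k \<xi> - fourier f \<xi>)"
      by simp
  qed
  then have "(\<lambda>k. ?I (fourier (H k))) \<longlonglongrightarrow> ?I G" by (rule LIM_zero_cancel)
  moreover have "(\<lambda>k. ?I (fourier (H k))) \<longlonglongrightarrow> (LINT y|lborel. indicator (box a b) y * f y)"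
    using mollified_inversion_weak[OF f(1), of a b] unfolding refl H_def[abs_def] .
  ultimately have "(LINT y|lborel. indicator (box a b) y * f y) = ?I G" by (rule LIMSEQ_unique[rotated])
  also have "\<dots> = (LINT x|lborel. indicator (box a b) x * G (- x))"
    using lborel_integral_reflect[of "\<lambda>x. indicator (box a b) x * G (- x)"] by (simp add: refl)
  finally show "(LINT x|lborel. indicator (box a b) x * f x) = (LINT x|lborel. indicator (box a b) x * G (- x))" .
qed

text \<open>Density: inversion holds for truncations of f, and the transform does not increase the
  norm. The distance between the two sides is thus at most the truncation error of f plus the
  resulting error of its transform.\<close>

lemma has_L2_fourier_inversion:
  assumes F: "has_L2_fourier f F" and G: "has_L2_fourier F G"
  shows "AE x in lborel. f x = G (- x)"
proof (rule L2_AE_eqI)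
  have fL: "f \<in> L2_space" and FL: "F \<in> L2_space" and GL: "G \<in> L2_space"
    using has_L2_fourierD[OF F] has_L2_fourierD[OF G] by auto
  show "f \<in> L2_space" "(\<lambda>x. G (- x)) \<in> L2_space" using fL L2_reflect(1)[OF GL] by auto
  note t = truncate_integrable[OF fL] truncate_L2[OF fL]
  have bound: "L2_norm (\<lambda>x. f x - G (- x))
      \<le> L2_norm (\<lambda>x. truncate R f x - f x) + L2_norm (\<lambda>\<xi>. fourier (truncate R f) \<xi> - F \<xi>)" for R
  proof -
    obtain H where H: "has_L2_fourier (fourier (truncate R f)) H"
      using has_L2_fourier_exists[OF fourier_L2(1)[OF t]] by blast
    have HL: "H \<in> L2_space" using has_L2_fourierD[OF H] by simp
    have "AE x in lborel. truncate R f x = H (- x)" by (rule fourier_inversion_L1_L2[OF t H])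
    then have "L2_norm (\<lambda>x. truncate R f x - G (- x)) = L2_norm (\<lambda>x. H (- x) - G (- x))"
      using t(2) GL HL by (intro L2_norm_cong_AE L2_space_measurable L2_diff(1) L2_reflect(1)) (auto elim: eventually_mono)
    also have "\<dots> = L2_norm (\<lambda>x. H x - G x)" by (rule L2_reflect(2)[OF L2_diff(1)[OF HL GL]])
    also have "\<dots> \<le> L2_norm (\<lambda>\<xi>. fourier (truncate R f) \<xi> - F \<xi>)"
      by (rule has_L2_fourier_norm_le[OF has_L2_fourier_diff[OF H G]])
    finally show ?thesis
      using L2_norm_diff_triangle[OF fL t(2) L2_reflect(1)[OF GL], of R] L2_norm_diff_commute[of f "truncate R f"]
      by simp
  qed
  have lim: "((\<lambda>R. L2_norm (\<lambda>x. truncate R f x - f x) + L2_norm (\<lambda>\<xi>. fourier (truncate R f) \<xi> - F \<xi>)) \<longlongrightarrow> 0) at_top"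
    using truncate_tendsto[OF fL] F
    by (auto simp: L2_tendsto_def has_L2_fourier_truncate intro!: tendsto_eq_intros)
  have "L2_norm (\<lambda>x. f x - G (- x)) \<le> 0"
    by (rule tendsto_lowerbound[OF lim]) (use bound in auto)
  then show "L2_norm (\<lambda>x. f x - G (- x)) \<le> e" if "0 < e" for e using that by simp
qed

text \<open>Transforming twice gives f up to reflection, so the contraction bound applied to the
  second transform is the reverse inequality.\<close>

theorem plancherel:
  assumes F: "has_L2_fourier f F"
  shows "L2_norm F = L2_norm f"
proof (rule antisym)
  show "L2_norm F \<le> L2_norm f" by (rule has_L2_fourier_norm_le[OF F])
  obtain G where G: "has_L2_fourier F G"
    using has_L2_fourier_exists has_L2_fourierD[OF F] by blast
  have GL: "G \<in> L2_space" using has_L2_fourierD[OF G] by simp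
  have "L2_norm f = L2_norm (\<lambda>x. G (- x))"
    using has_L2_fourier_inversion[OF F G] has_L2_fourierD(1)[OF F] L2_reflect(1)[OF GL]
    by (intro L2_norm_cong_AE) auto
  then show "L2_norm f \<le> L2_norm F" using L2_reflect(2)[OF GL] has_L2_fourier_norm_le[OF G] by simp
qed

text \<open>The preimage is the inverse transform, built as the reflection of the forward transform
  H of F; inversion shows that its transform K agrees with F.\<close>

lemma has_L2_fourier_surj:
  assumes "F \<in> L2_space"
  shows "\<exists>f. has_L2_fourier f F"
proof -
  obtain H where H: "has_L2_fourier F H" using has_L2_fourier_exists[OF assms] by blast
  obtain K where K: "has_L2_fourier (\<lambda>x. H (- x)) K"
    using has_L2_fourier_exists[OF L2_reflect(1)] has_L2_fourierD[OF H] by blast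
  have L: "H \<in> L2_space" "K \<in> L2_space" "(\<lambda>x. H (- x)) \<in> L2_space"
    using has_L2_fourierD[OF H] has_L2_fourierD[OF K] by auto
  have "AE x in lborel. F (- x) = K (- x)"
    by (rule has_L2_fourier_inversion[OF has_L2_fourier_reflect[OF H] K])
  then have "AE x in lborel. K x = F x"
    using lborel_AE_reflect[of "\<lambda>x. F (- x) = K (- x)"] by (auto elim: eventually_mono)
  then have "has_L2_fourier (\<lambda>x. H (- x)) F"
    using L assms by (intro has_L2_fourier_cong_AE[OF K]) auto
  then show ?thesis by blast
qed

lemma has_L2_fourier_inj:
  assumes "has_L2_fourier f F" "has_L2_fourier g G" "AE \<xi> in lborel. F \<xi> = G \<xi>"
  shows "AE x in lborel. f x = g x"
proof (rule L2_AE_eqI)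
  have L: "f \<in> L2_space" "g \<in> L2_space" "F \<in> L2_space" "G \<in> L2_space"
    using has_L2_fourierD[OF assms(1)] has_L2_fourierD[OF assms(2)] by auto
  then show "f \<in> L2_space" "g \<in> L2_space" by auto
  have "L2_norm (\<lambda>x. f x - g x) = L2_norm (\<lambda>\<xi>. F \<xi> - G \<xi>)"
    using plancherel[OF has_L2_fourier_diff[OF assms(1,2)]] by simp
  also have "\<dots> = L2_norm (\<lambda>_::'a. 0)"
    using L assms(3) by (intro L2_norm_cong_AE) (auto elim: eventually_mono)
  finally show "L2_norm (\<lambda>x. f x - g x) \<le> e" if "0 < e" for e
    using that by (simp add: L2_norm_def)
qed

subsection \<open>Convolution\<close>

lemma nn_integral_translate:
  fixes t :: "'a::euclidean_space"
  assumes [measurable]: "f \<in> borel_measurable borel"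
  shows "(\<integral>\<^sup>+x. f (x - t) \<partial>lborel) = (\<integral>\<^sup>+x. f x \<partial>lborel)"
    and "(\<integral>\<^sup>+x. f (t - x) \<partial>lborel) = (\<integral>\<^sup>+x. f x \<partial>lborel)"
proof -
  have *: "(\<integral>\<^sup>+x. f x \<partial>lborel) = (\<integral>\<^sup>+x. f (s + c *\<^sub>R x) \<partial>lborel)" if "\<bar>c\<bar> = 1" for s :: 'a and c
  proof -
    have "c \<noteq> 0" using that by auto
    then show ?thesis
      by (subst lborel_affine[of c s]) (simp_all add: nn_integral_density nn_integral_distr that)
  qed
  show "(\<integral>\<^sup>+x. f (x - t) \<partial>lborel) = (\<integral>\<^sup>+x. f x \<partial>lborel)" using *[of 1 "- t"] by simp
  show "(\<integral>\<^sup>+x. f (t - x) \<partial>lborel) = (\<integral>\<^sup>+x. f x \<partial>lborel)" using *[of "- 1" t] by simp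
qed

lemma fun_convolution_measurable [measurable]:
  assumes [measurable]: "f \<in> borel_measurable borel" "g \<in> borel_measurable borel"
  shows "fun_convolution f g \<in> borel_measurable borel"
  unfolding fun_convolution_def[abs_def] by (rule lborel.borel_measurable_lebesgue_integral) measurable

context
  fixes f g :: "'a::euclidean_space \<Rightarrow> complex"
  assumes f: "integrable lborel f" and g: "g \<in> L2_space"
begin

text \<open>Young's inequality for L1 and L2: write |f| as the square of sqrt |f|, apply
  Cauchy-Schwarz in y, then Tonelli. With absolute values inside, the bound also shows that the
  convolution integral exists almost everywhere.\<close>

lemma convolution_nn_integral_bound:
  "(\<integral>\<^sup>+x. (\<integral>\<^sup>+y. ennreal (cmod (f (x - y) * g y)) \<partial>lborel)\<^sup>2 \<partial>lborel)
    \<le> ennreal (((LINT x|lborel. cmod (f x)) * L2_norm g)\<^sup>2)"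
proof -
  have [measurable]: "f \<in> borel_measurable borel" "g \<in> borel_measurable borel" using f g by auto
  define A where "A = (LINT x|lborel. cmod (f x))"
  have A: "(\<integral>\<^sup>+x. ennreal (cmod (f x)) \<partial>lborel) = ennreal A"
    unfolding A_def using f by (intro nn_integral_eq_integral) auto
  have A0: "0 \<le> A" by (simp add: A_def)
  have "(\<integral>\<^sup>+y. ennreal (cmod (f (x - y) * g y)) \<partial>lborel)\<^sup>2
      \<le> ennreal A * (\<integral>\<^sup>+y. ennreal (cmod (f (x - y))) * ennreal ((cmod (g y))\<^sup>2) \<partial>lborel)" for x
  proof -
    have "(\<integral>\<^sup>+y. ennreal (cmod (f (x - y) * g y)) \<partial>lborel)\<^sup>2
      = (\<integral>\<^sup>+y. ennreal (sqrt (cmod (f (x - y)))) * ennreal (sqrt (cmod (f (x - y))) * cmod (g y)) \<partial>lborel)\<^sup>2"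
      by (intro arg_cong[where f="\<lambda>x. x\<^sup>2"] nn_integral_cong) (simp add: norm_mult flip: ennreal_mult mult.assoc)
    also have "\<dots> \<le> (\<integral>\<^sup>+y. (ennreal (sqrt (cmod (f (x - y)))))\<^sup>2 \<partial>lborel)
        * (\<integral>\<^sup>+y. (ennreal (sqrt (cmod (f (x - y))) * cmod (g y)))\<^sup>2 \<partial>lborel)"
      by (rule Cauchy_Schwarz_nn_integral) measurable
    also have "(\<integral>\<^sup>+y. (ennreal (sqrt (cmod (f (x - y)))))\<^sup>2 \<partial>lborel) = ennreal A"
      using nn_integral_translate(2)[of "\<lambda>y. ennreal (cmod (f y))" x] by (simp add: ennreal_power A)
    also have "(\<integral>\<^sup>+y. (ennreal (sqrt (cmod (f (x - y))) * cmod (g y)))\<^sup>2 \<partial>lborel)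
        = (\<integral>\<^sup>+y. ennreal (cmod (f (x - y))) * ennreal ((cmod (g y))\<^sup>2) \<partial>lborel)"
      by (intro nn_integral_cong) (simp add: ennreal_power power_mult_distrib flip: ennreal_mult)
    finally show ?thesis .
  qed
  then have "(\<integral>\<^sup>+x. (\<integral>\<^sup>+y. ennreal (cmod (f (x - y) * g y)) \<partial>lborel)\<^sup>2 \<partial>lborel)
      \<le> (\<integral>\<^sup>+x. ennreal A * (\<integral>\<^sup>+y. ennreal (cmod (f (x - y))) * ennreal ((cmod (g y))\<^sup>2) \<partial>lborel) \<partial>lborel)"
    by (rule nn_integral_mono)
  also have "\<dots> = ennreal A * (\<integral>\<^sup>+x. \<integral>\<^sup>+y. ennreal (cmod (f (x - y))) * ennreal ((cmod (g y))\<^sup>2) \<partial>lborel \<partial>lborel)"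
    by (rule nn_integral_cmult) measurable
  also have "(\<integral>\<^sup>+x. \<integral>\<^sup>+y. ennreal (cmod (f (x - y))) * ennreal ((cmod (g y))\<^sup>2) \<partial>lborel \<partial>lborel)
      = (\<integral>\<^sup>+y. \<integral>\<^sup>+x. ennreal (cmod (f (x - y))) * ennreal ((cmod (g y))\<^sup>2) \<partial>lborel \<partial>lborel)"
    by (rule lborel_pair.Fubini') measurable
  also have "\<dots> = (\<integral>\<^sup>+y. ennreal A * ennreal ((cmod (g y))\<^sup>2) \<partial>lborel)"
    using nn_integral_translate(1)[of "\<lambda>x. ennreal (cmod (f x))"] by (simp add: nn_integral_multc A)
  also have "\<dots> = ennreal A * ennreal ((L2_norm g)\<^sup>2)"
    by (simp add: nn_integral_cmult nn_integral_eq_L2_norm[OF g])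
  also have "ennreal A * (ennreal A * ennreal ((L2_norm g)\<^sup>2)) = ennreal ((A * L2_norm g)\<^sup>2)"
    using A0 by (simp add: power2_eq_square mult.assoc mult.left_commute flip: ennreal_mult)
  finally show ?thesis unfolding A_def .
qed

lemma convolution_AE_integrable: "AE x in lborel. integrable lborel (\<lambda>y. f (x - y) * g y)"
proof -
  have [measurable]: "f \<in> borel_measurable borel" "g \<in> borel_measurable borel" using f g by auto
  have "(\<integral>\<^sup>+x. (\<integral>\<^sup>+y. ennreal (cmod (f (x - y) * g y)) \<partial>lborel)\<^sup>2 \<partial>lborel) \<noteq> \<infinity>"
    using convolution_nn_integral_bound by (auto simp: top_unique)
  then have "AE x in lborel. (\<integral>\<^sup>+y. ennreal (cmod (f (x - y) * g y)) \<partial>lborel)\<^sup>2 \<noteq> \<infinity>"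
    by (intro nn_integral_noteq_infinite) measurable
  then show ?thesis
  proof eventually_elim
    case (elim x)
    then have "(\<integral>\<^sup>+y. ennreal (cmod (f (x - y) * g y)) \<partial>lborel) < \<infinity>"
      by (auto simp: less_top[symmetric] power2_eq_square ennreal_top_mult)
    then show ?case by (intro integrableI_bounded) auto
  qed
qed

lemma convolution_L2:
  shows "fun_convolution f g \<in> L2_space"
    and "L2_norm (fun_convolution f g) \<le> (LINT x|lborel. cmod (f x)) * L2_norm g"
proof -
  have [measurable]: "f \<in> borel_measurable borel" "g \<in> borel_measurable borel" using f g by auto
  have "(\<integral>\<^sup>+x. ennreal ((cmod (fun_convolution f g x))\<^sup>2) \<partial>lborel)
      \<le> (\<integral>\<^sup>+x. (\<integral>\<^sup>+y. ennreal (cmod (f (x - y) * g y)) \<partial>lborel)\<^sup>2 \<partial>lborel)"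
  proof (rule nn_integral_mono)
    fix x
    \<comment> \<open>Valid at every x, since the convolution is 0 where its integral does not
      exist.\<close>
    have "(ennreal (cmod (fun_convolution f g x)))\<^sup>2 \<le> (\<integral>\<^sup>+y. ennreal (cmod (f (x - y) * g y)) \<partial>lborel)\<^sup>2"
      unfolding fun_convolution_def power2_eq_square
      by (intro mult_mono integral_norm_bound_ennreal') auto
    then show "ennreal ((cmod (fun_convolution f g x))\<^sup>2) \<le> (\<integral>\<^sup>+y. ennreal (cmod (f (x - y) * g y)) \<partial>lborel)\<^sup>2"
      by (simp add: ennreal_power)
  qed
  also have "\<dots> \<le> ennreal (((LINT x|lborel. cmod (f x)) * L2_norm g)\<^sup>2)"
    by (rule convolution_nn_integral_bound)
  finally show "fun_convolution f g \<in> L2_space"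
    "L2_norm (fun_convolution f g) \<le> (LINT x|lborel. cmod (f x)) * L2_norm g"
    using L2_norm_leI[of "fun_convolution f g" "(LINT x|lborel. cmod (f x)) * L2_norm g"] by auto
qed

end

text \<open>Fubini, with the phase at x factored into its values at x - y and y. Each transform
  carries (2 pi)^(-n/2), so the product of two has one such factor too many; the constant
  compensates.\<close>

lemma convolution_L1:
  fixes f g :: "'a::euclidean_space \<Rightarrow> complex"
  assumes f: "integrable lborel f" and g: "integrable lborel g"
  shows "integrable lborel (fun_convolution f g)"
    and "fourier (fun_convolution f g) \<xi>
      = complex_of_real ((2 * pi) powr (real DIM('a) / 2)) * fourier f \<xi> * fourier g \<xi>"
proof -
  have [measurable]: "f \<in> borel_measurable borel" "g \<in> borel_measurable borel" using f g by auto
  have fy: "integrable lborel (\<lambda>x. f (x - y))" for y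
    using lborel_integrable_affine[OF f, of 1 "- y"] by simp
  have trans: "(LINT x|lborel. h (x - y)) = (LINT x|lborel. h x)"
    if "h \<in> borel_measurable borel" for h :: "'a \<Rightarrow> 'b::{banach, second_countable_topology}" and y
    using lborel_integral_affine[OF that, of 1 "- y"] by simp
  have int: "integrable (lborel \<Otimes>\<^sub>M lborel) (\<lambda>(y, x). f (x - y) * g y)"
  proof (rule lborel_pair.Fubini_integrable)
    show "integrable lborel (\<lambda>y. LINT x|lborel. cmod (case (y, x) of (y, x) \<Rightarrow> f (x - y) * g y))"
      using g trans[of "\<lambda>x. cmod (f x)"] by (simp add: norm_mult)
    show "AE y in lborel. integrable lborel (\<lambda>x. case (y, x) of (y, x) \<Rightarrow> f (x - y) * g y)"
      using fy by simp
  qed measurable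
  show h: "integrable lborel (fun_convolution f g)"
    using lborel_pair.integrable_snd[OF int] by (simp add: fun_convolution_def[abs_def])
  define p where "p x = exp (- (\<i> * complex_of_real (x \<bullet> \<xi>)))" for x
  have [measurable]: "p \<in> borel_measurable borel" unfolding p_def[abs_def] by measurable
  have p: "p x = p (x - y) * p y" for x y
    by (simp add: p_def inner_diff_left algebra_simps flip: exp_add)
  have "integrable (lborel \<Otimes>\<^sub>M lborel) (\<lambda>(y, x). f (x - y) * g y * p x)"
    by (rule Bochner_Integration.integrable_bound[OF int]) (auto simp: norm_mult p_def)
  from lborel_pair.Fubini_integral[OF this]
  have "(LINT x|lborel. (LINT y|lborel. f (x - y) * g y * p x)) = (LINT y|lborel. (LINT x|lborel. f (x - y) * g y * p x))" .
  also have "(\<lambda>y. LINT x|lborel. f (x - y) * g y * p x) = (\<lambda>y. g y * p y * (LINT x|lborel. f x * p x))"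
  proof
    fix y
    have "(LINT x|lborel. f (x - y) * g y * p x) = (LINT x|lborel. g y * p y * (f (x - y) * p (x - y)))"
      by (intro Bochner_Integration.integral_cong refl) (subst p[of _ y], simp)
    then show "(LINT x|lborel. f (x - y) * g y * p x) = g y * p y * (LINT x|lborel. f x * p x)"
      using trans[of "\<lambda>x. f x * p x" y] by simp
  qed
  finally have *: "(LINT x|lborel. fun_convolution f g x * p x) = (LINT y|lborel. g y * p y) * (LINT x|lborel. f x * p x)"
    by (simp add: fun_convolution_def)
  have "(2 * pi) powr (real DIM('a) / 2) * (2 * pi) powr (- real DIM('a) / 2) = 1"
    by (simp flip: powr_add)
  then have c: "complex_of_real ((2 * pi) powr (real DIM('a) / 2)) * complex_of_real ((2 * pi) powr (- real DIM('a) / 2)) = 1"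
    by (metis of_real_1 of_real_mult)
  have F: "fourier u \<xi> = complex_of_real ((2 * pi) powr (- real DIM('a) / 2)) * (LINT x|lborel. u x * p x)" for u
    by (simp add: fourier_def p_def)
  show "fourier (fun_convolution f g) \<xi>
      = complex_of_real ((2 * pi) powr (real DIM('a) / 2)) * fourier f \<xi> * fourier g \<xi>"
  proof -
    have "c1 * (k * a) * (k * b) = (c1 * k) * (k * (b * a))" for c1 k a b :: complex
      by (simp only: mult_ac)
    then show ?thesis unfolding F * using c by simp
  qed
qed

text \<open>Both sides are L2-continuous in g: the left by Young's inequality and the contraction
  bound, the right because the transform of f is bounded. Hence the identity for integrable
  functions extends from the truncations of g.\<close>

theorem convolution_has_L2_fourier:
  fixes f g :: "'a::euclidean_space \<Rightarrow> complex"
  assumes f: "integrable lborel f" and g: "has_L2_fourier g G"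
  shows "has_L2_fourier (fun_convolution f g)
    (\<lambda>\<xi>. complex_of_real ((2 * pi) powr (real DIM('a) / 2)) * fourier f \<xi> * G \<xi>)"
proof -
  have gL: "g \<in> L2_space" and GL: "G \<in> L2_space" using has_L2_fourierD[OF g] by auto
  have [measurable]: "f \<in> borel_measurable borel" "g \<in> borel_measurable borel"
    using f gL by auto
  note t = truncate_integrable[OF gL] truncate_L2[OF gL]
  define M where "M \<xi> = complex_of_real ((2 * pi) powr (real DIM('a) / 2)) * fourier f \<xi>" for \<xi>
  have [measurable]: "M \<in> borel_measurable borel" unfolding M_def[abs_def] by measurable
  define A where "A = (LINT x|lborel. cmod (f x))"
  define B where "B = (2 * pi) powr (real DIM('a) / 2) * ((2 * pi) powr (- real DIM('a) / 2) * A)"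
  have A: "0 \<le> A" and B: "0 \<le> B" by (auto simp: A_def B_def)
  have MB: "cmod (M \<xi>) \<le> B" for \<xi>
    unfolding M_def B_def A_def norm_mult using fourier_bound[of f \<xi>] by (intro mult_mono) auto
  have mult_L2: "(\<lambda>\<xi>. M \<xi> * u \<xi>) \<in> L2_space" "L2_norm (\<lambda>\<xi>. M \<xi> * u \<xi>) \<le> B * L2_norm u"
    if "u \<in> L2_space" for u
    using L2_bound[OF that, of "\<lambda>\<xi>. M \<xi> * u \<xi>" B] that MB B by (auto simp: norm_mult mult_right_mono)
  obtain K where K: "has_L2_fourier (fun_convolution f g) K"
    using has_L2_fourier_exists[OF convolution_L2(1)[OF f gL]] by blast
  have KL: "K \<in> L2_space" using has_L2_fourierD[OF K] by simp
  have bound: "L2_norm (\<lambda>\<xi>. K \<xi> - M \<xi> * G \<xi>)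
      \<le> A * L2_norm (\<lambda>x. truncate R g x - g x) + B * L2_norm (\<lambda>\<xi>. fourier (truncate R g) \<xi> - G \<xi>)" for R
  proof -
    let ?h = "fun_convolution f (truncate R g)"
    have h: "integrable lborel ?h" "?h \<in> L2_space"
      using convolution_L1(1)[OF f t(1)] convolution_L2(1)[OF f t(2)] .
    have Fh: "fourier ?h = (\<lambda>\<xi>. M \<xi> * fourier (truncate R g) \<xi>)"
      by (simp add: fun_eq_iff convolution_L1(2)[OF f t(1)] M_def)
    have "L2_norm (\<lambda>\<xi>. K \<xi> - M \<xi> * fourier (truncate R g) \<xi>) \<le> L2_norm (\<lambda>x. fun_convolution f g x - ?h x)"
      using has_L2_fourier_norm_le[OF has_L2_fourier_diff[OF K has_L2_fourier_fourier[OF h]]] by (simp add: Fh)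
    also have "\<dots> = L2_norm (fun_convolution f (\<lambda>x. g x - truncate R g x))"
    proof (rule L2_norm_cong_AE)
      show "AE x in lborel. fun_convolution f g x - ?h x = fun_convolution f (\<lambda>x. g x - truncate R g x) x"
        using convolution_AE_integrable[OF f gL] convolution_AE_integrable[OF f t(2)[of R]]
        by eventually_elim (simp add: fun_convolution_def right_diff_distrib)
    qed measurable
    also have "\<dots> \<le> A * L2_norm (\<lambda>x. g x - truncate R g x)"
      unfolding A_def by (rule convolution_L2(2)[OF f L2_diff(1)[OF gL t(2)]])
    finally have 1: "L2_norm (\<lambda>\<xi>. K \<xi> - M \<xi> * fourier (truncate R g) \<xi>) \<le> A * L2_norm (\<lambda>x. truncate R g x - g x)"
      by (simp add: L2_norm_diff_commute[of g])
    note FL = fourier_L2(1)[OF t, of R]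
    have 2: "L2_norm (\<lambda>\<xi>. M \<xi> * fourier (truncate R g) \<xi> - M \<xi> * G \<xi>)
        \<le> B * L2_norm (\<lambda>\<xi>. fourier (truncate R g) \<xi> - G \<xi>)"
      using mult_L2(2)[OF L2_diff(1)[OF FL GL]] by (simp add: right_diff_distrib)
    show ?thesis
      using L2_norm_diff_triangle[OF KL mult_L2(1)[OF FL] mult_L2(1)[OF GL]] 1 2 by linarith
  qed
  have lim: "((\<lambda>R. A * L2_norm (\<lambda>x. truncate R g x - g x) + B * L2_norm (\<lambda>\<xi>. fourier (truncate R g) \<xi> - G \<xi>)) \<longlongrightarrow> 0) at_top"
    using truncate_tendsto[OF gL] g
    by (auto simp: L2_tendsto_def has_L2_fourier_truncate intro!: tendsto_eq_intros)
  have "L2_norm (\<lambda>\<xi>. K \<xi> - M \<xi> * G \<xi>) \<le> 0"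
    by (rule tendsto_lowerbound[OF lim]) (use bound in auto)
  then have "AE \<xi> in lborel. K \<xi> = M \<xi> * G \<xi>"
    by (intro L2_AE_eqI KL mult_L2(1) GL) simp
  then have "has_L2_fourier (fun_convolution f g) (\<lambda>\<xi>. M \<xi> * G \<xi>)"
    using mult_L2(1)[OF GL] by (intro has_L2_fourier_cong_AE[OF K]) auto
  then show ?thesis by (simp add: M_def)
qed

section \<open>Continuity of the transform, and the transform of a mollifier\<close>

lemma fourier_tendsto:
  assumes f: "integrable lborel f" and X: "X \<longlonglongrightarrow> \<xi>"
  shows "(\<lambda>k. fourier f (X k)) \<longlonglongrightarrow> fourier f \<xi>"
  unfolding fourier_def
proof (intro tendsto_mult_left integral_dominated_convergence)
  have [measurable]: "f \<in> borel_measurable borel" using f by auto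
  show "(\<lambda>x. f x * exp (- (\<i> * complex_of_real (x \<bullet> \<xi>)))) \<in> borel_measurable lborel"
    "\<And>i. (\<lambda>x. f x * exp (- (\<i> * complex_of_real (x \<bullet> X i)))) \<in> borel_measurable lborel"
    by measurable
  show "integrable lborel (\<lambda>x. cmod (f x))" using f by simp
  show "AE x in lborel. (\<lambda>i. f x * exp (- (\<i> * complex_of_real (x \<bullet> X i))))
      \<longlonglongrightarrow> f x * exp (- (\<i> * complex_of_real (x \<bullet> \<xi>)))"
    by (intro AE_I2 tendsto_intros X)
qed (simp add: norm_mult)

lemma mollifier_integrable:
  assumes "integrable lborel \<phi>" "0 < \<alpha>"
  shows "integrable lborel (\<lambda>x. complex_of_real (mollifier \<phi> \<alpha> x))"
  unfolding mollifier_def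
  using lborel_integrable_affine[OF assms(1), of "inverse \<alpha>" 0] assms(2)
  by (intro integrable_of_real integrable_divide) simp

lemma fourier_mollifier:
  fixes \<phi> :: "'a::euclidean_space \<Rightarrow> real"
  assumes "integrable lborel \<phi>" and \<alpha>: "0 < \<alpha>"
  shows "fourier (\<lambda>x. complex_of_real (mollifier \<phi> \<alpha> x)) \<xi> = fourier (\<lambda>x. complex_of_real (\<phi> x)) (\<alpha> *\<^sub>R \<xi>)"
proof -
  have [measurable]: "\<phi> \<in> borel_measurable borel" using assms by auto
  have m: "(\<lambda>x. complex_of_real (mollifier \<phi> \<alpha> x)) \<in> borel_measurable borel"
    unfolding mollifier_def by measurable
  have "complex_of_real (\<alpha> ^ DIM('a)) * fourier (\<lambda>x. complex_of_real (mollifier \<phi> \<alpha> (\<alpha> *\<^sub>R x))) (\<alpha> *\<^sub>R \<xi>)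
      = fourier (\<lambda>x. complex_of_real (\<alpha> ^ DIM('a)) * complex_of_real (mollifier \<phi> \<alpha> (\<alpha> *\<^sub>R x))) (\<alpha> *\<^sub>R \<xi>)"
    unfolding fourier_def by (simp add: mult.assoc mult.left_commute)
  also have "(\<lambda>x. complex_of_real (\<alpha> ^ DIM('a)) * complex_of_real (mollifier \<phi> \<alpha> (\<alpha> *\<^sub>R x))) = (\<lambda>x. complex_of_real (\<phi> x))"
    using \<alpha> by (simp add: mollifier_def fun_eq_iff)
  finally show ?thesis using fourier_scale[OF m \<alpha>, of \<xi>] by simp
qed

subsection \<open>The reconstruction operators\<close>

lemma mittag_leffler_zero: "mittag_leffler \<gamma> 1 0 = 1"
  using powser_zero[of "\<lambda>k. 1 / Gamma (\<gamma> * real k + 1)"] by (simp add: mittag_leffler_def)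

context
  fixes \<phi> :: "'a::euclidean_space \<Rightarrow> real" and \<gamma> T :: real and \<rho> :: "real \<Rightarrow> real"
  assumes \<gamma>: "0 < \<gamma>" "\<gamma> < 1" and T: "0 < T"
    and \<phi>: "integrable lborel \<phi>" "(LINT x|lborel. \<phi> x) = 1"
    and \<rho>: "\<forall>\<alpha>>0. 0 \<le> \<rho> \<alpha>"
      "\<forall>\<alpha>>0. \<forall>\<xi>. cmod (fourier (\<lambda>x. complex_of_real (\<phi> x)) (\<alpha> *\<^sub>R \<xi>))
               / mittag_leffler \<gamma> 1 (- ((norm \<xi>)\<^sup>2) * T powr \<gamma>) \<le> \<rho> \<alpha>"
begin

definition propagator :: "real \<Rightarrow> 'a \<Rightarrow> real" where
  "propagator t \<xi> = mittag_leffler \<gamma> 1 (- ((norm \<xi>)\<^sup>2) * t powr \<gamma>)"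

lemma propagator_pos: "0 < propagator t \<xi>" and propagator_le_1: "propagator t \<xi> \<le> 1"
  using mittag_leffler_pos[OF \<gamma>, of "(norm \<xi>)\<^sup>2 * t powr \<gamma>"]
    mittag_leffler_le_one[OF \<gamma>, of "(norm \<xi>)\<^sup>2 * t powr \<gamma>"]
  by (simp_all add: propagator_def)

text \<open>At t = 0 the argument is 0 by the convention \<open>0 powr \<gamma> = 0\<close>.\<close>

lemma propagator_0: "propagator 0 \<xi> = 1"
  using mittag_leffler_zero by (simp add: propagator_def)

lemma propagator_measurable [measurable]: "propagator t \<in> borel_measurable borel"
  unfolding propagator_def[abs_def] by measurable

definition filter_symbol :: "real \<Rightarrow> 'a \<Rightarrow> complex" where
  "filter_symbol \<alpha> \<xi> = complex_of_real ((2 * pi) powr (real DIM('a) / 2))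
     * fourier (\<lambda>x. complex_of_real (\<phi> x)) (\<alpha> *\<^sub>R \<xi>)"

definition reconstruction_symbol :: "real \<Rightarrow> 'a \<Rightarrow> complex" where
  "reconstruction_symbol \<alpha> \<xi> = filter_symbol \<alpha> \<xi> / complex_of_real (propagator T \<xi>)"

lemma filter_symbol_measurable [measurable]: "filter_symbol \<alpha> \<in> borel_measurable borel"
proof -
  have [measurable]: "\<phi> \<in> borel_measurable borel" using \<phi> by auto
  show ?thesis unfolding filter_symbol_def[abs_def] by measurable
qed

lemma reconstruction_symbol_measurable [measurable]: "reconstruction_symbol \<alpha> \<in> borel_measurable borel"
  unfolding reconstruction_symbol_def[abs_def] by measurable

lemma reconstruction_symbol_bound:
  assumes "0 < \<alpha>"
  shows "cmod (reconstruction_symbol \<alpha> \<xi>) \<le> (2 * pi) powr (real DIM('a) / 2) * \<rho> \<alpha>"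
proof -
  have "cmod (reconstruction_symbol \<alpha> \<xi>) = (2 * pi) powr (real DIM('a) / 2)
      * (cmod (fourier (\<lambda>x. complex_of_real (\<phi> x)) (\<alpha> *\<^sub>R \<xi>)) / propagator T \<xi>)"
    using propagator_pos[of T \<xi>]
    by (simp add: reconstruction_symbol_def filter_symbol_def norm_mult norm_divide)
  also have "\<dots> \<le> (2 * pi) powr (real DIM('a) / 2) * \<rho> \<alpha>"
    using \<rho>(2) assms by (intro mult_left_mono) (auto simp: propagator_def)
  finally show ?thesis .
qed

lemma mult_reconstruction_symbol_L2:
  assumes "0 < \<alpha>" "G \<in> L2_space"
  shows "(\<lambda>\<xi>. reconstruction_symbol \<alpha> \<xi> * G \<xi>) \<in> L2_space"
    and "L2_norm (\<lambda>\<xi>. reconstruction_symbol \<alpha> \<xi> * G \<xi>) \<le> (2 * pi) powr (real DIM('a) / 2) * \<rho> \<alpha> * L2_norm G"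
  using L2_bound[OF assms(2), of "\<lambda>\<xi>. reconstruction_symbol \<alpha> \<xi> * G \<xi>" "(2 * pi) powr (real DIM('a) / 2) * \<rho> \<alpha>"]
    assms \<rho>(1) reconstruction_symbol_bound[OF assms(1)]
  by (auto simp: norm_mult mult_right_mono)

text \<open>The powers of 2 pi cancel and leave the L1 norm of \<phi>. This bound does not depend on
  \<alpha>, unlike \<rho>(\<alpha>), and is the one that dominates the limit as \<alpha> tends to
  0.\<close>

lemma filter_symbol_bound: "cmod (filter_symbol \<alpha> \<xi>) \<le> (LINT x|lborel. cmod (complex_of_real (\<phi> x)))"
proof -
  have "cmod (filter_symbol \<alpha> \<xi>) \<le> (2 * pi) powr (real DIM('a) / 2)
      * ((2 * pi) powr (- real DIM('a) / 2) * (LINT x|lborel. cmod (complex_of_real (\<phi> x))))"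
    unfolding filter_symbol_def norm_mult
    using fourier_bound[of "\<lambda>x. complex_of_real (\<phi> x)"] by (intro mult_mono) auto
  also have "\<dots> = (LINT x|lborel. cmod (complex_of_real (\<phi> x)))"
    unfolding mult.assoc[symmetric] powr_add[symmetric] by simp
  finally show ?thesis .
qed

lemma filter_symbol_tendsto:
  assumes "X \<longlonglongrightarrow> 0"
  shows "(\<lambda>k. filter_symbol (X k) \<xi>) \<longlonglongrightarrow> 1"
proof -
  have "(\<lambda>k. X k *\<^sub>R \<xi>) \<longlonglongrightarrow> 0 *\<^sub>R \<xi>" by (intro tendsto_intros assms)
  then have "(\<lambda>k. fourier (\<lambda>x. complex_of_real (\<phi> x)) (X k *\<^sub>R \<xi>)) \<longlonglongrightarrow> fourier (\<lambda>x. complex_of_real (\<phi> x)) (0 *\<^sub>R \<xi>)"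
    using \<phi>(1) by (intro fourier_tendsto) auto
  moreover have "fourier (\<lambda>x. complex_of_real (\<phi> x)) (0 *\<^sub>R \<xi>) = complex_of_real ((2 * pi) powr (- real DIM('a) / 2))"
    using \<phi>(2) by (simp add: fourier_def)
  ultimately have "(\<lambda>k. filter_symbol (X k) \<xi>) \<longlonglongrightarrow>
      complex_of_real ((2 * pi) powr (real DIM('a) / 2)) * complex_of_real ((2 * pi) powr (- real DIM('a) / 2))"
    unfolding filter_symbol_def by (intro tendsto_mult_left) simp
  also have "complex_of_real ((2 * pi) powr (real DIM('a) / 2)) * complex_of_real ((2 * pi) powr (- real DIM('a) / 2)) = 1"
    unfolding of_real_mult[symmetric] powr_add[symmetric] by simp
  finally show ?thesis .
qed

lemma convolution_mollifier_has_L2_fourier: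
  assumes "0 < \<alpha>" "has_L2_fourier g G"
  shows "has_L2_fourier (fun_convolution (\<lambda>y. complex_of_real (mollifier \<phi> \<alpha> y)) g)
    (\<lambda>\<xi>. filter_symbol \<alpha> \<xi> * G \<xi>)"
  using convolution_has_L2_fourier[OF mollifier_integrable[OF \<phi>(1) assms(1)] assms(2)]
  by (simp add: filter_symbol_def fourier_mollifier[OF \<phi>(1) assms(1)])

lemma frac_heat_solutionD:
  assumes "frac_heat_solution \<gamma> T u"
  obtains U where "has_L2_fourier (u 0) (U 0)" "has_L2_fourier (u T) (U T)"
    "AE \<xi> in lborel. U T \<xi> = U 0 \<xi> * complex_of_real (propagator T \<xi>)"
  using assms T unfolding frac_heat_solution_def propagator_def by fastforce

text \<open>The final value fixes its transform up to null sets, and E > 0 lets the propagator be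
  divided out. All solutions with the same final value therefore share their initial value almost
  everywhere, which makes the reconstruction single-valued.\<close>

lemma mollified_solution_transform:
  assumes \<alpha>: "0 < \<alpha>" and g: "has_L2_fourier g G" and u: "mollified_solution \<phi> \<gamma> T \<alpha> g u"
  shows "has_L2_fourier (u 0) (\<lambda>\<xi>. reconstruction_symbol \<alpha> \<xi> * G \<xi>)"
proof -
  obtain U where U: "has_L2_fourier (u 0) (U 0)" "has_L2_fourier (u T) (U T)"
    "AE \<xi> in lborel. U T \<xi> = U 0 \<xi> * complex_of_real (propagator T \<xi>)"
    using u frac_heat_solutionD unfolding mollified_solution_def by blast
  note c = convolution_mollifier_has_L2_fourier[OF \<alpha> g]
  have "has_L2_fourier (fun_convolution (\<lambda>y. complex_of_real (mollifier \<phi> \<alpha> y)) g) (U T)"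
    using u has_L2_fourierD[OF c] has_L2_fourierD[OF U(2)]
    by (intro has_L2_fourier_cong_AE[OF U(2)]) (auto simp: mollified_solution_def)
  from has_L2_fourier_unique[OF c this] U(3)
  have "AE \<xi> in lborel. U 0 \<xi> = reconstruction_symbol \<alpha> \<xi> * G \<xi>"
  proof eventually_elim
    case (elim \<xi>)
    then show ?case using propagator_pos[of T \<xi>] by (simp add: reconstruction_symbol_def field_simps)
  qed
  then show ?thesis
    using has_L2_fourierD[OF U(1)] has_L2_fourierD[OF g]
    by (intro has_L2_fourier_cong_AE[OF U(1)]) auto
qed

text \<open>The solution is built from its initial transform W, which is in L2 by the assumed bound
  on the symbol. Running forward only multiplies by factors in (0, 1], so every \<open>U t\<close>
  is square integrable and has a preimage.\<close>

lemma mollified_solution_exists: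
  assumes \<alpha>: "0 < \<alpha>" and gL: "g \<in> L2_space"
  shows "\<exists>u. mollified_solution \<phi> \<gamma> T \<alpha> g u"
proof -
  obtain G where g: "has_L2_fourier g G" using has_L2_fourier_exists[OF gL] by blast
  have GL: "G \<in> L2_space" using has_L2_fourierD[OF g] by simp
  define W where "W \<xi> = reconstruction_symbol \<alpha> \<xi> * G \<xi>" for \<xi>
  define U where "U t \<xi> = W \<xi> * complex_of_real (propagator t \<xi>)" for t \<xi>
  have W: "W \<in> L2_space" unfolding W_def by (rule mult_reconstruction_symbol_L2(1)[OF \<alpha> GL])
  have UL: "U t \<in> L2_space" for t
    unfolding U_def
    by (rule L2_bound(1)[OF W, of _ 1])
      (use W propagator_pos[of t] propagator_le_1[of t] in \<open>auto simp: norm_mult abs_of_pos mult_left_le\<close>)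
  define c where "c = fun_convolution (\<lambda>y. complex_of_real (mollifier \<phi> \<alpha> y)) g"
  \<comment> \<open>At time T the convolution itself is taken; at other times any preimage of
    \<open>U t\<close> serves.\<close>
  define u where "u t = (if t = T then c else (SOME v. has_L2_fourier v (U t)))" for t
  have "U T = (\<lambda>\<xi>. filter_symbol \<alpha> \<xi> * G \<xi>)"
  proof
    fix \<xi>
    show "U T \<xi> = filter_symbol \<alpha> \<xi> * G \<xi>"
      using propagator_pos[of T \<xi>] by (simp add: U_def W_def reconstruction_symbol_def)
  qed
  then have "has_L2_fourier c (U T)"
    using convolution_mollifier_has_L2_fourier[OF \<alpha> g] by (simp add: c_def)
  then have "has_L2_fourier (u t) (U t)" for t
    using someI_ex[OF has_L2_fourier_surj[OF UL]] by (simp add: u_def)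
  then have "frac_heat_solution \<gamma> T u"
    unfolding frac_heat_solution_def propagator_def[symmetric]
    by (intro exI[of _ U]) (auto simp: U_def propagator_0)
  then have "mollified_solution \<phi> \<gamma> T \<alpha> g u" by (simp add: mollified_solution_def u_def c_def)
  then show ?thesis by blast
qed

text \<open>All clauses are read off on the transform side, where the map is multiplication by one
  bounded function; injectivity of the transform brings the almost everywhere identities
  back.\<close>

lemma reconstruction_bounded_linear:
  assumes \<alpha>: "0 < \<alpha>"
  shows "L2_bounded_linear_map (\<lambda>g w. \<exists>u. mollified_solution \<phi> \<gamma> T \<alpha> g u \<and> u 0 = w)"
    (is "L2_bounded_linear_map ?S")
proof -
  note transform = mollified_solution_transform[OF \<alpha>]
  have linear: "AE x in lborel. z x = a * v x + b * w x"
    if "g \<in> L2_space" "h \<in> L2_space" and S: "?S g v" "?S h w" "?S (\<lambda>x. a * g x + b * h x) z"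
    for g h a b v w z
  proof -
    obtain G H where GH: "has_L2_fourier g G" "has_L2_fourier h H"
      using has_L2_fourier_exists \<open>g \<in> L2_space\<close> \<open>h \<in> L2_space\<close> by metis
    have v: "has_L2_fourier v (\<lambda>\<xi>. reconstruction_symbol \<alpha> \<xi> * G \<xi>)"
      and w: "has_L2_fourier w (\<lambda>\<xi>. reconstruction_symbol \<alpha> \<xi> * H \<xi>)"
      and z: "has_L2_fourier z (\<lambda>\<xi>. reconstruction_symbol \<alpha> \<xi> * (a * G \<xi> + b * H \<xi>))"
      using S transform[OF GH(1)] transform[OF GH(2)] transform[OF has_L2_fourier_linear[OF GH]] by blast+
    show ?thesis
      by (rule has_L2_fourier_inj[OF z has_L2_fourier_linear[OF v w]]) (simp add: algebra_simps)
  qed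
  have unique: "AE x in lborel. v x = w x"
    if "g \<in> L2_space" "h \<in> L2_space" "AE x in lborel. g x = h x" "?S g v" "?S h w" for g h v w
  proof -
    obtain G where G: "has_L2_fourier g G" using has_L2_fourier_exists \<open>g \<in> L2_space\<close> by blast
    have "has_L2_fourier h G"
      using that has_L2_fourierD[OF G] by (intro has_L2_fourier_cong_AE[OF G]) auto
    then show ?thesis
      using that(4,5) transform[OF G] transform[of h G] by (blast intro: has_L2_fourier_inj AE_I2)
  qed
  have bounded: "w \<in> L2_space \<and> L2_norm w \<le> (2 * pi) powr (real DIM('a) / 2) * \<rho> \<alpha> * L2_norm g"
    if "g \<in> L2_space" "?S g w" for g w
  proof -
    obtain G where G: "has_L2_fourier g G" using has_L2_fourier_exists \<open>g \<in> L2_space\<close> by blast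
    have w: "has_L2_fourier w (\<lambda>\<xi>. reconstruction_symbol \<alpha> \<xi> * G \<xi>)" using that(2) transform[OF G] by blast
    show ?thesis
      using has_L2_fourierD[OF w] plancherel[OF w] plancherel[OF G]
        mult_reconstruction_symbol_L2(2)[OF \<alpha> has_L2_fourierD(2)[OF G]] by simp
  qed
  show ?thesis
    unfolding L2_bounded_linear_map_def
  proof (intro conjI ballI allI impI)
    fix g :: "'a \<Rightarrow> complex" assume "g \<in> L2_space"
    then show "\<exists>w. ?S g w" using mollified_solution_exists[OF \<alpha>] by blast
  next
    fix g h v w :: "'a \<Rightarrow> complex"
    assume "g \<in> L2_space" "h \<in> L2_space" "AE x in lborel. g x = h x" "?S g v" "?S h w"
    then show "AE x in lborel. v x = w x" by (rule unique)
  next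
    fix g h :: "'a \<Rightarrow> complex" and a b v w z
    assume "g \<in> L2_space" "h \<in> L2_space" "?S g v" "?S h w" "?S (\<lambda>x. a * g x + b * h x) z"
    then show "AE x in lborel. z x = a * v x + b * w x" by (rule linear)
  next
    show "\<exists>C. \<forall>g\<in>L2_space. \<forall>w. ?S g w \<longrightarrow> w \<in> L2_space \<and> L2_norm w \<le> C * L2_norm g"
      using bounded by blast
  qed
qed

lemma reconstruction_tendsto:
  assumes u: "frac_heat_solution \<gamma> T u"
    and w: "\<And>\<alpha>. 0 < \<alpha> \<Longrightarrow> \<exists>v. mollified_solution \<phi> \<gamma> T \<alpha> (u T) v \<and> v 0 = w \<alpha>"
  shows "L2_tendsto w (u 0) (at_right 0)"
proof -
  obtain U where U: "has_L2_fourier (u 0) (U 0)" "has_L2_fourier (u T) (U T)"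
    "AE \<xi> in lborel. U T \<xi> = U 0 \<xi> * complex_of_real (propagator T \<xi>)"
    using u frac_heat_solutionD by blast
  have L: "u 0 \<in> L2_space" "U 0 \<in> L2_space" using has_L2_fourierD[OF U(1)] by auto
  have W: "has_L2_fourier (w \<alpha>) (\<lambda>\<xi>. filter_symbol \<alpha> \<xi> * U 0 \<xi>)" if \<alpha>: "0 < \<alpha>" for \<alpha>
  proof -
    obtain v where v: "mollified_solution \<phi> \<gamma> T \<alpha> (u T) v" "v 0 = w \<alpha>" using w[OF \<alpha>] by blast
    have *: "has_L2_fourier (w \<alpha>) (\<lambda>\<xi>. reconstruction_symbol \<alpha> \<xi> * U T \<xi>)"
      using mollified_solution_transform[OF \<alpha> U(2) v(1)] v(2) by simp
    have "AE \<xi> in lborel. reconstruction_symbol \<alpha> \<xi> * U T \<xi> = filter_symbol \<alpha> \<xi> * U 0 \<xi>"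
      using U(3)
    proof eventually_elim
      case (elim \<xi>)
      then show ?case using propagator_pos[of T \<xi>] by (simp add: reconstruction_symbol_def)
    qed
    then show ?thesis
      using L has_L2_fourierD(1)[OF *] by (intro has_L2_fourier_cong_AE[OF *]) auto
  qed
  have "((\<lambda>\<alpha>. L2_norm (\<lambda>x. w \<alpha> x - u 0 x)) \<longlongrightarrow> 0) (at_right 0)"
    \<comment> \<open>Dominated convergence is applied along sequences, so the one-sided limit is
      tested on sequences of positive parameters.\<close>
    unfolding tendsto_at_iff_sequentially
  proof (intro allI impI)
    fix X :: "nat \<Rightarrow> real"
    assume X: "\<forall>i. X i \<in> {0<..} - {0}" "X \<longlonglongrightarrow> 0"
    have "L2_tendsto (\<lambda>k \<xi>. filter_symbol (X k) \<xi> * U 0 \<xi>) (U 0) sequentially"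
      by (rule L2_tendsto_multiplier[OF L(2) _ filter_symbol_tendsto[OF X(2)] filter_symbol_bound]) measurable
    moreover have "L2_norm (\<lambda>x. w (X k) x - u 0 x) = L2_norm (\<lambda>\<xi>. filter_symbol (X k) \<xi> * U 0 \<xi> - U 0 \<xi>)" for k
      using plancherel[OF has_L2_fourier_diff[OF W U(1)], of "X k"] X(1) by simp
    ultimately show "((\<lambda>\<alpha>. L2_norm (\<lambda>x. w \<alpha> x - u 0 x)) \<circ> X) \<longlonglongrightarrow> 0"
      by (simp add: L2_tendsto_def comp_def)
  qed
  moreover have "\<forall>\<^sub>F \<alpha> in at_right 0. w \<alpha> \<in> L2_space"
    using eventually_at_right_less[of 0] by eventually_elim (rule has_L2_fourierD(1)[OF W])
  ultimately show ?thesis using L by (simp add: L2_tendsto_def)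
qed

end

theorem proposition2:
  fixes \<phi> :: "'a::euclidean_space \<Rightarrow> real" and \<gamma> T :: real
  assumes "0 < \<gamma>" and "\<gamma> < 1" and "0 < T"
    and "smooth \<phi>" and "integrable lborel \<phi>" and "(LINT x|lborel. \<phi> x) = 1"
    and "\<exists>\<rho>. (\<forall>\<alpha>>0. 0 \<le> \<rho> \<alpha>) \<and>
           (\<forall>\<alpha>>0. \<forall>\<xi>. cmod (fourier (\<lambda>x. complex_of_real (\<phi> x)) (\<alpha> *\<^sub>R \<xi>))
               / mittag_leffler \<gamma> 1 (- ((norm \<xi>)\<^sup>2) * T powr \<gamma>) \<le> \<rho> \<alpha>)"
  shows "L2_regularization_method
    (\<lambda>f g. \<exists>u. frac_heat_solution \<gamma> T u \<and> u 0 = f \<and> u T = g)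
    (\<lambda>\<alpha> g w. \<exists>u. mollified_solution \<phi> \<gamma> T \<alpha> g u \<and> u 0 = w)"
proof -
  obtain \<rho> where \<rho>: "\<forall>\<alpha>>0. 0 \<le> \<rho> \<alpha>"
    "\<forall>\<alpha>>0. \<forall>\<xi>. cmod (fourier (\<lambda>x. complex_of_real (\<phi> x)) (\<alpha> *\<^sub>R \<xi>))
       / mittag_leffler \<gamma> 1 (- ((norm \<xi>)\<^sup>2) * T powr \<gamma>) \<le> \<rho> \<alpha>"
    using assms(7) by blast
  note hyps = assms(1-3,5,6) \<rho>
  show ?thesis
    unfolding L2_regularization_method_def
  proof (intro conjI allI impI)
    fix \<alpha> :: real assume "0 < \<alpha>"
    then show "L2_bounded_linear_map (\<lambda>g w. \<exists>u. mollified_solution \<phi> \<gamma> T \<alpha> g u \<and> u 0 = w)"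
      by (rule reconstruction_bounded_linear[OF hyps])
  next
    fix f g and w :: "real \<Rightarrow> 'a \<Rightarrow> complex"
    assume "\<exists>u. frac_heat_solution \<gamma> T u \<and> u 0 = f \<and> u T = g"
      and w: "\<forall>\<alpha>>0. \<exists>u. mollified_solution \<phi> \<gamma> T \<alpha> g u \<and> u 0 = w \<alpha>"
    then obtain u where "frac_heat_solution \<gamma> T u" "u 0 = f" "u T = g" by blast
    with w show "L2_tendsto w f (at_right 0)"
      using reconstruction_tendsto[OF hyps, of u w] by blast
  qed
qed

end
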